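(* Let $k\ge1$, $1\le d_1\le\dots\le d_k$, and let $\mathfrak b$ be as in the context. Let $f\in L^2\big(\mathbb R^{1+d_1+\dots+d_{k-1}};H^1(\mathbb R^{d_k})\big)$ (i.e. $f$ is square integrable in $(t,x^1,\dots,x^{k-1})$ with values in $H^1$ of the variable $x^k$) be such that $\big(\partial_t+(\mathfrak bx)\cdot\nabla\big)f=\nabla_{x^k}\cdot S$ in the sense of distributions for some $S\in L^2(\mathbb R^{1+D};\mathbb R^{d_k})$. Then $$\|f\|_{L^{2\kappa}(\mathbb R^{1+D})}\le C\big(\|\nabla_{x^k}f\|_{L^2(\mathbb R^{1+D})}+\|S\|_{L^2(\mathbb R^{1+D})}\big)$$ with $\kappa=\frac{\mathrm Q}{\mathrm Q-2}$ and $C=C(d_1,\dots,d_k,\mathfrak b)>0$.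
   Context: Variables $(t,x)=(t,x^1,\dots,x^k)\in\mathbb R\times\mathbb R^{d_1}\times\dots\times\mathbb R^{d_k}$, $D=d_1+\dots+d_k$. $\mathfrak b$ is the $D\times D$ block matrix whose only nonzero blocks are $\mathfrak b_j\in\mathbb R^{d_j\times d_{j+1}}$ in block position $(j,j+1)$, $j=1,\dots,k-1$, each $\mathfrak b_j$ a constant matrix of (maximal) rank $d_j$; thus $(\mathfrak bx)\cdot\nabla=\sum_{j=1}^{k-1}(\mathfrak b_jx^{j+1})\cdot\nabla_{x^j}$. The homogeneous dimension is $\mathrm Q=2+\sum_{j=1}^k d_j\,(1+2(k-j))$. *)

theory Defs
  imports "HOL-Analysis.Analysis"
begin

text \<open>Points of R^(1+D) are vectors of type real^'n; a bijection idx from {..<1+D} onto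
 the index type fixes the coordinate labelling: global coordinate 0 is t, and the
 r-th component (r < d j) of the block x^j (1 \<le> j \<le> k) is global coordinate gidx d j r.\<close>

definition gidx :: "(nat \<Rightarrow> nat) \<Rightarrow> nat \<Rightarrow> nat \<Rightarrow> nat" where
  "gidx d j r = 1 + (\<Sum>i\<in>{1..<j}. d i) + r"

definition partial :: "'n::finite \<Rightarrow> (real^'n \<Rightarrow> real) \<Rightarrow> real^'n \<Rightarrow> real" where
  "partial i \<phi> x = deriv (\<lambda>s. \<phi> (x + s *\<^sub>R axis i 1)) 0"

fun iter_partial :: "'n::finite list \<Rightarrow> (real^'n \<Rightarrow> real) \<Rightarrow> real^'n \<Rightarrow> real" where
  "iter_partial [] \<phi> = \<phi>"
| "iter_partial (i # is) \<phi> = partial i (iter_partial is \<phi>)"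

definition smooth_fun :: "(real^'n::finite \<Rightarrow> real) \<Rightarrow> bool" where
  "smooth_fun \<phi> \<longleftrightarrow> (\<forall>is. continuous_on UNIV (iter_partial is \<phi>) \<and>
      (\<forall>i x. (\<lambda>s. iter_partial is \<phi> (x + s *\<^sub>R axis i 1)) differentiable (at 0)))"

definition test_fun :: "(real^'n::finite \<Rightarrow> real) \<Rightarrow> bool" where
  "test_fun \<phi> \<longleftrightarrow> smooth_fun \<phi> \<and> compact (closure {x. \<phi> x \<noteq> 0})"

definition L2 :: "(real^'n::finite \<Rightarrow> real) \<Rightarrow> bool" where
  "L2 u \<longleftrightarrow> u \<in> borel_measurable lborel \<and> integrable lborel (\<lambda>x. (u x)\<^sup>2)"

definition homdim :: "nat \<Rightarrow> (nat \<Rightarrow> nat) \<Rightarrow> nat" where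
  "homdim k d = 2 + (\<Sum>j\<in>{1..k}. d j * (1 + 2 * (k - j)))"

text \<open>b_j (a d_j x d_(j+1) matrix, entries b j r c) has rank d_j, i.e. its rows are linearly independent.\<close>
definition full_row_rank :: "nat \<Rightarrow> nat \<Rightarrow> (nat \<Rightarrow> nat \<Rightarrow> real) \<Rightarrow> bool" where
  "full_row_rank m n B \<longleftrightarrow>
     (\<forall>a::nat\<Rightarrow>real. (\<forall>c<n. (\<Sum>r<m. a r * B r c) = 0) \<longrightarrow> (\<forall>r<m. a r = 0))"

end

theory Submission
  imports Defs
begin

text \<open>
  Idea: average \<open>f\<close> against a bump function \<open>\<psi>\<close> transported to the point \<open>z\<close> and the scale \<open>r\<close> by the
  translations and dilations that leave \<open>Y = \<partial>\<^sub>t + (b x) \<cdot> \<nabla>\<close> and \<open>\<nabla>\<^bsub>x\<^sup>k\<^esub>\<close> invariant. The difference of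
  the averages at the scales \<open>r\<close> and \<open>2r\<close> pairs \<open>f\<close> with a finite sum of first derivatives of compactly
  supported functions, and since iterated commutators with \<open>Y\<close> turn \<open>\<nabla>\<^bsub>x\<^sup>k\<^esub>\<close> into all space directions
  (this is where the rank condition enters), such a sum has the form \<open>Y \<phi> + \<nabla>\<^bsub>x\<^sup>k\<^esub> \<cdot> F\<close>. By the equation
  the difference is therefore at most \<open>C r\<close> times the average of \<open>|\<nabla>\<^bsub>x\<^sup>k\<^esub> f| + |S|\<close> over a kinetic ball of
  radius \<open>r\<close> and volume \<open>r\<^sup>Q\<close>. Summing over dyadic scales bounds \<open>|f|\<close> by a Riesz potential of order 1 in
  homogeneous dimension \<open>Q\<close>, which maps \<open>L\<^sup>2\<close> to \<open>L\<^sup>p\<close> with \<open>p = 2 Q / (Q - 2)\<close>.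
\<close>

subsection \<open>A class of smooth functions\<close>

text \<open>Two profiles of equal mass differ by a sum of derivatives; as both are tensor products,
  they can be exchanged one coordinate at a time, with explicit compactly supported primitives. The
  bracket argument acts on these test functions only, whose regularity is unlimited, while
  \<open>f\<close> meets the equation once, at the very end. The sum over scales closes at both ends
  for different reasons: at large scales the average of an \<open>L2\<close> function decays like
  \<open>r\<close> to the power \<open>-Q/2\<close> by Cauchy-Schwarz; at small scales the averages
  converge to \<open>f\<close> locally in L1, and a bound that is uniform in the scale passes to
  \<open>f\<close> almost everywhere. Both the decay at infinity and the summability of the
  potential over large scales rest on \<open>Q > 2\<close>, that is, on the presence of at least one
  space variable besides time. The constant \<open>C\<close> has to be fixed before the labelling
  \<open>idx\<close>. There are infinitely many functions \<open>idx\<close>, but they induce only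
  finitely many triples (time index, weights, matrix), and the largest of the corresponding
  constants serves for all.\<close>

lemma partial_has_derivative:
  assumes "(\<phi> has_derivative D) (at x)"
  shows "partial i \<phi> x = D (axis i 1)"
proof -
  have lin: "bounded_linear D" using assms by (rule has_derivative_bounded_linear)
  have "((\<lambda>s. \<phi> (x + s *\<^sub>R axis i 1)) has_derivative (\<lambda>s. D (s *\<^sub>R axis i 1))) (at 0)"
    by (rule has_derivative_compose[where g=\<phi> and f="\<lambda>s::real. x + s *\<^sub>R axis i 1", simplified])
       (auto intro!: derivative_eq_intros assms)
  then have "((\<lambda>s. \<phi> (x + s *\<^sub>R axis i 1)) has_field_derivative D (axis i 1)) (at 0)"
    by (rule has_derivative_imp_has_field_derivative)
       (simp add: linear_cmul[OF bounded_linear.linear[OF lin]])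
  then show ?thesis
    unfolding partial_def by (rule DERIV_imp_deriv)
qed

lemma partial_eq_frechet:
  "\<phi> differentiable (at x) \<Longrightarrow> partial i \<phi> x = frechet_derivative \<phi> (at x) (axis i 1)"
  by (rule partial_has_derivative) (simp add: frechet_derivative_works)

lemma has_derivative_imp_partial_sum:
  fixes \<phi> :: "real^'n::finite \<Rightarrow> real"
  assumes "(\<phi> has_derivative D) (at x)"
  shows "D v = (\<Sum>i\<in>UNIV. v $ i * partial i \<phi> x)"
proof -
  interpret D: bounded_linear D using assms by (rule has_derivative_bounded_linear)
  have "(\<Sum>i\<in>UNIV. v $ i *\<^sub>R axis i (1::real)) = v"
    using basis_expansion[of v] by (simp add: scalar_mult_eq_scaleR)
  then have "D v = D (\<Sum>i\<in>UNIV. v $ i *\<^sub>R axis i 1)"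
    by simp
  also have "\<dots> = (\<Sum>i\<in>UNIV. v $ i * D (axis i 1))"
    by (simp add: D.sum D.scaleR)
  finally show ?thesis using partial_has_derivative[OF assms] by simp
qed

lemma partial_const: "partial i (\<lambda>_. c) = (\<lambda>_. 0)"
  by (simp add: partial_def fun_eq_iff)

lemma partial_add:
  assumes "f differentiable (at x)" "g differentiable (at x)"
  shows "partial i (\<lambda>x. f x + g x) x = partial i f x + partial i g x"
proof -
  have "((\<lambda>x. f x + g x) has_derivative (\<lambda>v. frechet_derivative f (at x) v + frechet_derivative g (at x) v)) (at x)"
    using assms by (auto simp: frechet_derivative_works intro!: derivative_intros)
  from partial_has_derivative[OF this] show ?thesis by (simp add: partial_eq_frechet assms)
qed

lemma partial_mult:
  assumes "f differentiable (at x)" "g differentiable (at x)"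
  shows "partial i (\<lambda>x. f x * g x) x = f x * partial i g x + partial i f x * g x"
proof -
  have "((\<lambda>x. f x * g x) has_derivative (\<lambda>v. f x * frechet_derivative g (at x) v + frechet_derivative f (at x) v * g x)) (at x)"
    using assms by (auto simp: frechet_derivative_works intro!: derivative_eq_intros)
  from partial_has_derivative[OF this] show ?thesis by (simp add: partial_eq_frechet assms)
qed

lemma partial_cmult:
  "f differentiable (at x) \<Longrightarrow> partial i (\<lambda>x. c * f x) x = c * partial i f x"
  by (simp add: partial_mult partial_const)

lemma partial_comp:
  assumes "f differentiable (at x)" "(h has_real_derivative h') (at (f x))"
  shows "partial i (\<lambda>x. h (f x)) x = h' * partial i f x"
proof -
  have "((\<lambda>x. h (f x)) has_derivative (\<lambda>v. h' * frechet_derivative f (at x) v)) (at x)"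
    using has_derivative_compose[OF assms(1)[unfolded frechet_derivative_works] assms(2)[unfolded has_field_derivative_def]]
    by (simp add: mult.commute)
  from partial_has_derivative[OF this] show ?thesis by (simp add: partial_eq_frechet assms)
qed

lemma partial_coord: "partial i (\<lambda>x. x $ j) x = (if i = j then 1 else 0)"
proof -
  have "((\<lambda>x. x $ j) has_derivative (\<lambda>v. v $ j)) (at x)"
    by (intro bounded_linear_imp_has_derivative bounded_linear_vec_nth)
  from partial_has_derivative[OF this, of i] show ?thesis by (auto simp: axis_def)
qed

text \<open>Smoothness is generated rather than tested, so closure under differentiation and
  symmetry of second derivatives follow by structural induction. The rule for composition carries a
  whole sequence \<open>h n\<close> of successive derivatives: differentiating
  \<open>h 0 (f x)\<close> produces \<open>h (Suc 0) (f x)\<close>, which is in the class again by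
  means of the shifted sequence.\<close>

inductive smth :: "(real^'n::finite \<Rightarrow> real) \<Rightarrow> bool" where
  smth_const: "smth (\<lambda>_. c)"
| smth_coord: "smth (\<lambda>x. x $ i)"
| smth_add: "smth f \<Longrightarrow> smth g \<Longrightarrow> smth (\<lambda>x. f x + g x)"
| smth_mult: "smth f \<Longrightarrow> smth g \<Longrightarrow> smth (\<lambda>x. f x * g x)"
| smth_comp: "(\<And>n s. (h n has_real_derivative h (Suc n) s) (at s)) \<Longrightarrow> smth f \<Longrightarrow> smth (\<lambda>x. h 0 (f x))"

lemmas smth_intros = smth_const smth_coord smth_add smth_mult

lemma smth_differentiable: "smth f \<Longrightarrow> f differentiable (at x)"
proof (induction arbitrary: x rule: smth.induct)
  case (smth_comp h f)
  have "h 0 differentiable (at (f x))"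
    using smth_comp(1)[of 0 "f x"] by (auto simp: real_differentiable_def)
  then show ?case using smth_comp(3)[of x] differentiable_compose by blast
next
  case (smth_coord i)
  show ?case by (intro linear_imp_differentiable bounded_linear.linear bounded_linear_vec_nth)
qed auto

lemma smth_continuous: "smth f \<Longrightarrow> continuous_on S f"
  by (simp add: smth_differentiable differentiable_imp_continuous_on differentiable_on_def
      differentiable_at_withinI)

lemma smth_measurable [measurable_dest]: "smth f \<Longrightarrow> f \<in> borel_measurable borel"
  by (intro borel_measurable_continuous_onI smth_continuous)

lemma smth_cmult: "smth f \<Longrightarrow> smth (\<lambda>x. c * f x)"
  by (intro smth_intros)

lemma smth_minus: "smth f \<Longrightarrow> smth (\<lambda>x. - f x)"
  using smth_cmult[of f "-1"] by simp

lemma smth_diff: "smth f \<Longrightarrow> smth g \<Longrightarrow> smth (\<lambda>x. f x - g x)"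
  using smth_add[OF _ smth_minus, of f g] by simp

lemma smth_sum: "(\<And>i. i \<in> I \<Longrightarrow> smth (f i)) \<Longrightarrow> smth (\<lambda>x. \<Sum>i\<in>I. f i x)"
  by (induction I rule: infinite_finite_induct) (auto intro: smth_intros)

lemma smth_prod: "(\<And>i. i \<in> I \<Longrightarrow> smth (f i)) \<Longrightarrow> smth (\<lambda>x. \<Prod>i\<in>I. f i x)"
  by (induction I rule: infinite_finite_induct) (auto intro: smth_intros)

lemma smth_power: "smth f \<Longrightarrow> smth (\<lambda>x. f x ^ n)"
  by (induction n) (auto intro: smth_intros)

lemma smth_compose:
  fixes T :: "real^'m::finite \<Rightarrow> real^'n::finite"
  assumes "smth f" "\<And>i. smth (\<lambda>x. T x $ i)"
  shows "smth (\<lambda>x. f (T x))"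
  using assms(1)
proof (induction rule: smth.induct)
  case (smth_comp h f)
  then show ?case by (intro smth.smth_comp[where h=h])
qed (auto intro: smth_intros assms(2))

lemma smth_partial: "smth f \<Longrightarrow> smth (partial i f)"
proof (induction rule: smth.induct)
  case (smth_const c)
  then show ?case by (simp add: partial_const smth_intros)
next
  case (smth_coord j)
  have "partial i (\<lambda>x::real^'a. x $ j) = (\<lambda>_. if i = j then 1 else 0)"
    by (rule ext, rule partial_coord)
  then show ?case by (simp add: smth_intros)
next
  case (smth_add f g)
  have "partial i (\<lambda>x. f x + g x) = (\<lambda>x. partial i f x + partial i g x)"
    by (rule ext, rule partial_add) (auto intro: smth_differentiable smth_add)
  then show ?case using smth_add by (auto intro: smth_intros)
next
  case (smth_mult f g)
  have "partial i (\<lambda>x. f x * g x) = (\<lambda>x. f x * partial i g x + partial i f x * g x)"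
    by (rule ext, rule partial_mult) (auto intro: smth_differentiable smth_mult)
  then show ?case using smth_mult by (auto intro!: smth_intros)
next
  case (smth_comp h f)
  have "partial i (\<lambda>x. h 0 (f x)) = (\<lambda>x. h (Suc 0) (f x) * partial i f x)"
    by (rule ext, rule partial_comp) (auto intro: smth_differentiable smth_comp)
  moreover have "smth (\<lambda>x. h (Suc 0) (f x))"
    by (rule smth.smth_comp[where h="\<lambda>n. h (Suc n)"]) (use smth_comp in auto)
  ultimately show ?case using smth_comp by (auto intro!: smth_intros)
qed

lemma partial_commute: "smth f \<Longrightarrow> partial i (partial j f) x = partial j (partial i f) x"
proof (induction arbitrary: x rule: smth.induct)
  case (smth_const c)
  then show ?case by (simp add: partial_const)
next
  case (smth_coord k)
  have "partial a (\<lambda>x::real^'a. x $ k) = (\<lambda>_. if a = k then 1 else 0)" for a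
    by (rule ext, rule partial_coord)
  then show ?case by (simp add: partial_const)
next
  case (smth_add f g)
  have "partial a (\<lambda>x. f x + g x) = (\<lambda>x. partial a f x + partial a g x)" for a
    by (rule ext, rule partial_add) (auto intro: smth_differentiable smth_add)
  then show ?case using smth_add by (simp add: partial_add smth_differentiable smth_partial)
next
  case (smth_mult f g)
  have "partial a (\<lambda>x. f x * g x) = (\<lambda>x. f x * partial a g x + partial a f x * g x)" for a
    by (rule ext, rule partial_mult) (auto intro: smth_differentiable smth_mult)
  then show ?case using smth_mult
    by (simp add: partial_add partial_mult differentiable_mult smth_differentiable smth_partial)
next
  case (smth_comp h f)
  have *: "partial a (\<lambda>x. h 0 (f x)) = (\<lambda>x. h (Suc 0) (f x) * partial a f x)" for a
    by (rule ext, rule partial_comp) (auto intro: smth_differentiable smth_comp)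
  have **: "partial a (\<lambda>x. h (Suc 0) (f x)) x = h (Suc (Suc 0)) (f x) * partial a f x" for a
    by (rule partial_comp) (auto intro: smth_differentiable smth_comp)
  have s: "smth (\<lambda>x. h (Suc 0) (f x))"
    by (rule smth.smth_comp[where h="\<lambda>n. h (Suc n)"]) (use smth_comp in auto)
  show ?case using smth_comp s
    by (simp add: * ** partial_mult smth_differentiable smth_partial)
qed

lemma smth_iter_partial: "smth f \<Longrightarrow> smth (iter_partial is f)"
  by (induction "is") (auto intro: smth_partial)

lemma smth_imp_smooth_fun:
  assumes "smth f" shows "smooth_fun f"
  unfolding smooth_fun_def
proof (intro allI conjI)
  fix "is" :: "'a list" and i x
  show "continuous_on UNIV (iter_partial is f)"
    using assms smth_iter_partial smth_continuous by blast
  have d: "iter_partial is f differentiable at x"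
    using assms smth_iter_partial smth_differentiable by blast
  show "(\<lambda>s. iter_partial is f (x + s *\<^sub>R axis i 1)) differentiable at 0"
    by (rule differentiable_compose[where g="\<lambda>s::real. x + s *\<^sub>R axis i 1"])
       (use d in simp_all)
qed


subsection \<open>A smooth step\<close>

text \<open>The polynomial factor makes the flat function \<open>exp (-1/x)\<close> a member of a
  family that is closed under differentiation, as \<open>smth_comp\<close> requires.\<close>

definition expinv :: "real poly \<Rightarrow> real \<Rightarrow> real" where
  "expinv p x = (if x > 0 then poly p (1 / x) * exp (- (1 / x)) else 0)"

text \<open>With \<open>y = 1/x\<close> one has \<open>y' = -y^2\<close>, so the derivative of
  \<open>p(y) exp(-y)\<close> is \<open>y^2 (p(y) - p'(y)) exp(-y)\<close>.\<close>

definition expinv_diff :: "real poly \<Rightarrow> real poly" where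
  "expinv_diff p = [:0, 0, 1:] * (p - pderiv p)"

lemma tendsto_poly_exp_neg: "((\<lambda>y. poly p y * exp (- y :: real)) \<longlongrightarrow> 0) at_top"
proof -
  have "((\<lambda>y. \<Sum>i\<le>degree p. coeff p i * (y ^ i / exp y)) \<longlongrightarrow> (\<Sum>i\<le>degree p. coeff p i * 0)) at_top"
    by (intro tendsto_sum tendsto_mult tendsto_const tendsto_power_div_exp_0)
  then show ?thesis
    by (simp add: poly_altdef exp_minus sum_distrib_right divide_inverse mult.assoc)
qed

lemma expinv_has_derivative:
  "(expinv p has_real_derivative expinv (expinv_diff p) x) (at x)"
proof -
  consider "x > 0" | "x < 0" | "x = 0" by linarith
  then show ?thesis
  proof cases
    case 1
    have "((\<lambda>x. poly p (1 / x) * exp (- (1 / x))) has_real_derivative expinv (expinv_diff p) x) (at x)"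
      using 1 by (auto intro!: derivative_eq_intros poly_DERIV[THEN DERIV_chain2]
          simp: expinv_def expinv_diff_def field_simps power2_eq_square)
    then show ?thesis
      by (rule has_field_derivative_transform_within_open[where S="{0<..}"])
         (use 1 in \<open>auto simp: expinv_def\<close>)
  next
    case 2
    have "((\<lambda>x. 0) has_real_derivative expinv (expinv_diff p) x) (at x)"
      using 2 by (simp add: expinv_def)
    then show ?thesis
      by (rule has_field_derivative_transform_within_open[where S="{..<0}"])
         (use 2 in \<open>auto simp: expinv_def\<close>)
  next
    case 3
    have "((\<lambda>h. (expinv p h - expinv p 0) / h) \<longlongrightarrow> 0) (at_left 0)"
      by (rule tendsto_eventually) (auto simp: eventually_at_filter expinv_def)
    moreover have "((\<lambda>h. (expinv p h - expinv p 0) / h) \<longlongrightarrow> 0) (at_right 0)"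
    proof -
      \<comment> \<open>The right difference quotient at 0 is \<open>y p(y) exp(-y)\<close> with
        \<open>y = 1/h\<close>: dividing by \<open>h\<close> only multiplies the polynomial by the
        variable, and the exponential still wins.\<close>
      have "((\<lambda>h. poly ([:0, 1:] * p) (inverse h) * exp (- inverse h)) \<longlongrightarrow> 0) (at_right (0::real))"
        by (rule filterlim_compose[OF tendsto_poly_exp_neg filterlim_inverse_at_top_right])
      then show ?thesis
        by (rule Lim_transform_eventually)
           (auto simp: eventually_at_filter expinv_def field_simps)
    qed
    ultimately have "((\<lambda>h. (expinv p h - expinv p 0) / h) \<longlongrightarrow> 0) (at 0)"
      by (rule filterlim_split_at)
    then show ?thesis
      using 3 by (simp add: has_field_derivative_iff expinv_def)
  qed
qed

lemma smth_expinv: "smth f \<Longrightarrow> smth (\<lambda>x. expinv p (f x))"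
  using smth_comp[of "\<lambda>n. expinv ((expinv_diff ^^ n) p)" f]
  by (simp add: expinv_has_derivative)

text \<open>Composing the flat function \<open>exp (-1/x)\<close> with itself already gives a smooth step, so that
  no antiderivative of a bump function is needed.\<close>

definition step :: "real \<Rightarrow> real" where
  "step s = 1 - expinv 1 (expinv 1 1 - expinv 1 s) / expinv 1 (expinv 1 1)"

text \<open>This is the derivative of \<open>step\<close> by the chain rule. Since
  \<open>expinv_diff 1\<close> is the square of the variable, both factors are nonnegative; the
  first vanishes for arguments at least 1, the second for arguments at most 0, and the total mass is
  \<open>step 1 - step 0 = 1\<close>.\<close>

definition bump :: "real \<Rightarrow> real" where
  "bump s = expinv (expinv_diff 1) (expinv 1 1 - expinv 1 s) * expinv (expinv_diff 1) s
     / expinv 1 (expinv 1 1)"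

lemma expinv_1_pos: "s > 0 \<Longrightarrow> expinv 1 s > 0"
  by (simp add: expinv_def)

lemma expinv_1_1_pos: "expinv 1 (expinv 1 1) > 0"
  by (intro expinv_1_pos) simp

lemma expinv_1_mono: "s \<ge> 1 \<Longrightarrow> expinv 1 s \<ge> expinv 1 1"
  by (simp add: expinv_def)

lemma expinv_diff_1_nonneg: "expinv (expinv_diff 1) s \<ge> 0"
  by (simp add: expinv_def expinv_diff_def)

lemma step_has_derivative: "(step has_real_derivative bump s) (at s)"
proof -
  have [simp]: "expinv 1 (expinv 1 1) \<noteq> 0"
    using expinv_1_1_pos by linarith
  have "((\<lambda>s. 1 - expinv 1 (expinv 1 1 - expinv 1 s) / expinv 1 (expinv 1 1)) has_real_derivative bump s) (at s)"
    by (auto intro!: derivative_eq_intros DERIV_chain2[OF expinv_has_derivative] expinv_has_derivative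
        simp: bump_def)
  then show ?thesis by (simp add: step_def[abs_def])
qed

lemma step_eq_0: "s \<le> 0 \<Longrightarrow> step s = 0"
proof -
  assume "s \<le> 0"
  then have "expinv 1 s = 0" by (simp add: expinv_def)
  moreover have "expinv 1 (expinv 1 1) \<noteq> 0"
    using expinv_1_1_pos by linarith
  ultimately show ?thesis unfolding step_def by simp
qed

lemma step_eq_1: "s \<ge> 1 \<Longrightarrow> step s = 1"
  using expinv_1_mono[of s] by (simp add: step_def expinv_def[of 1 "expinv 1 1 - expinv 1 s"])

lemma bump_nonneg: "bump s \<ge> 0"
  unfolding bump_def
  by (intro divide_nonneg_nonneg mult_nonneg_nonneg expinv_diff_1_nonneg)
     (simp add: expinv_def)

lemma bump_eq_0: "s \<notin> {0..1} \<Longrightarrow> bump s = 0"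
  using expinv_1_mono[of s]
  by (cases "s \<le> 0") (simp_all add: bump_def expinv_def[of "expinv_diff 1" s]
      expinv_def[of "expinv_diff 1" "expinv 1 1 - expinv 1 s"])

lemma smth_step: "smth f \<Longrightarrow> smth (\<lambda>x. step (f x))"
  unfolding step_def divide_inverse
  by (intro smth_diff smth_const smth_mult smth_expinv)

lemma smth_bump: "smth f \<Longrightarrow> smth (\<lambda>x. bump (f x))"
  unfolding bump_def divide_inverse
  by (intro smth_diff smth_const smth_mult smth_expinv)

lemma bump_measurable [measurable]: "bump \<in> borel_measurable borel"
proof -
  have "continuous_on UNIV (expinv p)" for p
    by (rule DERIV_continuous_on) (rule expinv_has_derivative)
  note [continuous_intros] = continuous_on_compose2[OF this]
  show ?thesis
    unfolding bump_def[abs_def] divide_inverse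
    by (intro borel_measurable_continuous_onI continuous_intros subset_UNIV)
qed

lemma nn_integral_bump: "(\<integral>\<^sup>+s. ennreal (bump s) \<partial>lborel) = 1"
proof -
  have "(\<integral>\<^sup>+s. ennreal (bump s) * indicator {0..1} s \<partial>lborel) = ennreal (step 1 - step 0)"
    by (rule nn_integral_FTC_Icc) (auto intro: bump_nonneg step_has_derivative[THEN DERIV_subset] step_has_derivative)
  also have "(\<integral>\<^sup>+s. ennreal (bump s) * indicator {0..1} s \<partial>lborel) = (\<integral>\<^sup>+s. ennreal (bump s) \<partial>lborel)"
    by (rule nn_integral_cong) (auto simp: bump_eq_0 indicator_def)
  finally show ?thesis by (simp add: step_eq_0 step_eq_1)
qed

abbreviation cube :: "real \<Rightarrow> (real^'n::finite) set" where
  "cube c \<equiv> {x. \<forall>i. \<bar>x $ i\<bar> \<le> c}"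

abbreviation dyadic :: "int \<Rightarrow> real" where
  "dyadic m \<equiv> 2 powr real_of_int m"

subsection \<open>Sums over dyadic scales\<close>

lemma nn_integral_powr_atLeast_int:
  assumes "\<beta> > 0"
  shows "(\<integral>\<^sup>+m\<in>{M..}. ennreal (2 powr (- \<beta> * real_of_int m)) \<partial>count_space UNIV)
    = ennreal (2 powr (- \<beta> * real_of_int M) / (1 - 2 powr - \<beta>))"
proof -
  have bij: "bij_betw (\<lambda>n. M + int n) UNIV {M..}"
    by (rule bij_betwI[where g="\<lambda>m. nat (m - M)"]) auto
  have lt1: "2 powr - \<beta> < 1"
    using powr_less_mono[of "- \<beta>" 0 2] assms by simp
  have "(\<integral>\<^sup>+m\<in>{M..}. ennreal (2 powr (- \<beta> * real_of_int m)) \<partial>count_space UNIV)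
      = (\<integral>\<^sup>+m. ennreal (2 powr (- \<beta> * real_of_int m)) \<partial>count_space {M..})"
    by (simp add: nn_integral_count_space_indicator)
  also have "\<dots> = (\<Sum>n. ennreal (2 powr (- \<beta> * real_of_int (M + int n))))"
    by (simp only: nn_integral_bij_count_space[OF bij, symmetric] nn_integral_count_space_nat)
  also have "\<dots> = (\<Sum>n. ennreal (2 powr (- \<beta> * real_of_int M) * (2 powr - \<beta>) ^ n))"
  proof (intro suminf_cong arg_cong[where f=ennreal])
    fix n
    have "(2 powr - \<beta>) ^ n = 2 powr (- \<beta> * real n)"
      by (simp add: powr_realpow[symmetric] powr_powr)
    then show "2 powr (- \<beta> * real_of_int (M + int n)) = 2 powr (- \<beta> * real_of_int M) * (2 powr - \<beta>) ^ n"
      by (simp add: powr_add[symmetric] algebra_simps)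
  qed
  also have "\<dots> = ennreal (2 powr (- \<beta> * real_of_int M) * (1 / (1 - 2 powr - \<beta>)))"
    using lt1 by (intro suminf_ennreal_eq sums_mult geometric_sums) auto
  finally show ?thesis by simp
qed

lemma nn_integral_powr_lessThan_int:
  "(\<integral>\<^sup>+m\<in>{..<M}. ennreal (dyadic m) \<partial>count_space UNIV) = ennreal (dyadic M)"
proof -
  have bij: "bij_betw uminus {1 - M..} {..<M}"
    by (rule bij_betwI[where g=uminus]) auto
  have "(\<integral>\<^sup>+m\<in>{..<M}. ennreal (dyadic m) \<partial>count_space UNIV)
      = (\<integral>\<^sup>+m. ennreal (dyadic m) \<partial>count_space {..<M})"
    by (simp add: nn_integral_count_space_indicator)
  also have "\<dots> = (\<integral>\<^sup>+m. ennreal (2 powr (- 1 * real_of_int m)) \<partial>count_space {1 - M..})"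
    by (subst nn_integral_bij_count_space[OF bij, symmetric]) simp
  also have "\<dots> = (\<integral>\<^sup>+m\<in>{1 - M..}. ennreal (2 powr (- 1 * real_of_int m)) \<partial>count_space UNIV)"
    by (simp add: nn_integral_count_space_indicator)
  also have "\<dots> = ennreal (2 powr (- 1 * real_of_int (1 - M)) / (1 - 2 powr - 1))"
    by (rule nn_integral_powr_atLeast_int) simp
  also have "2 powr (- 1 * real_of_int (1 - M)) / (1 - 2 powr - 1) = dyadic M"
    by (simp add: powr_diff powr_minus)
  finally show ?thesis .
qed

text \<open>The witness is the least integer \<open>M\<close> satisfying the strict inequality,
  which is why the other one, at \<open>M - 1\<close>, is not strict. It selects the scale at which
  a geometric sequence crosses a given level.\<close>

lemma exists_dyadic_scale:
  assumes "\<beta> > 0" "x > 0"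
  obtains M :: int where "2 powr (- \<beta> * real_of_int M) < x" "x \<le> 2 powr (- \<beta> * real_of_int (M - 1))"
proof
  define M where "M = \<lfloor>- log 2 x / \<beta>\<rfloor> + 1"
  have "- log 2 x / \<beta> < M" by (simp add: M_def)
  then have "- \<beta> * M < log 2 x" using assms by (simp add: field_simps)
  then show "2 powr (- \<beta> * real_of_int M) < x"
    using assms by (simp add: less_log_iff)
  have "M - 1 \<le> - log 2 x / \<beta>" by (simp add: M_def)
  then have "log 2 x \<le> - \<beta> * (M - 1)" using assms by (simp add: field_simps)
  then show "x \<le> 2 powr (- \<beta> * real_of_int (M - 1))"
    using assms by (simp add: log_le_iff)
qed

text \<open>A geometric series is comparable to its largest term, and that term is below
  \<open>x\<close>. In the potential estimate this sum over scales yields one of the two factors in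
  the square of \<open>G\<close>.\<close>

lemma nn_integral_powr_less:
  assumes "\<beta> > 0" "x \<ge> 0"
  shows "(\<integral>\<^sup>+m\<in>{m. 2 powr (- \<beta> * real_of_int m) < x}. ennreal (2 powr (- \<beta> * real_of_int m)) \<partial>count_space UNIV)
    \<le> ennreal (x / (1 - 2 powr - \<beta>))"
proof (cases "x = 0")
  case False
  then obtain M where M: "2 powr (- \<beta> * real_of_int M) < x" "x \<le> 2 powr (- \<beta> * real_of_int (M - 1))"
    using exists_dyadic_scale[of \<beta> x] assms by auto
  have "{m. 2 powr (- \<beta> * real_of_int m) < x} \<subseteq> {M..}"
  proof
    fix m :: int
    assume "m \<in> {m. 2 powr (- \<beta> * real_of_int m) < x}"
    then have "2 powr (- \<beta> * real_of_int m) < x" by blast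
    then have "2 powr (- \<beta> * real_of_int m) < 2 powr (- \<beta> * real_of_int (M - 1))"
      using M(2) by (rule less_le_trans)
    then have "- \<beta> * real_of_int m < - \<beta> * real_of_int (M - 1)"
      by (simp only: powr_less_cancel_iff)
    then have "real_of_int (M - 1) < real_of_int m"
      using assms(1) by (simp only: mult_minus_left neg_less_iff_less mult_less_cancel_left_pos)
    then show "m \<in> {M..}" by simp
  qed
  then have "(\<integral>\<^sup>+m\<in>{m. 2 powr (- \<beta> * real_of_int m) < x}. ennreal (2 powr (- \<beta> * real_of_int m)) \<partial>count_space UNIV)
     \<le> (\<integral>\<^sup>+m\<in>{M..}. ennreal (2 powr (- \<beta> * real_of_int m)) \<partial>count_space UNIV)"
    by (intro nn_integral_mono) (auto simp: indicator_def)
  also have "\<dots> = ennreal (2 powr (- \<beta> * real_of_int M) / (1 - 2 powr - \<beta>))"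
    by (rule nn_integral_powr_atLeast_int[OF assms(1)])
  also have "\<dots> \<le> ennreal (x / (1 - 2 powr - \<beta>))"
    using M(1) powr_less_mono[of "- \<beta>" 0 2] assms by (intro ennreal_leI divide_right_mono) auto
  finally show ?thesis .
qed (simp add: not_less)

lemma ennreal_power2_le_imp_le:
  assumes "x\<^sup>2 \<le> (ennreal y)\<^sup>2" "y \<ge> 0"
  shows "x \<le> ennreal y"
proof (cases x)
  case (real r)
  then show ?thesis using assms
    by (auto simp: ennreal_power intro!: ennreal_leI power2_le_imp_le)
next
  case top
  then show ?thesis using assms by (simp add: ennreal_power top_unique)
qed

subsection \<open>A Hardy--Littlewood--Sobolev inequality for dyadic kernels\<close>

text \<open>The model is the indicator of a ball of radius \<open>dyadic m\<close> divided by its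
  volume, which scales with exponent \<open>Q\<close>. Row and column bounds are separate
  assumptions because membership of \<open>w\<close> in the ball around \<open>z\<close> need not be
  symmetric.\<close>

locale dyadic_kernel = sigma_finite_measure M for M :: "'a measure" +
  fixes k :: "int \<Rightarrow> 'a \<Rightarrow> 'a \<Rightarrow> ennreal" and Q C :: real
  assumes k_measurable [measurable]: "\<And>m. (\<lambda>(z, w). k m z w) \<in> borel_measurable (M \<Otimes>\<^sub>M M)"
    and Q_gt_2: "Q > 2" and C_pos: "C > 0"
    and k_row: "\<And>m z. z \<in> space M \<Longrightarrow> (\<integral>\<^sup>+w. k m z w \<partial>M) \<le> ennreal C"
    and k_col: "\<And>m w. w \<in> space M \<Longrightarrow> (\<integral>\<^sup>+z. k m z w \<partial>M) \<le> ennreal C"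
    and k_sup: "\<And>m z w. z \<in> space M \<Longrightarrow> w \<in> space M \<Longrightarrow> k m z w \<le> ennreal (C * 2 powr (- Q * real_of_int m))"
begin

sublocale pair: pair_sigma_finite M M ..

definition avg :: "int \<Rightarrow> ('a \<Rightarrow> ennreal) \<Rightarrow> 'a \<Rightarrow> ennreal" where
  "avg m G z = (\<integral>\<^sup>+w. k m z w * G w \<partial>M)"

text \<open>For \<open>I = UNIV\<close> this is a discrete Riesz potential: the factor
  \<open>dyadic m\<close> makes its order 1. A general \<open>I\<close> permits cutting at a
  scale.\<close>

definition pot :: "int set \<Rightarrow> ('a \<Rightarrow> ennreal) \<Rightarrow> 'a \<Rightarrow> ennreal" where
  "pot I G z = (\<integral>\<^sup>+m\<in>I. (ennreal (dyadic m) * avg m G z) \<partial>count_space UNIV)"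

lemma k_measurable2 [measurable]: "w \<in> space M \<Longrightarrow> (\<lambda>z. k m z w) \<in> borel_measurable M"
  "z \<in> space M \<Longrightarrow> (\<lambda>w. k m z w) \<in> borel_measurable M"
  using measurable_Pair2[OF k_measurable[of m], of z] measurable_Pair1[OF k_measurable[of m], of w]
  by auto

lemma avg_measurable [measurable]:
  assumes [measurable]: "G \<in> borel_measurable M"
  shows "avg m G \<in> borel_measurable M"
proof -
  have "(\<lambda>(z, w). k m z w * G w) \<in> borel_measurable (M \<Otimes>\<^sub>M M)"
    by (simp add: split_beta') measurable
  from borel_measurable_nn_integral[OF this] show ?thesis by (simp add: avg_def[abs_def])
qed

lemma nn_integral_int_measurable:
  fixes F :: "int \<Rightarrow> 'a \<Rightarrow> ennreal"
  assumes "\<And>m. F m \<in> borel_measurable M"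
  shows "(\<lambda>z. \<integral>\<^sup>+m. F m z \<partial>count_space UNIV) \<in> borel_measurable M"
proof -
  have "(\<integral>\<^sup>+m. F m z \<partial>count_space UNIV) = (\<Sum>n. F (int_decode n) z)" for z
    by (simp only: nn_integral_bij_count_space[OF bij_int_decode, symmetric] nn_integral_count_space_nat)
  then show ?thesis using assms by simp
qed

lemma pot_measurable [measurable]:
  assumes [measurable]: "G \<in> borel_measurable M"
  shows "pot I G \<in> borel_measurable M"
  unfolding pot_def[abs_def] by (rule nn_integral_int_measurable) measurable

lemma avg_le_sup:
  assumes "z \<in> space M" "\<And>w. w \<in> space M \<Longrightarrow> G w \<le> ennreal s"
  shows "avg m G z \<le> ennreal C * ennreal s"
proof -
  have "avg m G z \<le> (\<integral>\<^sup>+w. k m z w * ennreal s \<partial>M)"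
    unfolding avg_def using assms by (intro nn_integral_mono mult_left_mono) auto
  also have "\<dots> = (\<integral>\<^sup>+w. k m z w \<partial>M) * ennreal s"
    using assms(1) by (simp add: nn_integral_multc)
  also have "\<dots> \<le> ennreal C * ennreal s"
    by (intro mult_right_mono k_row assms) auto
  finally show ?thesis .
qed

lemma nn_integral_avg_le:
  assumes [measurable]: "G \<in> borel_measurable M"
  shows "(\<integral>\<^sup>+z. avg m G z \<partial>M) \<le> ennreal C * (\<integral>\<^sup>+w. G w \<partial>M)"
proof -
  have m: "(\<lambda>(z, w). k m z w * G w) \<in> borel_measurable (M \<Otimes>\<^sub>M M)"
    by (simp add: split_beta') measurable
  have "(\<integral>\<^sup>+z. avg m G z \<partial>M) = (\<integral>\<^sup>+w. \<integral>\<^sup>+z. k m z w * G w \<partial>M \<partial>M)"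
    unfolding avg_def by (rule pair.Fubini'[symmetric, OF m])
  also have "\<dots> = (\<integral>\<^sup>+w. (\<integral>\<^sup>+z. k m z w \<partial>M) * G w \<partial>M)"
    by (intro nn_integral_cong nn_integral_multc) auto
  also have "\<dots> \<le> (\<integral>\<^sup>+w. ennreal C * G w \<partial>M)"
    by (intro nn_integral_mono mult_right_mono k_col) auto
  also have "\<dots> = ennreal C * (\<integral>\<^sup>+w. G w \<partial>M)"
    by (rule nn_integral_cmult) auto
  finally show ?thesis .
qed

text \<open>Cauchy-Schwarz, with the square integral of the kernel bounded by its supremum times its
  mass, hence of order \<open>2 powr (- Q * m)\<close>; the square root halves the exponent.\<close>

lemma avg_le_L2:
  assumes [measurable]: "G \<in> borel_measurable M" and z: "z \<in> space M"
    and N: "(\<integral>\<^sup>+w. (G w)\<^sup>2 \<partial>M) \<le> ennreal (N\<^sup>2)" "N \<ge> 0"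
  shows "avg m G z \<le> ennreal (C * N * 2 powr (- (Q / 2) * real_of_int m))"
proof (rule ennreal_power2_le_imp_le)
  have "(\<integral>\<^sup>+w. (k m z w)\<^sup>2 \<partial>M) \<le> (\<integral>\<^sup>+w. ennreal (C * 2 powr (- Q * real_of_int m)) * k m z w \<partial>M)"
    unfolding power2_eq_square by (intro nn_integral_mono mult_right_mono k_sup z) auto
  also have "\<dots> = ennreal (C * 2 powr (- Q * real_of_int m)) * (\<integral>\<^sup>+w. k m z w \<partial>M)"
    using z by (intro nn_integral_cmult) auto
  also have "\<dots> \<le> ennreal (C * 2 powr (- Q * real_of_int m)) * ennreal C"
    by (intro mult_left_mono k_row z) auto
  finally have k2: "(\<integral>\<^sup>+w. (k m z w)\<^sup>2 \<partial>M) \<le> ennreal (C * 2 powr (- Q * real_of_int m)) * ennreal C" .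
  have "(avg m G z)\<^sup>2 \<le> (\<integral>\<^sup>+w. (k m z w)\<^sup>2 \<partial>M) * (\<integral>\<^sup>+w. (G w)\<^sup>2 \<partial>M)"
    unfolding avg_def using z by (intro Cauchy_Schwarz_nn_integral) auto
  also have "\<dots> \<le> (ennreal (C * 2 powr (- Q * real_of_int m)) * ennreal C) * ennreal (N\<^sup>2)"
    by (intro mult_mono k2 N) auto
  also have "\<dots> = ennreal ((C * N * 2 powr (- (Q / 2) * real_of_int m))\<^sup>2)"
  proof -
    have "(2 powr (- (Q / 2) * real_of_int m))\<^sup>2 = 2 powr (- Q * real_of_int m)"
      by (simp add: power2_eq_square powr_add[symmetric])
    then show ?thesis
      using C_pos by (simp add: ennreal_mult[symmetric] power_mult_distrib) (simp add: power2_eq_square algebra_simps)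
  qed
  finally show "(avg m G z)\<^sup>2 \<le> (ennreal (C * N * 2 powr (- (Q / 2) * real_of_int m)))\<^sup>2"
    using C_pos N by (simp add: ennreal_power)
qed (use C_pos N in auto)

text \<open>The gain \<open>dyadic m\<close> competes with the decay
  \<open>2 powr (- (Q/2) * m)\<close> of \<open>avg_le_L2\<close>; since \<open>Q > 2\<close> the
  product has the negative exponent \<open>-(Q/2 - 1)\<close>, so the large scales sum to a multiple
  of their first term.\<close>

lemma pot_atLeast_le:
  assumes [measurable]: "G \<in> borel_measurable M" and z: "z \<in> space M"
    and N: "(\<integral>\<^sup>+w. (G w)\<^sup>2 \<partial>M) \<le> ennreal (N\<^sup>2)" "N \<ge> 0"
  shows "pot {m0..} G z \<le> ennreal (C * N / (1 - 2 powr - (Q / 2 - 1)) * 2 powr (- (Q / 2 - 1) * real_of_int m0))"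
proof -
  have "pot {m0..} G z \<le> (\<integral>\<^sup>+m\<in>{m0..}. (ennreal (C * N) * ennreal (2 powr (- (Q / 2 - 1) * real_of_int m))) \<partial>count_space UNIV)"
    unfolding pot_def
  proof (intro nn_integral_mono mult_right_mono)
    fix m :: int
    have "ennreal (dyadic m) * avg m G z
       \<le> ennreal (dyadic m) * ennreal (C * N * 2 powr (- (Q / 2) * real_of_int m))"
      by (intro mult_left_mono avg_le_L2 assms) auto
    also have "\<dots> = ennreal (C * N) * ennreal (2 powr (- (Q / 2 - 1) * real_of_int m))"
    proof -
      have "dyadic m * 2 powr (- (Q / 2) * real_of_int m) = 2 powr (- (Q / 2 - 1) * real_of_int m)"
        by (simp add: powr_add[symmetric] algebra_simps)
      then show ?thesis using C_pos N
        by (simp add: ennreal_mult[symmetric] mult.left_commute)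
    qed
    finally show "ennreal (dyadic m) * avg m G z
       \<le> ennreal (C * N) * ennreal (2 powr (- (Q / 2 - 1) * real_of_int m))" .
  qed simp
  also have "\<dots> = ennreal (C * N) * (\<integral>\<^sup>+m\<in>{m0..}. ennreal (2 powr (- (Q / 2 - 1) * real_of_int m)) \<partial>count_space UNIV)"
    by (simp add: mult.assoc nn_integral_cmult)
  also have "\<dots> = ennreal (C * N) * ennreal (2 powr (- (Q / 2 - 1) * real_of_int m0) / (1 - 2 powr - (Q / 2 - 1)))"
    using Q_gt_2 by (subst nn_integral_powr_atLeast_int) auto
  finally show ?thesis
    using C_pos N by (simp add: ennreal_mult'[symmetric])
qed

lemma pot_lessThan_le:
  assumes z: "z \<in> space M" and s: "\<And>w. w \<in> space M \<Longrightarrow> G w \<le> ennreal s" "s \<ge> 0"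
  shows "pot {..<m0} G z \<le> ennreal (C * s * dyadic m0)"
proof -
  have "pot {..<m0} G z \<le> (\<integral>\<^sup>+m\<in>{..<m0}. (ennreal (dyadic m) * (ennreal C * ennreal s)) \<partial>count_space UNIV)"
    unfolding pot_def by (intro nn_integral_mono mult_right_mono mult_left_mono avg_le_sup z s) auto
  also have "\<dots> = (\<integral>\<^sup>+m. ennreal C * ennreal s * (ennreal (dyadic m) * indicator {..<m0} m) \<partial>count_space UNIV)"
    by (simp add: mult_ac)
  also have "\<dots> = ennreal C * ennreal s * (\<integral>\<^sup>+m\<in>{..<m0}. ennreal (dyadic m) \<partial>count_space UNIV)"
    by (rule nn_integral_cmult) auto
  also have "\<dots> = ennreal C * ennreal s * ennreal (dyadic m0)"
    by (subst nn_integral_powr_lessThan_int) auto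
  finally show ?thesis
    using C_pos s by (simp add: ennreal_mult[symmetric])
qed

text \<open>Averaging is bounded on L1 by the column bound, uniformly in the scale, so only the sum
  of \<open>dyadic m\<close> over \<open>m < m0\<close> remains, which equals
  \<open>dyadic m0\<close>.\<close>

lemma nn_integral_pot_lessThan_le:
  assumes [measurable]: "G \<in> borel_measurable M"
  shows "(\<integral>\<^sup>+z. pot {..<m0} G z \<partial>M) \<le> ennreal (C * dyadic m0) * (\<integral>\<^sup>+w. G w \<partial>M)"
proof -
  have "(\<integral>\<^sup>+z. pot {..<m0} G z \<partial>M)
     = (\<integral>\<^sup>+m. (\<integral>\<^sup>+z. ennreal (dyadic m) * avg m G z * indicator {..<m0} m \<partial>M) \<partial>count_space UNIV)"
    unfolding pot_def by (rule nn_integral_count_space_nn_integral) auto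
  also have "\<dots> \<le> (\<integral>\<^sup>+m. (ennreal C * (\<integral>\<^sup>+w. G w \<partial>M)) * (ennreal (dyadic m) * indicator {..<m0} m) \<partial>count_space UNIV)"
  proof (rule nn_integral_mono)
    fix m :: int
    have "(\<integral>\<^sup>+z. ennreal (dyadic m) * avg m G z * indicator {..<m0} m \<partial>M)
       = ennreal (dyadic m) * (\<integral>\<^sup>+z. avg m G z \<partial>M) * indicator {..<m0} m"
      by (simp add: nn_integral_cmult nn_integral_multc)
    also have "\<dots> \<le> ennreal (dyadic m) * (ennreal C * (\<integral>\<^sup>+w. G w \<partial>M)) * indicator {..<m0} m"
      by (intro mult_right_mono mult_left_mono nn_integral_avg_le) auto
    finally show "(\<integral>\<^sup>+z. ennreal (dyadic m) * avg m G z * indicator {..<m0} m \<partial>M)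
       \<le> (ennreal C * (\<integral>\<^sup>+w. G w \<partial>M)) * (ennreal (dyadic m) * indicator {..<m0} m)"
      by (simp add: mult_ac)
  qed
  also have "\<dots> = (ennreal C * (\<integral>\<^sup>+w. G w \<partial>M)) * ennreal (dyadic m0)"
    by (simp add: nn_integral_cmult nn_integral_powr_lessThan_int)
  finally show ?thesis
    using C_pos by (simp add: ennreal_mult mult_ac)
qed

lemma pot_split:
  assumes [measurable]: "G \<in> borel_measurable M" and z: "z \<in> space M"
  shows "pot UNIV G z = pot {..<m0} G z + pot {m0..} G z"
proof -
  have "pot {..<m0} G z + pot {m0..} G z = 
    (\<integral>\<^sup>+m. ennreal (dyadic m) * avg m G z * indicator {..<m0} m +
       ennreal (dyadic m) * avg m G z * indicator {m0..} m \<partial>count_space UNIV)"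
    unfolding pot_def by (rule nn_integral_add[symmetric]) auto
  also have "\<dots> = pot UNIV G z"
    unfolding pot_def by (rule nn_integral_cong) (auto simp: indicator_def)
  finally show ?thesis by simp
qed

lemma pot_add:
  assumes [measurable]: "G \<in> borel_measurable M" "H \<in> borel_measurable M" and z: "z \<in> space M"
  shows "pot I (\<lambda>w. G w + H w) z = pot I G z + pot I H z"
proof -
  have "avg m (\<lambda>w. G w + H w) z = avg m G z + avg m H z" for m
    unfolding avg_def distrib_left using z by (intro nn_integral_add) auto
  then show ?thesis
    unfolding pot_def by (subst nn_integral_add[symmetric]) (auto simp: distrib_left distrib_right)
qed


text \<open>At a point where the potential is comparable to \<open>\<lambda>\<^sub>m = L 2\<^sup>-\<^sup>a\<^sup>m\<close>, the scales above \<open>m\<close> and the part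
  of \<open>G\<close> below a suitable height contribute at most \<open>2 \<lambda>\<^sub>m\<close>; hence the part of \<open>G\<close> above
  that height alone, at scales below \<open>m\<close>, controls the potential, and it can be summed in \<open>L\<^sup>1\<close>.\<close>

theorem pot_strong_type:
  defines "p \<equiv> 2 * Q / (Q - 2)"
  obtains C' where "C' > 0"
    and "\<And>G N. G \<in> borel_measurable M \<Longrightarrow> (\<And>w. G w \<ge> (0::real)) \<Longrightarrow> N > 0 \<Longrightarrow>
        (\<integral>\<^sup>+w. (ennreal (G w))\<^sup>2 \<partial>M) \<le> ennreal (N\<^sup>2) \<Longrightarrow>
        \<exists>H \<in> borel_measurable M.
          (\<forall>z\<in>space M. \<forall>y\<ge>0. ennreal y \<le> pot UNIV (\<lambda>w. ennreal (G w)) z \<longrightarrow> ennreal (y powr p) \<le> H z) \<and>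
          (\<integral>\<^sup>+z. H z \<partial>M) \<le> ennreal (C' * N powr (p - 2)) * (\<integral>\<^sup>+w. (ennreal (G w))\<^sup>2 \<partial>M)"
proof -
  define a where "a = Q / 2 - 1"
  have a: "a > 0" using Q_gt_2 by (simp add: a_def)
  have p: "p > 2" using Q_gt_2 by (simp add: p_def field_simps)
  \<comment> \<open>This identity singles out the exponent \<open>p\<close>: it gives the weights
    \<open>kap m\<close>, once multiplied by \<open>dyadic m\<close>, the same decay in
    \<open>m\<close> as the heights \<open>s m\<close>.\<close>
  have ap: "a * (p - 1) = Q / 2 + 1" using Q_gt_2 by (simp add: a_def p_def field_simps)
  define d0 where "d0 = 1 - 2 powr - a"
  define d1 where "d1 = 1 - 2 powr - (Q / 2)"
  have d: "d0 > 0" "d1 > 0"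
    using powr_less_mono[of "- a" 0 2] powr_less_mono[of "- (Q / 2)" 0 2] a Q_gt_2 by (auto simp: d0_def d1_def)
  \<comment> \<open>The leading 3 and the inner 3 come from the splitting into thirds,
    \<open>2 powr a\<close> from the gap between consecutive scales. One \<open>C\<close> is the L1
    bound, the other comes from the height \<open>s m\<close>; \<open>C / d0\<close> is
    \<open>L / N\<close>, and \<open>1 / d1\<close> is a geometric sum.\<close>
  define C' where "C' = 3 * C\<^sup>2 * (3 * 2 powr a) powr (p - 1) * (C / d0) powr (p - 2) / d1"
  have "C' > 0" using C_pos d by (simp add: C'_def)
  moreover have "\<exists>H \<in> borel_measurable M.
      (\<forall>z\<in>space M. \<forall>y\<ge>0. ennreal y \<le> pot UNIV (\<lambda>w. ennreal (G w)) z \<longrightarrow> ennreal (y powr p) \<le> H z) \<and>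
      (\<integral>\<^sup>+z. H z \<partial>M) \<le> ennreal (C' * N powr (p - 2)) * (\<integral>\<^sup>+w. (ennreal (G w))\<^sup>2 \<partial>M)"
    if G [measurable]: "G \<in> borel_measurable M" and G0: "\<And>w. G w \<ge> (0::real)" and N: "N > 0"
      and GN: "(\<integral>\<^sup>+w. (ennreal (G w))\<^sup>2 \<partial>M) \<le> ennreal (N\<^sup>2)" for G N
  proof -
    \<comment> \<open>Chosen so that \<open>lam m\<close> is precisely the bound of
      \<open>pot_atLeast_le\<close> for the scales from \<open>m\<close> on.\<close>
    define L where "L = C * N / d0"
    have L: "L > 0" using C_pos N d by (simp add: L_def)
    define lam where "lam m = L * 2 powr (- a * real_of_int m)" for m :: int
    \<comment> \<open>The height for which the part of \<open>G\<close> below it contributes at most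
      \<open>lam m\<close> at the scales below \<open>m\<close>; this is the identity
      \<open>s_lam\<close>.\<close>
    define s where "s m = L / C * 2 powr (- (Q / 2) * real_of_int m)" for m :: int
    \<comment> \<open>If \<open>y\<close> is at most \<open>3 * lam (m - 1)\<close>, then
      \<open>y powr p = 3 * y powr (p - 1) * (y / 3)\<close> is at most \<open>kap m\<close> times
      \<open>y / 3\<close>.\<close>
    define kap where "kap m = 3 * (3 * lam (m - 1)) powr (p - 1)" for m
    have lam_pos: "lam m > 0" for m using L by (simp add: lam_def)
    have s_pos: "s m > 0" for m using L C_pos by (simp add: s_def)
    have kap_pos: "kap m > 0" for m using lam_pos[of "m - 1"] by (simp add: kap_def)
    have s_lam: "C * s m * dyadic m = lam m" for m
      using C_pos by (simp add: s_def lam_def a_def powr_add[symmetric] algebra_simps)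
    define Gs where "Gs m w = ennreal (G w) * indicator {w. G w \<le> s m} w" for m w
    define Gb where "Gb m w = ennreal (G w) * indicator {w. G w > s m} w" for m w
    have [measurable]: "Gs m \<in> borel_measurable M" "Gb m \<in> borel_measurable M" for m
      unfolding Gs_def[abs_def] Gb_def[abs_def] by measurable
    have G_split: "(\<lambda>w. ennreal (G w)) = (\<lambda>w. Gs m w + Gb m w)" for m
      by (auto simp: Gs_def Gb_def indicator_def)
    \<comment> \<open>The relevant scale depends on \<open>z\<close>; summing over all scales gives
      a measurable majorant, in which any single term may be selected afterwards.\<close>
    define H where "H z = (\<integral>\<^sup>+m. ennreal (kap m) * pot {..<m} (Gb m) z \<partial>count_space UNIV)" for z
    have H_meas: "H \<in> borel_measurable M"
      unfolding H_def[abs_def] by (rule nn_integral_int_measurable) measurable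
    have pointwise: "ennreal (y powr p) \<le> H z"
      if z: "z \<in> space M" and y: "y \<ge> 0" and yT: "ennreal y \<le> pot UNIV (\<lambda>w. ennreal (G w)) z" for y z
    proof (cases "y = 0")
      case False
      then have y: "y > 0" using y by simp
      obtain m where m: "2 powr (- a * real_of_int m) < y / (3 * L)" "y / (3 * L) \<le> 2 powr (- a * real_of_int (m - 1))"
        using exists_dyadic_scale[of a "y / (3 * L)"] a L y by auto
      \<comment> \<open>The lower bound makes the two contributions of size \<open>lam m\<close>
        amount to less than two thirds of \<open>y\<close>, so that a third is left for the high
        part; the upper bound is what \<open>kap m\<close> was built for.\<close>
      have m: "3 * lam m < y" "y \<le> 3 * lam (m - 1)"
        using m L by (simp_all add: lam_def field_simps)
      define P where "P = pot {..<m} (Gb m) z"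
      have "ennreal y \<le> pot {..<m} (\<lambda>w. ennreal (G w)) z + pot {m..} (\<lambda>w. ennreal (G w)) z"
        using yT pot_split[of "\<lambda>w. ennreal (G w)" z m] z by simp
      also have "pot {..<m} (\<lambda>w. ennreal (G w)) z = pot {..<m} (Gs m) z + P"
        using z unfolding P_def by (subst G_split[of m], intro pot_add) auto
      also have "pot {..<m} (Gs m) z \<le> ennreal (C * s m * dyadic m)"
        using z s_pos[of m] by (intro pot_lessThan_le) (auto simp: Gs_def indicator_def intro: ennreal_leI)
      also have "pot {m..} (\<lambda>w. ennreal (G w)) z
          \<le> ennreal (C * N / (1 - 2 powr - (Q / 2 - 1)) * 2 powr (- (Q / 2 - 1) * real_of_int m))"
        using N GN z by (intro pot_atLeast_le) auto
      also have "C * N / (1 - 2 powr - (Q / 2 - 1)) * 2 powr (- (Q / 2 - 1) * real_of_int m) = lam m"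
        by (simp add: lam_def L_def d0_def a_def)
      finally have yle: "ennreal y \<le> ennreal (lam m) + P + ennreal (lam m)"
        by (simp add: s_lam add_mono)
      then have yP: "ennreal (y / 3) \<le> P"
      proof (cases P)
        case (real q)
        then have "ennreal y \<le> ennreal (lam m + q + lam m)"
          using yle lam_pos[of m] by (simp add: ennreal_plus[symmetric] del: ennreal_plus)
        then have "y \<le> lam m + q + lam m"
          using real lam_pos[of m] by (subst (asm) ennreal_le_iff) auto
        then have "y / 3 \<le> q" using m by simp
        then show ?thesis using real by (simp add: ennreal_leI)
      qed simp
      have "ennreal (y powr p) = ennreal (3 * y powr (p - 1)) * ennreal (y / 3)"
        using y by (simp add: ennreal_mult[symmetric] powr_diff)
      also have "\<dots> \<le> ennreal (kap m) * P"
        unfolding kap_def using m y p by (intro mult_mono yP ennreal_leI mult_left_mono powr_mono2) auto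
      also have "\<dots> \<le> H z"
        unfolding H_def P_def
        by (rule nn_integral_ge_point[where p="\<lambda>m. ennreal (kap m) * pot {..<m} (Gb m) z"]) simp
      finally show ?thesis .
    qed simp
    \<comment> \<open>The L1 bound at scale \<open>m\<close> costs \<open>C * dyadic m\<close>. By
      \<open>ap\<close> the total weight is proportional to \<open>s m\<close>, which makes the sum
      over \<open>m\<close> with \<open>s m < G w\<close> comparable to \<open>G w\<close>.\<close>
    have kap_eq: "kap m * (C * dyadic m) = kap 0 * C * 2 powr (- (Q / 2) * real_of_int m)" for m
    proof -
      have "lam (m - 1) = lam (- 1) * 2 powr (- a * real_of_int m)"
        by (simp add: lam_def powr_add[symmetric] algebra_simps)
      then have "kap m = kap 0 * (2 powr (- a * real_of_int m)) powr (p - 1)"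
        using lam_pos[of "- 1"] by (simp add: kap_def powr_mult mult.assoc[symmetric])
      also have "(2 powr (- a * real_of_int m)) powr (p - 1) = 2 powr (- (a * (p - 1)) * real_of_int m)"
        by (simp add: powr_powr mult_ac)
      finally have "kap m = kap 0 * 2 powr (- (Q / 2 + 1) * real_of_int m)"
        by (simp only: ap)
      moreover have "2 powr (- (Q / 2 + 1) * real_of_int m) * dyadic m = 2 powr (- (Q / 2) * real_of_int m)"
        by (simp add: powr_add[symmetric] algebra_simps)
      ultimately show ?thesis by (simp add: mult_ac)
    qed
    have "(\<integral>\<^sup>+z. H z \<partial>M) = (\<integral>\<^sup>+m. \<integral>\<^sup>+z. ennreal (kap m) * pot {..<m} (Gb m) z \<partial>M \<partial>count_space UNIV)"
      unfolding H_def by (rule nn_integral_count_space_nn_integral) auto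
    also have "\<dots> \<le> (\<integral>\<^sup>+m. \<integral>\<^sup>+w. ennreal (kap 0 * C * 2 powr (- (Q / 2) * real_of_int m)) * Gb m w \<partial>M \<partial>count_space UNIV)"
    proof (rule nn_integral_mono)
      fix m :: int
      have "(\<integral>\<^sup>+z. ennreal (kap m) * pot {..<m} (Gb m) z \<partial>M) = ennreal (kap m) * (\<integral>\<^sup>+z. pot {..<m} (Gb m) z \<partial>M)"
        by (rule nn_integral_cmult) measurable
      also have "\<dots> \<le> ennreal (kap m) * (ennreal (C * dyadic m) * (\<integral>\<^sup>+w. Gb m w \<partial>M))"
        by (intro mult_left_mono nn_integral_pot_lessThan_le) auto
      also have "\<dots> = ennreal (kap 0 * C * 2 powr (- (Q / 2) * real_of_int m)) * (\<integral>\<^sup>+w. Gb m w \<partial>M)"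
        unfolding kap_eq[symmetric] using kap_pos[of m] C_pos by (simp add: ennreal_mult mult.assoc)
      finally show "(\<integral>\<^sup>+z. ennreal (kap m) * pot {..<m} (Gb m) z \<partial>M)
          \<le> (\<integral>\<^sup>+w. ennreal (kap 0 * C * 2 powr (- (Q / 2) * real_of_int m)) * Gb m w \<partial>M)"
        by (simp add: nn_integral_cmult)
    qed
    also have "\<dots> = (\<integral>\<^sup>+w. \<integral>\<^sup>+m. ennreal (kap 0 * C * 2 powr (- (Q / 2) * real_of_int m)) * Gb m w \<partial>count_space UNIV \<partial>M)"
      by (rule nn_integral_count_space_nn_integral[symmetric]) auto
    \<comment> \<open>For fixed \<open>w\<close> only the scales with \<open>s m < G w\<close>
      contribute. Their weights sum to a multiple of \<open>G w\<close>, and the value of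
      \<open>Gb m\<close> supplies the second factor \<open>G w\<close>.\<close>
    also have "\<dots> \<le> (\<integral>\<^sup>+w. ennreal (kap 0 * C * C / (L * d1)) * (ennreal (G w))\<^sup>2 \<partial>M)"
    proof (rule nn_integral_mono)
      fix w
      have "(\<integral>\<^sup>+m. ennreal (kap 0 * C * 2 powr (- (Q / 2) * real_of_int m)) * Gb m w \<partial>count_space UNIV)
         = (\<integral>\<^sup>+m. ennreal (kap 0 * C * G w) * (ennreal (2 powr (- (Q / 2) * real_of_int m)) *
              indicator {m. 2 powr (- (Q / 2) * real_of_int m) < C * G w / L} m) \<partial>count_space UNIV)"
      proof (rule nn_integral_cong)
        fix m :: int
        have "G w > s m \<longleftrightarrow> 2 powr (- (Q / 2) * real_of_int m) < C * G w / L"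
          using L C_pos by (simp add: s_def field_simps)
        then show "ennreal (kap 0 * C * 2 powr (- (Q / 2) * real_of_int m)) * Gb m w =
            ennreal (kap 0 * C * G w) * (ennreal (2 powr (- (Q / 2) * real_of_int m)) *
              indicator {m. 2 powr (- (Q / 2) * real_of_int m) < C * G w / L} m)"
          using kap_pos[of 0] C_pos G0[of w] by (simp add: Gb_def indicator_def ennreal_mult[symmetric] mult_ac)
      qed
      also have "\<dots> = ennreal (kap 0 * C * G w) * (\<integral>\<^sup>+m\<in>{m. 2 powr (- (Q / 2) * real_of_int m) < C * G w / L}.
              ennreal (2 powr (- (Q / 2) * real_of_int m)) \<partial>count_space UNIV)"
        by (rule nn_integral_cmult) auto
      also have "\<dots> \<le> ennreal (kap 0 * C * G w) * ennreal (C * G w / L / (1 - 2 powr - (Q / 2)))"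
        using Q_gt_2 L C_pos G0[of w] by (intro mult_left_mono nn_integral_powr_less) auto
      also have "\<dots> = ennreal (kap 0 * C * C / (L * d1)) * (ennreal (G w))\<^sup>2"
        using kap_pos[of 0] C_pos G0[of w] L d
        by (simp add: d1_def[symmetric] ennreal_power ennreal_mult[symmetric] power2_eq_square mult_ac)
      finally show "(\<integral>\<^sup>+m. ennreal (kap 0 * C * 2 powr (- (Q / 2) * real_of_int m)) * Gb m w \<partial>count_space UNIV)
         \<le> ennreal (kap 0 * C * C / (L * d1)) * (ennreal (G w))\<^sup>2" .
    qed
    also have "\<dots> = ennreal (kap 0 * C * C / (L * d1)) * (\<integral>\<^sup>+w. (ennreal (G w))\<^sup>2 \<partial>M)"
      by (rule nn_integral_cmult) measurable
    also have "kap 0 * C * C / (L * d1) = C' * N powr (p - 2)"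
    proof -
      have "3 * lam (- 1) = (3 * 2 powr a) * L" by (simp add: lam_def)
      then have "kap 0 = 3 * ((3 * 2 powr a) powr (p - 1) * L powr (p - 1))"
        using L by (simp add: kap_def powr_mult)
      moreover have "L powr (p - 1) = L * L powr (p - 2)"
        using L powr_add[of L 1 "p - 2"] by simp
      moreover have "L powr (p - 2) = (C / d0) powr (p - 2) * N powr (p - 2)"
        using C_pos d N by (simp add: L_def powr_mult[symmetric])
      ultimately show ?thesis
        using L by (simp add: C'_def power2_eq_square)
    qed
    finally show ?thesis using H_meas pointwise by blast
  qed
  ultimately show ?thesis by (rule that)
qed

end

subsection \<open>Shears preserve Lebesgue measure\<close>

text \<open>Only boxes need to be tested. With the coordinate along \<open>e\<close> as the outer
  variable of integration, the shift \<open>u\<close> is a constant vector for the inner integrals,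
  each of which is a translation-invariant length; the \<open>e\<close>-coordinate itself is unmoved
  because \<open>u\<close> is orthogonal to \<open>e\<close>.\<close>

lemma distr_lborel_shear:
  fixes u :: "real \<Rightarrow> 'a::euclidean_space"
  assumes [measurable]: "u \<in> borel_measurable borel" and e: "e \<in> Basis" and u0: "\<And>t. u t \<bullet> e = 0"
  shows "distr lborel borel (\<lambda>w. w - u (w \<bullet> e)) = (lborel :: 'a measure)"
proof (rule sym, rule lborel_eqI)
  fix l h :: 'a
  assume lh: "\<And>b. b \<in> Basis \<Longrightarrow> l \<bullet> b \<le> h \<bullet> b"
  let ?T = "\<lambda>w::'a. w - u (w \<bullet> e)"
  let ?B = "Basis :: 'a set"
  let ?ind = "\<lambda>b x. indicator {l \<bullet> b <..< h \<bullet> b} x :: ennreal"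
  interpret product_sigma_finite "\<lambda>_::'a. lborel :: real measure" ..
  have [simp]: "(\<Sum>b\<in>?B. f b *\<^sub>R b) \<bullet> c = f c" if "c \<in> ?B" for f c
    using that by (simp add: inner_sum_left inner_Basis if_distrib sum.delta cong: if_cong)
  have ind: "indicator (?T -` box l h) w = (\<Prod>b\<in>?B. ?ind b (w \<bullet> b - u (w \<bullet> e) \<bullet> b))" for w
    by (auto simp: indicator_def box_def inner_diff_left prod_zero_iff intro!: prod.neutral)
  have "?T \<in> borel_measurable borel" by measurable
  from measurable_sets[OF this, of "box l h"]
  have [measurable]: "?T -` box l h \<in> sets borel" by simp
  have "emeasure (distr lborel borel ?T) (box l h) = (\<integral>\<^sup>+w. indicator (?T -` box l h) w \<partial>lborel)"
    by (subst emeasure_distr) auto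
  also have "\<dots> = (\<integral>\<^sup>+w. (\<Prod>b\<in>?B. ?ind b (w \<bullet> b - u (w \<bullet> e) \<bullet> b)) \<partial>lborel)"
    by (simp only: ind)
  also have "\<dots> = (\<integral>\<^sup>+f. (\<Prod>b\<in>?B. ?ind b (f b - u (f e) \<bullet> b)) \<partial>(\<Pi>\<^sub>M b\<in>?B. lborel))"
    using e by (subst lborel_eq, subst nn_integral_distr) (auto intro!: nn_integral_cong prod.cong)
  also have "?B = insert e (?B - {e})" using e by auto
  also have "(\<integral>\<^sup>+f. (\<Prod>b\<in>insert e (?B - {e}). ?ind b (f b - u (f e) \<bullet> b)) \<partial>(\<Pi>\<^sub>M b\<in>insert e (?B - {e}). lborel))
     = (\<integral>\<^sup>+y. \<integral>\<^sup>+f. (\<Prod>b\<in>insert e (?B - {e}). ?ind b ((f(e := y)) b - u ((f(e := y)) e) \<bullet> b)) \<partial>(\<Pi>\<^sub>M b\<in>?B - {e}. lborel) \<partial>lborel)"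
    by (rule product_nn_integral_insert_rev) auto
  also have "\<dots> = (\<integral>\<^sup>+y. \<integral>\<^sup>+f. ?ind e y * (\<Prod>b\<in>?B - {e}. ?ind b (f b - u y \<bullet> b)) \<partial>(\<Pi>\<^sub>M b\<in>?B - {e}. lborel) \<partial>lborel)"
    by (intro nn_integral_cong, subst prod.insert) (auto simp: u0 intro!: arg_cong2[where f="(*)"] prod.cong)
  also have "\<dots> = (\<integral>\<^sup>+y. ?ind e y * (\<Prod>b\<in>?B - {e}. ennreal ((h - l) \<bullet> b)) \<partial>lborel)"
  proof (rule nn_integral_cong)
    fix y
    have 1: "(\<integral>\<^sup>+x. ?ind b (x - c) \<partial>lborel) = ennreal ((h - l) \<bullet> b)" if "b \<in> ?B" for b c
    proof -
      have "(\<integral>\<^sup>+x. ?ind b (x - c) \<partial>lborel) = (\<integral>\<^sup>+x. indicator {l \<bullet> b + c <..< h \<bullet> b + c} x \<partial>lborel)"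
        by (intro nn_integral_cong) (auto simp: indicator_def)
      then show ?thesis using lh[OF that] by (simp add: inner_diff_left)
    qed
    have "(\<integral>\<^sup>+f. ?ind e y * (\<Prod>b\<in>?B - {e}. ?ind b (f b - u y \<bullet> b)) \<partial>(\<Pi>\<^sub>M b\<in>?B - {e}. lborel))
      = ?ind e y * (\<integral>\<^sup>+f. (\<Prod>b\<in>?B - {e}. ?ind b (f b - u y \<bullet> b)) \<partial>(\<Pi>\<^sub>M b\<in>?B - {e}. lborel))"
      by (rule nn_integral_cmult) measurable
    also have "(\<integral>\<^sup>+f. (\<Prod>b\<in>?B - {e}. ?ind b (f b - u y \<bullet> b)) \<partial>(\<Pi>\<^sub>M b\<in>?B - {e}. lborel))
      = (\<Prod>b\<in>?B - {e}. \<integral>\<^sup>+x. ?ind b (x - u y \<bullet> b) \<partial>lborel)"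
      by (rule product_nn_integral_prod) auto
    also have "\<dots> = (\<Prod>b\<in>?B - {e}. ennreal ((h - l) \<bullet> b))"
      by (intro prod.cong 1) auto
    finally show "(\<integral>\<^sup>+f. ?ind e y * (\<Prod>b\<in>?B - {e}. ?ind b (f b - u y \<bullet> b)) \<partial>(\<Pi>\<^sub>M b\<in>?B - {e}. lborel))
      = ?ind e y * (\<Prod>b\<in>?B - {e}. ennreal ((h - l) \<bullet> b))" .
  qed
  also have "\<dots> = ennreal ((h - l) \<bullet> e) * (\<Prod>b\<in>?B - {e}. ennreal ((h - l) \<bullet> b))"
    using lh[OF e] by (simp add: nn_integral_multc inner_diff_left)
  also have "\<dots> = (\<Prod>b\<in>?B. ennreal ((h - l) \<bullet> b))"
    using e by (simp add: prod.remove)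
  finally show "emeasure (distr lborel borel ?T) (box l h) = ennreal (\<Prod>b\<in>?B. (h - l) \<bullet> b)"
    using lh by (simp add: prod_ennreal inner_diff_left)
qed simp

subsection \<open>Graded Kolmogorov operators\<close>

lemma partial_eq_0:
  assumes "open U" "x \<in> U" "\<And>y. y \<in> U \<Longrightarrow> \<phi> y = 0"
  shows "partial i \<phi> x = 0"
proof -
  have "(\<phi> has_derivative (\<lambda>_. 0)) (at x)"
    by (rule has_derivative_transform_within_open[OF has_derivative_const assms(1,2)])
       (simp add: assms(3))
  then show ?thesis by (simp add: partial_has_derivative)
qed

lemma partial_sum:
  assumes "\<And>j. j \<in> I \<Longrightarrow> f j differentiable (at x)"
  shows "partial i (\<lambda>x. \<Sum>j\<in>I. f j x) x = (\<Sum>j\<in>I. partial i (f j) x)"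
  using assms
  by (induction I rule: infinite_finite_induct)
     (simp_all add: partial_const partial_add differentiable_sum)

definition cpt_smth :: "(real^'n::finite \<Rightarrow> real) \<Rightarrow> bool" where
  "cpt_smth \<phi> \<longleftrightarrow> smth \<phi> \<and> (\<exists>c. \<forall>x i. \<phi> x \<noteq> 0 \<longrightarrow> \<bar>x $ i\<bar> \<le> c)"

lemma cpt_smthI: "smth \<phi> \<Longrightarrow> (\<And>x i. \<phi> x \<noteq> 0 \<Longrightarrow> \<bar>x $ i\<bar> \<le> c) \<Longrightarrow> cpt_smth \<phi>"
  by (auto simp: cpt_smth_def)

lemma cpt_smthE:
  assumes "cpt_smth \<phi>"
  obtains c where "c > 0" "\<And>x i. \<phi> x \<noteq> 0 \<Longrightarrow> \<bar>x $ i\<bar> \<le> c"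
proof -
  obtain c where "\<forall>x i. \<phi> x \<noteq> 0 \<longrightarrow> \<bar>x $ i\<bar> \<le> c" using assms by (auto simp: cpt_smth_def)
  then show thesis by (intro that[of "max c 1"]) (auto simp: le_max_iff_disj)
qed

lemma cpt_smth_smth: "cpt_smth \<phi> \<Longrightarrow> smth \<phi>"
  by (simp add: cpt_smth_def)

lemma cpt_smth_zero: "cpt_smth (\<lambda>_. 0)"
  by (auto simp: cpt_smth_def smth_const)

lemma cpt_smth_mult: "smth f \<Longrightarrow> cpt_smth g \<Longrightarrow> cpt_smth (\<lambda>x. f x * g x)"
  by (auto simp: cpt_smth_def smth_mult)

lemma cpt_smth_cmult: "cpt_smth g \<Longrightarrow> cpt_smth (\<lambda>x. c * g x)"
  using cpt_smth_mult[OF smth_const] .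

lemma cpt_smth_add:
  assumes "cpt_smth f" "cpt_smth g"
  shows "cpt_smth (\<lambda>x. f x + g x)"
proof -
  obtain c c' where *: "\<And>x i. f x \<noteq> 0 \<Longrightarrow> \<bar>x $ i\<bar> \<le> c" "\<And>x i. g x \<noteq> 0 \<Longrightarrow> \<bar>x $ i\<bar> \<le> c'"
    using assms by (meson cpt_smth_def)
  show ?thesis
  proof (rule cpt_smthI[where c="max c c'"])
    fix x i assume "f x + g x \<noteq> 0"
    then have "f x \<noteq> 0 \<or> g x \<noteq> 0" by auto
    then show "\<bar>x $ i\<bar> \<le> max c c'" using *[of x i] by (auto simp: le_max_iff_disj)
  qed (use assms in \<open>simp add: smth_add cpt_smth_def\<close>)
qed

lemma cpt_smth_sum: "(\<And>i. i \<in> I \<Longrightarrow> cpt_smth (f i)) \<Longrightarrow> cpt_smth (\<lambda>x. \<Sum>i\<in>I. f i x)"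
  by (induction I rule: infinite_finite_induct) (auto intro: cpt_smth_add cpt_smth_zero)

lemma cpt_smth_partial:
  assumes "cpt_smth f" shows "cpt_smth (partial i f)"
proof -
  obtain c where c: "\<And>x i. f x \<noteq> 0 \<Longrightarrow> \<bar>x $ i\<bar> \<le> c"
    using assms by (meson cpt_smth_def)
  show ?thesis
  proof (rule cpt_smthI[where c=c])
    show "smth (partial i f)" using assms by (simp add: cpt_smth_def smth_partial)
    fix x j assume nz: "partial i f x \<noteq> 0"
    show "\<bar>x $ j\<bar> \<le> c"
    proof (rule ccontr)
      assume "\<not> ?thesis"
      moreover have "open {x :: real^'a. c < \<bar>x $ j\<bar>}"
        by (intro open_Collect_less continuous_intros)
      ultimately have "partial i f x = 0"
        using c by (intro partial_eq_0[where U="{x. c < \<bar>x $ j\<bar>}"]) (auto simp: not_le[symmetric])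
      then show False using nz by simp
    qed
  qed
qed

text \<open>Only the grading of the operator is kept: \<open>om i\<close> is the scaling exponent of
  the coordinate \<open>i\<close>. \<open>B_deg\<close> makes the drift homogeneous of the same
  degree 2 as the time derivative, and \<open>B_rows\<close> states all rank conditions at once, as
  independence of the rows of weight above 1. \<open>ex_space\<close> yields
  \<open>Q \<ge> 3\<close>.\<close>

locale kolmogorov =
  fixes t0 :: "'n::finite" and om :: "'n \<Rightarrow> nat" and B :: "'n \<Rightarrow> 'n \<Rightarrow> real"
  assumes om_t0: "om t0 = 2"
    and om_odd: "\<And>i. i \<noteq> t0 \<Longrightarrow> odd (om i)"
    and B_deg: "\<And>i j. B i j \<noteq> 0 \<Longrightarrow> i \<noteq> t0 \<and> j \<noteq> t0 \<and> om i = om j + 2"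
    and B_rows: "\<And>z i. (\<And>c. (\<Sum>i\<in>UNIV. z i * B i c) = 0) \<Longrightarrow> i \<noteq> t0 \<Longrightarrow> om i \<noteq> 1 \<Longrightarrow> z i = 0"
    and ex_space: "\<exists>i. i \<noteq> t0"
begin

definition V :: "'n set" where "V = {i. om i = 1}"

definition Bv :: "real^'n \<Rightarrow> real^'n" where
  "Bv x = (\<chi> i. \<Sum>j\<in>UNIV. B i j * x $ j)"

definition Y :: "(real^'n \<Rightarrow> real) \<Rightarrow> real^'n \<Rightarrow> real" where
  "Y \<phi> x = partial t0 \<phi> x + (\<Sum>i\<in>UNIV. Bv x $ i * partial i \<phi> x)"

lemma om_pos: "om i > 0"
  using om_odd[of i] om_t0 by (cases "i = t0") (auto intro: odd_pos)

lemma Bv_nth: "Bv x $ i = (\<Sum>j\<in>UNIV. B i j * x $ j)"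
  by (simp add: Bv_def)

lemma Bv_t0: "Bv x $ t0 = 0"
proof -
  have "B t0 j = 0" for j using B_deg[of t0 j] by auto
  then show ?thesis by (simp add: Bv_nth)
qed

lemma linear_Bv: "linear Bv"
  by (rule linearI) (auto simp: Bv_def vec_eq_iff sum.distrib algebra_simps sum_distrib_left)

lemma smth_Bv: "smth (\<lambda>x. Bv x $ i)"
  unfolding Bv_nth by (intro smth_sum smth_cmult smth_coord)

lemma partial_Bv: "partial c (\<lambda>x. Bv x $ i) x = B i c"
proof -
  have "((\<lambda>x. Bv x $ i) has_derivative (\<lambda>x. Bv x $ i)) (at x)"
    by (intro bounded_linear_imp_has_derivative linear_conv_bounded_linear[THEN iffD1])
       (use linear_Bv in \<open>auto simp: linear_iff\<close>)
  from partial_has_derivative[OF this, of c] show ?thesis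
    by (simp add: Bv_nth axis_def if_distrib cong: if_cong)
qed

lemma Y_has_derivative:
  assumes "(\<phi> has_derivative D) (at x)"
  shows "Y \<phi> x = D (axis t0 1 + Bv x)"
proof -
  interpret D: bounded_linear D using assms by (rule has_derivative_bounded_linear)
  show ?thesis
    by (simp add: Y_def D.add partial_has_derivative[OF assms] has_derivative_imp_partial_sum[OF assms, of "Bv x"])
qed

lemma cpt_smth_Y: "cpt_smth \<phi> \<Longrightarrow> cpt_smth (Y \<phi>)"
  unfolding Y_def[abs_def] by (intro cpt_smth_add cpt_smth_sum cpt_smth_mult cpt_smth_partial smth_Bv)

lemma Y_add: "smth f \<Longrightarrow> smth g \<Longrightarrow> Y (\<lambda>x. f x + g x) x = Y f x + Y g x"
  by (simp add: Y_def partial_add smth_differentiable sum.distrib distrib_left)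

lemma Y_cmult: "smth f \<Longrightarrow> Y (\<lambda>x. c * f x) x = c * Y f x"
  by (simp add: Y_def partial_cmult smth_differentiable sum_distrib_left distrib_left mult.left_commute)

text \<open>Because \<open>Bv\<close> is linear, the commutator has constant coefficients, namely
  column \<open>c\<close> of \<open>B\<close>; no second derivatives survive.\<close>

lemma partial_Y_commutator:
  assumes "smth h"
  shows "partial c (Y h) x - Y (partial c h) x = (\<Sum>i\<in>UNIV. B i c * partial i h x)"
proof -
  have "partial c (Y h) x = partial c (partial t0 h) x +
      (\<Sum>i\<in>UNIV. Bv x $ i * partial c (partial i h) x + B i c * partial i h x)"
    unfolding Y_def[abs_def] using assms
    by (simp add: partial_add partial_sum partial_mult smth_differentiable smth_partial smth_sum smth_mult smth_Bv
        partial_Bv)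
  then show ?thesis
    using assms by (simp add: Y_def sum.distrib partial_commute[of h c])
qed

text \<open>It suffices that \<open>axis i 1\<close> lies in the range of \<open>Bv\<close>. Its
  component \<open>z\<close> orthogonal to the range annihilates all columns of \<open>B\<close>, so
  \<open>B_rows\<close> kills the entries of weight above 1; at \<open>t0\<close> and at weight 1
  the rows of \<open>B\<close> vanish, and \<open>z\<close> agrees there with
  \<open>axis i 1\<close>, which is 0.\<close>

lemma Bv_solvable:
  assumes "i \<noteq> t0" "om i \<noteq> 1"
  obtains a where "\<And>c. a c \<noteq> 0 \<Longrightarrow> c \<noteq> t0 \<and> om c < om i"
    and "\<And>i'. (\<Sum>c\<in>UNIV. a c * B i' c) = (if i' = i then 1 else 0)"
proof -
  have sub: "subspace (range Bv)"
    by (rule linear_subspace_image[OF linear_Bv subspace_UNIV])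
  obtain y z where y: "y \<in> span (range Bv)" and z: "\<And>w. w \<in> span (range Bv) \<Longrightarrow> orthogonal z w"
    and eq: "axis i 1 = y + z"
    using orthogonal_subspace_decomp_exists[of "range Bv" "axis i 1 :: real^'n"] by metis
  have "(\<Sum>i\<in>UNIV. z $ i * B i c) = 0" for c
  proof -
    have "z \<bullet> Bv (axis c 1) = 0"
      using z[of "Bv (axis c 1)"] by (simp add: orthogonal_def span_base)
    then show ?thesis
      by (simp add: inner_vec_def Bv_nth axis_def if_distrib cong: if_cong)
  qed
  then have z1: "z $ i' = 0" if "i' \<noteq> t0" "om i' \<noteq> 1" for i'
    using B_rows[of "\<lambda>i. z $ i"] that by blast
  obtain v where v: "y = Bv v" using y sub by (auto simp: span_eq_iff[THEN iffD2])
  have z2: "z $ i' = 0" if "i' = t0 \<or> om i' = 1" for i'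
  proof -
    have "B i' j = 0" for j using B_deg[of i' j] om_pos[of j] that by fastforce
    then have "y $ i' = 0" by (simp add: v Bv_nth)
    moreover have "i' \<noteq> i" using that assms by auto
    ultimately show ?thesis using arg_cong[OF eq, of "\<lambda>x. x $ i'"] by (auto simp: axis_def)
  qed
  have "z = 0" using z1 z2 by (auto simp: vec_eq_iff)
  then have v: "axis i 1 = Bv v" using eq v by simp
  \<comment> \<open>Truncating the preimage to weight \<open>om i - 2\<close> leaves the rows of
    weight \<open>om i\<close> unchanged, kills all other rows by \<open>B_deg\<close>, and leaves
    only directions of smaller weight, as the induction on the weight demands.\<close>
  define a where "a c = (if c \<noteq> t0 \<and> om i = om c + 2 then v $ c else 0)" for c
  have "(\<Sum>c\<in>UNIV. a c * B i' c) = (if i' = i then 1 else 0)" for i'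
  proof (cases "om i' = om i")
    case True
    have "a c * B i' c = B i' c * v $ c" for c
      using B_deg[of i' c] True by (auto simp: a_def)
    then have "(\<Sum>c\<in>UNIV. a c * B i' c) = Bv v $ i'" by (simp only: Bv_nth)
    then show ?thesis by (simp add: v[symmetric] axis_def)
  next
    case False
    have "a c * B i' c = 0" for c
      using B_deg[of i' c] False by (auto simp: a_def)
    then have "(\<Sum>c\<in>UNIV. a c * B i' c) = 0" by (intro sum.neutral ballI)
    then show ?thesis using False by auto
  qed
  moreover have "c \<noteq> t0 \<and> om c < om i" if "a c \<noteq> 0" for c
    using that by (auto simp: a_def split: if_splits)
  ultimately show thesis using that by blast
qed

text \<open>The functions on which the equation for \<open>f\<close> gives information: \<open>\<integral> f h\<close> is controlled by the
  source \<open>S\<close> and the derivatives of \<open>f\<close> in the \<open>V\<close>-directions.\<close>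

definition accessible :: "(real^'n \<Rightarrow> real) \<Rightarrow> bool" where
  "accessible h \<longleftrightarrow> (\<exists>\<phi> F. cpt_smth \<phi> \<and> (\<forall>i. cpt_smth (F i)) \<and>
      h = (\<lambda>x. Y \<phi> x + (\<Sum>i\<in>V. partial i (F i) x)))"

lemma accessible_zero: "accessible (\<lambda>_. 0)"
  unfolding accessible_def
  by (intro exI[of _ "\<lambda>_. 0"] exI[of _ "\<lambda>_ _. 0"]) (simp add: cpt_smth_zero Y_def partial_const)

lemma accessible_add:
  assumes "accessible f" "accessible g" shows "accessible (\<lambda>x. f x + g x)"
proof -
  obtain \<phi> F \<phi>' F' where 1: "cpt_smth \<phi>" "\<And>i. cpt_smth (F i)" "f = (\<lambda>x. Y \<phi> x + (\<Sum>i\<in>V. partial i (F i) x))"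
    and 2: "cpt_smth \<phi>'" "\<And>i. cpt_smth (F' i)" "g = (\<lambda>x. Y \<phi>' x + (\<Sum>i\<in>V. partial i (F' i) x))"
    using assms unfolding accessible_def by blast
  show ?thesis unfolding accessible_def
    by (intro exI[of _ "\<lambda>x. \<phi> x + \<phi>' x"] exI[of _ "\<lambda>i x. F i x + F' i x"])
       (auto simp: 1 2 cpt_smth_add Y_add partial_add smth_differentiable cpt_smth_smth sum.distrib)
qed

lemma accessible_cmult:
  assumes "accessible f" shows "accessible (\<lambda>x. c * f x)"
proof -
  obtain \<phi> F where 1: "cpt_smth \<phi>" "\<And>i. cpt_smth (F i)" "f = (\<lambda>x. Y \<phi> x + (\<Sum>i\<in>V. partial i (F i) x))"
    using assms unfolding accessible_def by metis
  show ?thesis unfolding accessible_def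
    by (intro exI[of _ "\<lambda>x. c * \<phi> x"] exI[of _ "\<lambda>i x. c * F i x"])
       (auto simp: 1 cpt_smth_cmult Y_cmult partial_cmult smth_differentiable cpt_smth_smth sum_distrib_left distrib_left)
qed

lemma accessible_diff: "accessible f \<Longrightarrow> accessible g \<Longrightarrow> accessible (\<lambda>x. f x - g x)"
  using accessible_add[of f "\<lambda>x. - 1 * g x"] accessible_cmult[of g "- 1"] by simp

lemma accessible_sum: "(\<And>i. i \<in> I \<Longrightarrow> accessible (f i)) \<Longrightarrow> accessible (\<lambda>x. \<Sum>i\<in>I. f i x)"
  by (induction I rule: infinite_finite_induct) (auto intro: accessible_add accessible_zero)

lemma accessible_Y: "cpt_smth \<phi> \<Longrightarrow> accessible (Y \<phi>)"
  unfolding accessible_def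
  by (intro exI[of _ \<phi>] exI[of _ "\<lambda>_ _. 0"]) (simp add: cpt_smth_zero partial_const)

lemma accessible_partial_V:
  assumes "i \<in> V" "cpt_smth h" shows "accessible (partial i h)"
proof -
  have "(\<Sum>j\<in>V. partial j (if j = i then h else (\<lambda>_. 0)) x) = partial i h x" for x
  proof -
    have "(\<Sum>j\<in>V. partial j (if j = i then h else (\<lambda>_. 0)) x) = (\<Sum>j\<in>V. if j = i then partial i h x else 0)"
      by (intro sum.cong) (auto simp: partial_const)
    then show ?thesis using assms(1) by simp
  qed
  then show ?thesis
    unfolding accessible_def using assms
    by (intro exI[of _ "\<lambda>_. 0"] exI[of _ "\<lambda>j. if j = i then h else (\<lambda>_. 0)"])
       (simp add: cpt_smth_zero Y_def partial_const)
qed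

text \<open>Hoermander's bracket condition: \<open>[\<partial>\<^sub>c, Y]\<close> produces the directions of the next higher weight.\<close>

lemma accessible_partial_space:
  assumes "i \<noteq> t0" "cpt_smth h" shows "accessible (partial i h)"
  using assms
proof (induction "om i" arbitrary: i h rule: less_induct)
  case less
  show ?case
  proof (cases "om i = 1")
    case True
    then show ?thesis using less.prems by (intro accessible_partial_V) (auto simp: V_def)
  next
    case False
    obtain a where a: "\<And>c. a c \<noteq> 0 \<Longrightarrow> c \<noteq> t0 \<and> om c < om i"
      "\<And>i'. (\<Sum>c\<in>UNIV. a c * B i' c) = (if i' = i then 1 else 0)"
      using Bv_solvable[OF less.prems(1) False] by blast
    \<comment> \<open>The combination of commutators isolates the direction \<open>i\<close>. The
      terms \<open>partial c (Y h)\<close> fall under the induction hypothesis for the new function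
      \<open>Y h\<close>, and the terms \<open>Y (partial c h)\<close> are accessible by
      definition.\<close>
    have "partial i h x = (\<Sum>c | a c \<noteq> 0. a c * (partial c (Y h) x - Y (partial c h) x))" for x
    proof -
      have "(\<Sum>c | a c \<noteq> 0. a c * (partial c (Y h) x - Y (partial c h) x))
          = (\<Sum>c\<in>UNIV. a c * (\<Sum>i'\<in>UNIV. B i' c * partial i' h x))"
        by (subst partial_Y_commutator) (auto intro!: sum.mono_neutral_left cpt_smth_smth less.prems)
      also have "\<dots> = (\<Sum>i'\<in>UNIV. (\<Sum>c\<in>UNIV. a c * B i' c) * partial i' h x)"
        unfolding sum_distrib_left sum_distrib_right by (subst sum.swap) (simp add: mult.assoc)
      also have "\<dots> = partial i h x"
        by (simp add: a(2) if_distrib[where f="\<lambda>u. u * _"] cong: if_cong)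
      finally show ?thesis by simp
    qed
    moreover have "accessible (\<lambda>x. \<Sum>c | a c \<noteq> 0. a c * (partial c (Y h) x - Y (partial c h) x))"
      using a(1) less.prems
      by (intro accessible_sum accessible_cmult accessible_diff accessible_Y cpt_smth_partial less.hyps cpt_smth_Y) auto
    ultimately show ?thesis by (subst ext[where f="partial i h"]) auto
  qed
qed

text \<open>For time, \<open>Y\<close> is solved for \<open>partial t0\<close>. The diagonal of
  \<open>B\<close> vanishes, so the coefficient \<open>Bv x $ i\<close> may be moved inside the
  derivative in direction \<open>i\<close>, leaving pure space derivatives of compactly supported
  functions.\<close>

lemma accessible_partial:
  assumes h: "cpt_smth h" shows "accessible (partial i h)"
proof (cases "i = t0")
  case True
  have "partial t0 h x = Y h x - (\<Sum>i\<in>-{t0}. partial i (\<lambda>x. Bv x $ i * h x) x)" for x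
  proof -
    have "B i i = 0" for i using B_deg[of i i] by auto
    then have "(\<Sum>i\<in>-{t0}. partial i (\<lambda>x. Bv x $ i * h x) x) = (\<Sum>i\<in>-{t0}. Bv x $ i * partial i h x)"
      using h by (simp add: partial_mult smth_differentiable smth_Bv cpt_smth_smth partial_Bv)
    also have "\<dots> = (\<Sum>i\<in>UNIV. Bv x $ i * partial i h x)"
      by (rule sum.mono_neutral_left) (auto simp: Bv_t0)
    finally show ?thesis by (simp add: Y_def)
  qed
  moreover have "accessible (\<lambda>x. Y h x - (\<Sum>i\<in>-{t0}. partial i (\<lambda>x. Bv x $ i * h x) x))"
    using h by (intro accessible_diff accessible_Y accessible_sum accessible_partial_space cpt_smth_mult smth_Bv) auto
  ultimately have "accessible (partial t0 h)" by (subst ext[where f="partial t0 h"]) auto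
  then show ?thesis using True by simp
qed (simp add: accessible_partial_space h)

section \<open>The averaging profile and its two-scale difference\<close>

definition \<psi> :: "real^'n \<Rightarrow> real" where
  "\<psi> x = (\<Prod>i\<in>UNIV. bump (x $ i))"

definition dil :: "real \<Rightarrow> real^'n \<Rightarrow> real^'n" where
  "dil r x = (\<chi> i. x $ i / r ^ om i)"

definition Q :: nat where "Q = (\<Sum>i\<in>UNIV. om i)"

lemma smth_psi: "smth \<psi>"
  unfolding \<psi>_def[abs_def] by (intro smth_prod smth_bump smth_coord)

lemma psi_nonneg: "\<psi> x \<ge> 0"
  by (simp add: \<psi>_def prod_nonneg bump_nonneg)

lemma psi_support: "\<psi> x \<noteq> 0 \<Longrightarrow> \<bar>x $ i\<bar> \<le> 1"
  using bump_eq_0[of "x $ i"] by (force simp: \<psi>_def)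

text \<open>The dilated factors \<open>b i\<close> are replaced by \<open>bump\<close> one
  coordinate at a time, \<open>I\<close> being the set of coordinates already replaced. Each
  replacement changes the product by a derivative in the one new coordinate, and
  \<open>accessible_partial\<close> applies; \<open>I = UNIV\<close> is the claim.\<close>

lemma accessible_psi_diff:
  "accessible (\<lambda>x. \<psi> x - \<psi> (dil 2 x) / 2 ^ Q)"
proof -
  define b where "b i s = bump (s / 2 ^ om i) / 2 ^ om i" for i s
  have psi2: "\<psi> (dil 2 x) / 2 ^ Q = (\<Prod>i\<in>UNIV. b i (x $ i))" for x
    by (simp add: \<psi>_def dil_def b_def prod_dividef Q_def power_sum)
  have smth_b: "smth (\<lambda>x. b i (x $ i))" for i
    unfolding b_def divide_inverse by (intro smth_mult smth_bump smth_coord smth_const)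
  have "accessible (\<lambda>x. (\<Prod>i\<in>I. bump (x $ i)) * (\<Prod>i\<in>-I. b i (x $ i)) - (\<Prod>i\<in>UNIV. b i (x $ i)))"
    if "finite I" for I
    using that
  proof (induction I rule: finite_induct)
    case empty
    then show ?case by (simp add: accessible_zero)
  next
    case (insert j I)
    define R where "R x = (\<Prod>i\<in>I. bump (x $ i)) * (\<Prod>i\<in>-insert j I. b i (x $ i))" for x
    \<comment> \<open>A primitive of \<open>bump - b j\<close> in the variable \<open>x $ j\<close>.
      Both steps are 0 on the left and both are 1 beyond \<open>2 ^ om j\<close>, so equal masses
      make the primitive compactly supported.\<close>
    define W where "W x = step (x $ j) - step (x $ j / 2 ^ om j)" for x :: "real^'n"
    have smth_R: "smth R" unfolding R_def[abs_def] by (intro smth_mult smth_prod smth_bump smth_coord smth_b)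
    have smth_W: "smth W"
      unfolding W_def[abs_def] divide_inverse by (intro smth_diff smth_step smth_mult smth_coord smth_const)
    have "cpt_smth (\<lambda>x. W x * R x)"
    \<comment> \<open>The factors live on intervals of length 1 or \<open>2 ^ om i\<close>, and
      every weight is at most \<open>Q\<close>.\<close>
    proof (rule cpt_smthI[where c="2 ^ Q"])
      fix x i assume nz: "W x * R x \<noteq> 0"
      have om_Q: "om i \<le> Q" for i unfolding Q_def by (rule member_le_sum) auto
      have le: "(1::real) \<le> 2 ^ om i" "2 ^ om i \<le> (2::real) ^ Q" for i
        using om_Q by (auto intro: power_increasing)
      consider "i = j" | "i \<in> I" | "i \<in> - insert j I" by auto
      then show "\<bar>x $ i\<bar> \<le> 2 ^ Q"
      proof cases
        case 1
        have "\<not> x $ j \<le> 0" using nz by (auto simp: W_def step_eq_0 divide_le_0_iff)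
        moreover have "\<not> x $ j \<ge> 2 ^ om j"
        proof
          assume "x $ j \<ge> 2 ^ om j"
          moreover from this have "x $ j \<ge> 1" using le(1)[of j] by linarith
          ultimately have "W x = 0" by (simp add: W_def step_eq_1)
          then show False using nz by simp
        qed
        ultimately have "0 \<le> x $ i" "x $ i \<le> 2 ^ om j" using 1 by auto
        then show ?thesis using le(2)[of j] by linarith
      next
        case 2
        then have "bump (x $ i) \<noteq> 0" using nz insert(1) by (auto simp: R_def)
        then have "x $ i \<in> {0..1}" using bump_eq_0 by blast
        then show ?thesis using le(1)[of i] le(2)[of i] by (simp only: atLeastAtMost_iff) linarith
      next
        case 3
        then have "b i (x $ i) \<noteq> 0" using nz by (auto simp: R_def)
        then have "x $ i / 2 ^ om i \<in> {0..1}" using bump_eq_0[of "x $ i / 2 ^ om i"] by (auto simp: b_def)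
        then have "0 \<le> x $ i" "x $ i \<le> 2 ^ om i" by (auto simp: field_simps)
        then show ?thesis using le(2)[of i] by linarith
      qed
    qed (intro smth_mult smth_W smth_R)
    then have "accessible (partial j (\<lambda>x. W x * R x))"
      by (rule accessible_partial)
    also have "partial j (\<lambda>x. W x * R x) = (\<lambda>x. (bump (x $ j) - b j (x $ j)) * R x)"
    proof
      fix x :: "real^'n"
      have line: "(x + s *\<^sub>R axis j 1) $ i = x $ i" if "i \<noteq> j" for i s
        using that by (simp add: axis_def)
      have "R (x + s *\<^sub>R axis j 1) = R x" for s
      proof -
        have "(\<Prod>i\<in>I. bump ((x + s *\<^sub>R axis j 1) $ i)) = (\<Prod>i\<in>I. bump (x $ i))"
          using insert(2) by (intro prod.cong refl) (metis line)
        moreover have "(\<Prod>i\<in>-insert j I. b i ((x + s *\<^sub>R axis j 1) $ i)) = (\<Prod>i\<in>-insert j I. b i (x $ i))"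
          by (intro prod.cong refl) (metis ComplD insertI1 line)
        ultimately show ?thesis by (simp only: R_def)
      qed
      then have R0: "partial j R x = 0" unfolding partial_def by simp
      have "((\<lambda>s. step s - step (s / 2 ^ om j)) has_real_derivative (bump (x $ j) - b j (x $ j))) (at (x $ j))"
        by (auto intro!: derivative_eq_intros step_has_derivative DERIV_chain2[OF step_has_derivative] simp: b_def)
      from partial_comp[OF smth_differentiable[OF smth_coord] this, of j]
      have "partial j W x = bump (x $ j) - b j (x $ j)"
        by (simp add: W_def[abs_def] partial_coord)
      then show "partial j (\<lambda>x. W x * R x) x = (bump (x $ j) - b j (x $ j)) * R x"
        by (simp add: partial_mult smth_differentiable smth_W smth_R R0)
    qed
    finally have 1: "accessible (\<lambda>x. (bump (x $ j) - b j (x $ j)) * R x)" .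
    have "- I = insert j (- insert j I)" using insert(2) by auto
    then have "(\<Prod>i\<in>-I. b i (x $ i)) = b j (x $ j) * (\<Prod>i\<in>-insert j I. b i (x $ i))" for x
      by (metis (no_types, lifting) ComplD finite insertI1 prod.insert)
    then have "(\<Prod>i\<in>insert j I. bump (x $ i)) * (\<Prod>i\<in>-insert j I. b i (x $ i)) - (\<Prod>i\<in>UNIV. b i (x $ i))
       = ((\<Prod>i\<in>I. bump (x $ i)) * (\<Prod>i\<in>-I. b i (x $ i)) - (\<Prod>i\<in>UNIV. b i (x $ i))) +
          (bump (x $ j) - b j (x $ j)) * R x" for x
      using insert(1,2) by (simp add: R_def algebra_simps)
    then show ?case using accessible_add[OF insert.IH 1] by (simp only:)
  qed
  from this[of UNIV] show ?thesis unfolding psi2 by (simp add: \<psi>_def)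
qed


subsection \<open>The group law and its dilations\<close>

text \<open>\<open>E \<tau> = exp (\<tau> Bv)\<close>; the series is finite since \<open>Bv\<close> raises the weight.\<close>

definition E :: "real \<Rightarrow> real^'n \<Rightarrow> real^'n" where
  "E \<tau> z = (\<Sum>m<Q. (\<tau> ^ m / fact m) *\<^sub>R (Bv ^^ m) z)"

text \<open>A nonzero entry \<open>B i j\<close> lowers the weight by two from \<open>i\<close> to
  \<open>j\<close>, so row \<open>i\<close> of the \<open>m\<close>-th power could only see
  coordinates of weight \<open>om i - 2 * m\<close>, and weights are positive.\<close>

lemma Bv_funpow_eq_0: "om i \<le> 2 * m \<Longrightarrow> (Bv ^^ m) z $ i = 0"
proof (induction m arbitrary: i)
  case 0
  then show ?case using om_pos[of i] by simp
next
  case (Suc m)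
  have "B i j * (Bv ^^ m) z $ j = 0" for j
    using B_deg[of i j] Suc.IH[of j] Suc.prems by (cases "B i j = 0") auto
  then have "(\<Sum>j\<in>UNIV. B i j * (Bv ^^ m) z $ j) = 0" by (intro sum.neutral ballI)
  then show ?case by (simp add: Bv_nth)
qed

lemma om_le_Q: "om i \<le> Q"
  unfolding Q_def by (rule member_le_sum) auto

lemma Bv_funpow_Q: "(Bv ^^ Q) z = 0"
proof -
  have "(Bv ^^ Q) z $ i = 0" for i
    using Bv_funpow_eq_0[of i Q z] om_le_Q[of i] by simp
  then show ?thesis by (simp add: vec_eq_iff)
qed

lemma Q_ge_3: "Q \<ge> 3"
proof -
  obtain i where i: "i \<noteq> t0" using ex_space by blast
  have "om i + om t0 = (\<Sum>j\<in>{i, t0}. om j)" using i by simp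
  also have "\<dots> \<le> Q" unfolding Q_def by (rule sum_mono2) auto
  finally show ?thesis using om_pos[of i] om_t0 by simp
qed

lemma linear_funpow_Bv: "linear (Bv ^^ m)"
proof (induction m)
  case (Suc m)
  then show ?case by (simp only: funpow.simps) (rule linear_compose[OF _ linear_Bv])
qed (simp add: linear_iff)

lemma linear_E: "linear (E \<tau>)"
proof -
  have "linear (\<lambda>z. (\<tau> ^ m / fact m) *\<^sub>R (Bv ^^ m) z)" for m
    using linear_compose_scale_right[OF linear_funpow_Bv] .
  then show ?thesis unfolding E_def[abs_def] by (intro linear_compose_sum) auto
qed

lemma Bv_E: "Bv (E \<tau> z) = (\<Sum>m<Q. (\<tau> ^ m / fact m) *\<^sub>R (Bv ^^ Suc m) z)"
  by (simp add: E_def linear_sum[OF linear_Bv] linear_cmul[OF linear_Bv])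

lemma E_t0: "E \<tau> z $ t0 = z $ t0"
proof -
  have "E \<tau> z $ t0 = (\<Sum>m<Q. if m = 0 then z $ t0 else 0)"
    unfolding E_def sum_component
  proof (intro sum.cong refl)
    fix m
    show "((\<tau> ^ m / fact m) *\<^sub>R (Bv ^^ m) z) $ t0 = (if m = 0 then z $ t0 else 0)"
      by (cases m) (auto simp: Bv_t0)
  qed
  then show ?thesis using Q_ge_3 by simp
qed

lemma E_0: "E 0 z = z"
proof -
  have "E 0 z = (\<Sum>m<Q. if m = 0 then z else 0)"
    unfolding E_def by (intro sum.cong) auto
  then show ?thesis using Q_ge_3 by simp
qed

lemma divide_fact_Suc: "real (Suc m) * a / fact (Suc m) = a / fact m"
  by (simp only: fact_Suc) (simp del: of_nat_Suc)

lemma E_has_vector_derivative: "((\<lambda>\<tau>. E \<tau> z) has_vector_derivative Bv (E \<tau> z)) (at \<tau>)"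
proof -
  \<comment> \<open>The derivative of the \<open>m\<close>-th term. The value at
    \<open>m = 0\<close> is set to 0, since the truncated \<open>m - 1\<close> would give a false
    term; \<open>g Q = 0\<close> by nilpotency, so the sum can be shifted by one without boundary
    terms.\<close>
  define g where "g m = (if m = 0 then 0 else (\<tau> ^ (m - 1) / fact (m - 1)) *\<^sub>R (Bv ^^ m) z)" for m
  have "((\<lambda>\<tau>. E \<tau> z) has_vector_derivative (\<Sum>m<Q. g m)) (at \<tau>)"
    unfolding E_def
  proof (rule has_vector_derivative_sum)
    fix m
    have "((\<lambda>\<tau>. \<tau> ^ m / fact m) has_real_derivative (of_nat m * \<tau> ^ (m - 1) / fact m)) (at \<tau>)"
      by (auto intro!: derivative_eq_intros)
    from has_vector_derivative_scaleR[OF this has_vector_derivative_const[of "(Bv ^^ m) z"]]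
    have "((\<lambda>\<tau>. (\<tau> ^ m / fact m) *\<^sub>R (Bv ^^ m) z) has_vector_derivative
        (of_nat m * \<tau> ^ (m - 1) / fact m) *\<^sub>R (Bv ^^ m) z) (at \<tau>)" by simp
    moreover have "(of_nat m * \<tau> ^ (m - 1) / fact m) *\<^sub>R (Bv ^^ m) z = g m"
      by (cases m) (simp_all only: g_def divide_fact_Suc, simp_all)
    ultimately show "((\<lambda>\<tau>. (\<tau> ^ m / fact m) *\<^sub>R (Bv ^^ m) z) has_vector_derivative g m) (at \<tau>)"
      by simp
  qed
  also have "(\<Sum>m<Q. g m) = (\<Sum>m<Q. g (Suc m))"
  proof -
    have "g 0 = 0" "g Q = 0" by (simp_all add: g_def Bv_funpow_Q)
    then show ?thesis using sum.lessThan_Suc_shift[of g Q] by simp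
  qed
  also have "\<dots> = Bv (E \<tau> z)"
    by (simp add: Bv_E g_def)
  finally show ?thesis .
qed

text \<open>The derivative in \<open>\<tau>\<close> of the composite is a telescoping sum whose two
  ends vanish, so the composite is constant and equals its value at 0.\<close>

lemma E_minus_E: "E (- \<tau>) (E \<tau> z) = z"
proof -
  have "((\<lambda>\<tau>. E (- \<tau>) (E \<tau> z)) has_vector_derivative 0) (at \<tau>)" for \<tau>
  proof -
    define g where "g m = (if m = 0 then 0 else ((- \<tau>) ^ (m - 1) / fact (m - 1)) *\<^sub>R (Bv ^^ m) (E \<tau> z))" for m
    have "((\<lambda>\<tau>. E (- \<tau>) (E \<tau> z)) has_vector_derivative (\<Sum>m<Q. g (Suc m) - g m)) (at \<tau>)"
      unfolding E_def[of "- _"]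
    proof (rule has_vector_derivative_sum)
      fix m
      have 1: "((\<lambda>\<tau>. (- \<tau>) ^ m / fact m) has_real_derivative (- (of_nat m * (- \<tau>) ^ (m - 1) / fact m))) (at \<tau>)"
        by (auto intro!: derivative_eq_intros)
      have bl: "bounded_linear (Bv ^^ m)"
        using linear_funpow_Bv linear_conv_bounded_linear by blast
      have 2: "((\<lambda>\<tau>. (Bv ^^ m) (E \<tau> z)) has_vector_derivative (Bv ^^ m) (Bv (E \<tau> z))) (at \<tau>)"
        by (rule bounded_linear.has_vector_derivative[OF bl E_has_vector_derivative])
      have "((\<lambda>\<tau>. ((- \<tau>) ^ m / fact m) *\<^sub>R (Bv ^^ m) (E \<tau> z)) has_vector_derivative
          ((- \<tau>) ^ m / fact m) *\<^sub>R (Bv ^^ m) (Bv (E \<tau> z)) + (- (of_nat m * (- \<tau>) ^ (m - 1) / fact m)) *\<^sub>R (Bv ^^ m) (E \<tau> z)) (at \<tau>)"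
        by (rule has_vector_derivative_scaleR[OF 1 2])
      moreover have "((- \<tau>) ^ m / fact m) *\<^sub>R (Bv ^^ m) (Bv (E \<tau> z)) = g (Suc m)"
        by (simp add: g_def funpow_swap1)
      moreover have "(- (of_nat m * (- \<tau>) ^ (m - 1) / fact m)) *\<^sub>R (Bv ^^ m) (E \<tau> z) = - g m"
        by (cases m) (simp_all only: g_def divide_fact_Suc, simp_all)
      ultimately show "((\<lambda>\<tau>. ((- \<tau>) ^ m / fact m) *\<^sub>R (Bv ^^ m) (E \<tau> z)) has_vector_derivative g (Suc m) - g m) (at \<tau>)"
        by simp
    qed
    also have "(\<Sum>m<Q. g (Suc m) - g m) = 0"
    proof -
      have "g 0 = 0" "g Q = 0" by (simp_all add: g_def Bv_funpow_Q)
      then show ?thesis by (simp only: sum_lessThan_telescope) simp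
    qed
    finally show ?thesis .
  qed
  then have "((\<lambda>\<tau>. E (- \<tau>) (E \<tau> z)) has_derivative (\<lambda>h. 0)) (at \<tau> within UNIV)" for \<tau>
    by (simp add: has_vector_derivative_def)
  then obtain c where "\<And>\<tau>. E (- \<tau>) (E \<tau> z) = c"
    using has_derivative_zero_constant[of UNIV "\<lambda>\<tau>. E (- \<tau>) (E \<tau> z)"] by auto
  from this[of 0] this[of \<tau>] show ?thesis by (simp add: E_0)
qed

lemma continuous_on_E [continuous_intros]:
  assumes "continuous_on S f" "continuous_on S g"
  shows "continuous_on S (\<lambda>x. E (f x) (g x))"
proof -
  have "continuous_on UNIV (Bv ^^ m)" for m
    by (simp add: linear_continuous_on linear_conv_bounded_linear[symmetric] linear_funpow_Bv)
  then have "continuous_on S (\<lambda>x. (Bv ^^ m) (g x))" for m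
    by (rule continuous_on_compose2[OF _ assms(2)]) auto
  then show ?thesis
    unfolding E_def by (intro continuous_intros assms) auto
qed

lemma dil_nth: "dil r x $ i = x $ i / r ^ om i"
  by (simp add: dil_def)

lemma linear_dil: "linear (dil r)"
  by (rule linearI) (auto simp: dil_def vec_eq_iff add_divide_distrib)

lemma dil_axis: "dil r (axis i 1) = (1 / r ^ om i) *\<^sub>R axis i 1"
  by (auto simp: dil_def vec_eq_iff axis_def)

lemma dil_Bv: "r > 0 \<Longrightarrow> dil r (Bv x) = (1 / r\<^sup>2) *\<^sub>R Bv (dil r x)"
proof -
  assume r: "r > 0"
  have eq: "B i j * x $ j / r ^ om i = 1 / r\<^sup>2 * (B i j * (x $ j / r ^ om j))" for i j
    using B_deg[of i j] r by (cases "B i j = 0") (auto simp: power_add power2_eq_square)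
  show ?thesis
    by (simp only: vec_eq_iff dil_nth Bv_nth sum_divide_distrib vector_scaleR_component
        real_scaleR_def sum_distrib_left eq) simp
qed

lemma dil_Bv_funpow: "r > 0 \<Longrightarrow> dil r ((Bv ^^ m) x) = (1 / r\<^sup>2) ^ m *\<^sub>R (Bv ^^ m) (dil r x)"
  by (induction m) (simp_all add: dil_Bv linear_cmul[OF linear_Bv])

lemma dil_E: "r > 0 \<Longrightarrow> dil r (E \<tau> x) = E (\<tau> / r\<^sup>2) (dil r x)"
  by (simp add: E_def linear_sum[OF linear_dil] linear_cmul[OF linear_dil] dil_Bv_funpow
      power_divide field_simps)

text \<open>\<open>lam r z w\<close> is \<open>\<delta>\<^bsub>1/r\<^esub> (z\<^sup>-\<^sup>1 \<circ> w)\<close> for the group law \<open>z \<circ> y = y + E (y\<^bsub>t0\<^esub>) z\<close>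
  under which \<open>Y\<close> and the \<open>V\<close>-derivatives are left invariant.\<close>

definition Lam :: "real^'n \<Rightarrow> real^'n \<Rightarrow> real^'n" where
  "Lam z w = w - E (w $ t0 - z $ t0) z"

definition lam :: "real \<Rightarrow> real^'n \<Rightarrow> real^'n \<Rightarrow> real^'n" where
  "lam r z w = dil r (Lam z w)"

lemma Lam_t0: "Lam z w $ t0 = w $ t0 - z $ t0"
  by (simp add: Lam_def E_t0)

lemma lam_t0: "lam r z w $ t0 = (w $ t0 - z $ t0) / r\<^sup>2"
  by (simp add: lam_def dil_nth Lam_t0 om_t0)

text \<open>The right-hand side is the group inverse of \<open>Lam z w\<close>: exchanging the two
  points inverts the relative position. It follows by applying \<open>E\<close> at the opposite time
  to \<open>Lam z w\<close>.\<close>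

lemma Lam_swap: "Lam w z = - E (- (w $ t0 - z $ t0)) (Lam z w)"
  using E_minus_E[of "w $ t0 - z $ t0" z] by (simp add: Lam_def linear_diff[OF linear_E])

lemma lam_swap: "r > 0 \<Longrightarrow> lam r w z = - E (- (lam r z w $ t0)) (lam r z w)"
  unfolding lam_t0 by (simp add: lam_def Lam_swap[of w z] linear_neg[OF linear_dil] dil_E minus_divide_left)

lemma lam_has_derivative:
  "(lam r z has_derivative (\<lambda>v. dil r (v - v $ t0 *\<^sub>R Bv (E (w $ t0 - z $ t0) z)))) (at w)"
proof -
  have "((\<lambda>w. E (w $ t0 - z $ t0) z) has_derivative (\<lambda>v. (v $ t0) *\<^sub>R Bv (E (w $ t0 - z $ t0) z))) (at w)"
    by (rule has_derivative_compose[OF _ E_has_vector_derivative[unfolded has_vector_derivative_def]])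
       (auto intro!: derivative_eq_intros bounded_linear_imp_has_derivative bounded_linear_vec_nth)
  then have "(Lam z has_derivative (\<lambda>v. v - v $ t0 *\<^sub>R Bv (E (w $ t0 - z $ t0) z))) (at w)"
    unfolding Lam_def[abs_def] by (intro has_derivative_diff has_derivative_ident)
  moreover have "(dil r has_derivative dil r) (at x)" for x
    by (simp add: bounded_linear_imp_has_derivative linear_conv_bounded_linear[symmetric] linear_dil)
  ultimately show ?thesis
    unfolding lam_def[abs_def] by (rule has_derivative_compose)
qed

lemma smth_lam: "smth (\<lambda>w. lam r z w $ i)"
  unfolding lam_def dil_nth Lam_def E_def divide_inverse vector_minus_component sum_component
    vector_scaleR_component real_scaleR_def
  by (intro smth_mult smth_diff smth_sum smth_power smth_coord smth_const)

lemma smth_compose_lam: "smth \<phi> \<Longrightarrow> smth (\<lambda>w. \<phi> (lam r z w))"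
  by (rule smth_compose[OF _ smth_lam])

lemma continuous_on_lam [continuous_intros]:
  assumes "continuous_on S f" "continuous_on S g"
  shows "continuous_on S (\<lambda>x. lam r (f x) (g x))"
  unfolding lam_def dil_def Lam_def divide_inverse
  by (intro continuous_on_vec_lambda continuous_intros assms)

text \<open>A direction in \<open>V\<close> does not move the time, so the transported centre
  \<open>E (w $ t0 - z $ t0) z\<close> stays fixed and only the dilation, of weight 1, is
  felt.\<close>

lemma partial_lam:
  assumes "smth \<phi>" "i \<in> V"
  shows "partial i (\<lambda>w. \<phi> (lam r z w)) w = partial i \<phi> (lam r z w) / r"
proof -
  obtain D where D: "(\<phi> has_derivative D) (at (lam r z w))"
    using smth_differentiable[OF assms(1)] by (auto simp: differentiable_def)
  interpret D: bounded_linear D using D by (rule has_derivative_bounded_linear)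
  have i: "om i = 1" "i \<noteq> t0" using assms(2) om_t0 by (auto simp: V_def)
  have "axis i (1::real) $ t0 = 0" using i by (simp add: axis_def)
  then have "partial i (\<lambda>w. \<phi> (lam r z w)) w = D (dil r (axis i 1))"
    using partial_has_derivative[OF has_derivative_compose[OF lam_has_derivative D], of i] by simp
  then show ?thesis
    using i by (simp add: dil_axis D.scaleR partial_has_derivative[OF D])
qed

text \<open>Along \<open>Y\<close> the transported centre \<open>E (w $ t0 - z $ t0) z\<close> moves
  with velocity \<open>Bv\<close> of itself, which turns \<open>Bv w\<close> into
  \<open>Bv (Lam z w)\<close> by linearity. Time and drift are both homogeneous of degree 2, whence
  the factor.\<close>

lemma Y_lam:
  assumes "smth \<phi>" "r > 0"
  shows "Y (\<lambda>w. \<phi> (lam r z w)) w = Y \<phi> (lam r z w) / r\<^sup>2"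
proof -
  obtain D where D: "(\<phi> has_derivative D) (at (lam r z w))"
    using smth_differentiable[OF assms(1)] by (auto simp: differentiable_def)
  interpret D: bounded_linear D using D by (rule has_derivative_bounded_linear)
  let ?v = "axis t0 1 + Bv w"
  have v: "?v - ?v $ t0 *\<^sub>R Bv (E (w $ t0 - z $ t0) z) = axis t0 1 + Bv (Lam z w)"
    by (simp add: Bv_t0 Lam_def linear_diff[OF linear_Bv])
  have "dil r (axis t0 1 + Bv (Lam z w)) = (1 / r\<^sup>2) *\<^sub>R (axis t0 1 + Bv (lam r z w))"
    using assms(2) by (simp add: linear_add[OF linear_dil] dil_axis om_t0 dil_Bv lam_def scaleR_add_right)
  moreover from has_derivative_compose[OF lam_has_derivative D]
  have "Y (\<lambda>w. \<phi> (lam r z w)) w = D (dil r (?v - ?v $ t0 *\<^sub>R Bv (E (w $ t0 - z $ t0) z)))"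
    by (rule Y_has_derivative)
  ultimately have "Y (\<lambda>w. \<phi> (lam r z w)) w = D ((1 / r\<^sup>2) *\<^sub>R (axis t0 1 + Bv (lam r z w)))"
    by (simp only: v)
  then show ?thesis by (simp add: D.scaleR Y_has_derivative[OF D])
qed

lemma lam_double: "lam (2 * r) z w = dil 2 (lam r z w)"
  by (simp add: lam_def dil_def vec_eq_iff power_mult_distrib)

subsection \<open>Kinetic balls\<close>

definition kball :: "real \<Rightarrow> real \<Rightarrow> real^'n \<Rightarrow> (real^'n) set" where
  "kball c r z = {w. \<forall>i. \<bar>lam r z w $ i\<bar> \<le> c}"

lemma E_bounded:
  obtains c' where "c' > 0" "\<And>\<sigma> y. \<bar>\<sigma>\<bar> \<le> c \<Longrightarrow> norm y \<le> R \<Longrightarrow> norm (E \<sigma> y) \<le> c'"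
proof -
  have "compact ((\<lambda>(\<sigma>, y). E \<sigma> y) ` ({-c..c} \<times> cball 0 R))"
    by (intro compact_continuous_image compact_Times)
       (auto simp: split_beta' intro!: continuous_intros)
  then obtain c' where c': "c' > 0" "\<forall>x\<in>(\<lambda>(\<sigma>, y). E \<sigma> y) ` ({-c..c} \<times> cball 0 R). norm x \<le> c'"
    using compact_imp_bounded bounded_pos by metis
  show thesis
    by (rule that[OF c'(1)]) (use c'(2) in \<open>auto simp: abs_le_iff\<close>)
qed

text \<open>By \<open>lam_swap\<close> the exchanged relative position is a continuous function of
  the dilated one, with no separate dependence on \<open>r\<close>; compactness therefore gives one
  \<open>c'\<close> for all scales and centres.\<close>

lemma kball_swap:
  obtains c' where "c' > 0" "\<And>r z w. r > 0 \<Longrightarrow> w \<in> kball c r z \<Longrightarrow> z \<in> kball c' r w"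
proof -
  obtain c' where c': "c' > 0" "\<And>\<sigma> y. \<bar>\<sigma>\<bar> \<le> c \<Longrightarrow> norm y \<le> real CARD('n) * c \<Longrightarrow> norm (E \<sigma> y) \<le> c'"
    using E_bounded by metis
  show thesis
  proof (rule that[OF c'(1)])
    fix r z w assume r: "r > 0" and w: "w \<in> kball c r z"
    have *: "\<bar>lam r z w $ i\<bar> \<le> c" for i using w by (auto simp: kball_def)
    have "norm (lam r z w) \<le> (\<Sum>i\<in>UNIV. \<bar>lam r z w $ i\<bar>)" by (rule norm_le_l1_cart)
    also have "\<dots> \<le> real CARD('n) * c" using sum_bounded_above[of UNIV "\<lambda>i. \<bar>lam r z w $ i\<bar>" c] * by simp
    finally have "norm (lam r w z) \<le> c'"
      using c'(2)[of "- (lam r z w $ t0)" "lam r z w"] *[of t0] by (simp add: lam_swap[OF r, of w z])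
    then show "z \<in> kball c' r w"
      unfolding kball_def using component_le_norm_cart order_trans by blast
  qed
qed

lemma norm_Lam_le:
  assumes r: "0 < r" "r \<le> 1" and w: "w \<in> kball c r z" and c: "c \<ge> 0"
  shows "norm (Lam z w) \<le> real CARD('n) * (c * r)"
proof -
  have "\<bar>Lam z w $ i\<bar> \<le> c * r" for i
  proof -
    have "\<bar>Lam z w $ i\<bar> \<le> c * r ^ om i"
      using w r by (auto simp: kball_def lam_def dil_nth abs_divide divide_le_eq)
    also have "\<dots> \<le> c * r ^ 1"
      using om_pos[of i] r c by (intro mult_left_mono power_decreasing) auto
    finally show ?thesis by simp
  qed
  then have "(\<Sum>i\<in>UNIV. \<bar>Lam z w $ i\<bar>) \<le> real CARD('n) * (c * r)"
    using sum_bounded_above[of UNIV "\<lambda>i. \<bar>Lam z w $ i\<bar>" "c * r"] by simp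
  then show ?thesis using norm_le_l1_cart[of "Lam z w"] by linarith
qed

lemma kball_bounded:
  assumes "c \<ge> 0"
  obtains R' where "R' > 0" "\<And>r z w. 0 < r \<Longrightarrow> r \<le> 1 \<Longrightarrow> norm z \<le> R \<Longrightarrow> w \<in> kball c r z \<Longrightarrow> norm w \<le> R'"
proof -
  obtain c' where c': "c' > 0" "\<And>\<sigma> y. \<bar>\<sigma>\<bar> \<le> c \<Longrightarrow> norm y \<le> R \<Longrightarrow> norm (E \<sigma> y) \<le> c'"
    using E_bounded by metis
  show thesis
  proof (rule that[of "c' + real CARD('n) * c"])
    show "0 < c' + real CARD('n) * c" using c'(1) assms by (intro add_pos_nonneg) auto
    fix r z w assume r: "0 < r" "r \<le> 1" and z: "norm z \<le> R" and w: "w \<in> kball c r z"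
    have "\<bar>w $ t0 - z $ t0\<bar> \<le> c * r\<^sup>2"
      using w r by (auto simp: kball_def lam_t0 divide_le_eq dest!: spec[of _ t0])
    also have "\<dots> \<le> c" using r assms by (simp add: mult_left_le power_le_one)
    finally have "norm (E (w $ t0 - z $ t0) z) \<le> c'" using c' z by blast
    moreover have "norm (Lam z w) \<le> real CARD('n) * c"
      using norm_Lam_le[OF r w assms] r assms by (smt (verit) mult_left_le mult_left_mono of_nat_0_le_iff)
    moreover have "w = E (w $ t0 - z $ t0) z + Lam z w" by (simp add: Lam_def)
    ultimately show "norm w \<le> c' + real CARD('n) * c"
      using norm_triangle_ineq[of "E (w $ t0 - z $ t0) z" "Lam z w"] by simp
  qed
qed

lemma kball_shrinks:
  assumes "c \<ge> 0" "\<epsilon> > 0"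
  shows "\<exists>\<delta>>0. \<forall>r w. 0 < r \<longrightarrow> r < \<delta> \<longrightarrow> w \<in> kball c r z \<longrightarrow> dist w z < \<epsilon>"
proof -
  have "continuous_on UNIV (\<lambda>\<tau>. E \<tau> z)" by (intro continuous_intros)
  then have "isCont (\<lambda>\<tau>. E \<tau> z) 0" by (simp add: continuous_on_eq_continuous_at)
  then obtain \<delta>1 where d1: "\<delta>1 > 0" "\<And>\<tau>. \<bar>\<tau>\<bar> < \<delta>1 \<Longrightarrow> dist (E \<tau> z) z < \<epsilon> / 2"
    using assms(2) unfolding continuous_at_eps_delta
    by (metis E_0 diff_0_right dist_norm half_gt_zero real_norm_def)
  \<comment> \<open>The three entries ensure \<open>r \<le> 1\<close>, a time displacement below
    \<open>\<delta>1\<close> and a norm of \<open>Lam z w\<close> below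
    \<open>\<epsilon> / 2\<close>. Using \<open>c + 1\<close> keeps the denominators positive when
    \<open>c = 0\<close>.\<close>
  define \<delta> where "\<delta> = min 1 (min (\<delta>1 / (c + 1)) (\<epsilon> / (2 * (real CARD('n) * (c + 1)))))"
  have pos: "\<delta> > 0" using d1(1) assms by (simp add: \<delta>_def)
  have "dist w z < \<epsilon>" if r: "0 < r" "r < \<delta>" and w: "w \<in> kball c r z" for r w
  proof -
    have r1: "r \<le> 1" and r2: "r * (c + 1) < \<delta>1" and r3: "r * (2 * (real CARD('n) * (c + 1))) < \<epsilon>"
      using r assms by (simp_all add: \<delta>_def less_divide_eq)
    have "\<bar>w $ t0 - z $ t0\<bar> \<le> c * r\<^sup>2"
      using w r by (auto simp: kball_def lam_t0 divide_le_eq dest!: spec[of _ t0])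
    also have "\<dots> \<le> c * r" using r(1) r1 assms by (intro mult_left_mono) (auto simp: power2_eq_square mult_left_le)
    also have "\<dots> < \<delta>1" using r2 r(1) by (simp add: algebra_simps)
    finally have "dist (E (w $ t0 - z $ t0) z) z < \<epsilon> / 2" by (rule d1(2))
    moreover have "norm (Lam z w) < \<epsilon> / 2"
    proof -
      have "norm (Lam z w) \<le> real CARD('n) * (c * r)" using norm_Lam_le[OF r(1) r1 w assms(1)] .
      also have "\<dots> \<le> real CARD('n) * ((c + 1) * r)" using r(1) by (intro mult_left_mono) auto
      also have "\<dots> < \<epsilon> / 2" using r3 by (simp add: mult_ac)
      finally show ?thesis .
    qed
    moreover have "w - z = (E (w $ t0 - z $ t0) z - z) + Lam z w" by (simp add: Lam_def)
    then have "norm (w - z) \<le> norm (E (w $ t0 - z $ t0) z - z) + norm (Lam z w)"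
      by (metis norm_triangle_ineq)
    ultimately show ?thesis unfolding dist_norm by linarith
  qed
  then show ?thesis using pos by blast
qed

lemma test_fun_compose_lam:
  assumes "cpt_smth \<phi>" "r > 0"
  shows "test_fun (\<lambda>w. \<phi> (lam r z w))"
  unfolding test_fun_def
proof
  show "smooth_fun (\<lambda>w. \<phi> (lam r z w))"
    using assms by (intro smth_imp_smooth_fun smth_compose_lam cpt_smth_smth)
  obtain c where c: "c > 0" "\<And>x i. \<phi> x \<noteq> 0 \<Longrightarrow> \<bar>x $ i\<bar> \<le> c" using assms(1) by (rule cpt_smthE) blast
  obtain c' where c': "c' > 0" "\<And>\<sigma> y. \<bar>\<sigma>\<bar> \<le> c * r\<^sup>2 \<Longrightarrow> norm y \<le> norm z \<Longrightarrow> norm (E \<sigma> y) \<le> c'"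
    using E_bounded by metis
  have "norm w \<le> c' + (\<Sum>i\<in>UNIV. c * r ^ om i)" if "\<phi> (lam r z w) \<noteq> 0" for w
  proof -
    have l: "\<bar>lam r z w $ i\<bar> \<le> c" for i using c(2)[OF that] .
    have "\<bar>w $ t0 - z $ t0\<bar> \<le> c * r\<^sup>2" using l[of t0] assms(2) by (simp add: lam_t0 divide_le_eq)
    then have "norm (E (w $ t0 - z $ t0) z) \<le> c'" using c' by blast
    moreover have "norm (Lam z w) \<le> (\<Sum>i\<in>UNIV. \<bar>Lam z w $ i\<bar>)" by (rule norm_le_l1_cart)
    moreover have "(\<Sum>i\<in>UNIV. \<bar>Lam z w $ i\<bar>) \<le> (\<Sum>i\<in>UNIV. c * r ^ om i)"
      using l assms(2) by (intro sum_mono) (auto simp: lam_def dil_nth abs_divide divide_le_eq)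
    moreover have "w = E (w $ t0 - z $ t0) z + Lam z w" by (simp add: Lam_def)
    ultimately show ?thesis
      using norm_triangle_ineq[of "E (w $ t0 - z $ t0) z" "Lam z w"] by simp
  qed
  then have "bounded {w. \<phi> (lam r z w) \<noteq> 0}" unfolding bounded_iff by blast
  then show "compact (closure {w. \<phi> (lam r z w) \<noteq> 0})" by (simp add: compact_closure)
qed

subsection \<open>Invariance of Lebesgue measure\<close>

lemma Lam_measurable [measurable]: "Lam z \<in> borel_measurable borel"
  unfolding Lam_def[abs_def] by (intro borel_measurable_continuous_onI continuous_intros)

lemma dil_measurable [measurable]: "dil r \<in> borel_measurable borel"
  by (intro borel_measurable_continuous_onI linear_continuous_on)
     (simp add: linear_conv_bounded_linear[symmetric] linear_dil)

lemma lam_measurable [measurable]: "lam r z \<in> borel_measurable borel"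
  unfolding lam_def[abs_def] by measurable

lemma distr_Lam: "distr lborel borel (Lam z) = lborel"
proof -
  let ?e = "axis t0 1 :: real^'n"
  \<comment> \<open>The time component of \<open>E (t - z $ t0) z\<close> is always
    \<open>z $ t0\<close>. Removing it makes the shift orthogonal to \<open>?e\<close>, so that
    \<open>Lam z\<close> is a shear followed by a constant translation in time.\<close>
  let ?u = "\<lambda>t. E (t - z $ t0) z - z $ t0 *\<^sub>R ?e"
  have "?u \<in> borel_measurable borel"
    by (intro borel_measurable_continuous_onI continuous_intros)
  then have 1: "distr lborel borel (\<lambda>w. w - ?u (w \<bullet> ?e)) = lborel"
    by (rule distr_lborel_shear) (auto simp: axis_in_Basis_iff inner_diff_left inner_axis E_t0)
  have [measurable]: "(\<lambda>w. w - ?u (w \<bullet> ?e)) \<in> borel_measurable borel"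
    by (intro borel_measurable_continuous_onI continuous_intros)
  have "distr lborel borel (Lam z) = distr lborel borel ((+) (- (z $ t0 *\<^sub>R ?e)) \<circ> (\<lambda>w. w - ?u (w \<bullet> ?e)))"
    by (intro distr_cong) (auto simp: Lam_def inner_axis)
  also have "\<dots> = distr (distr lborel borel (\<lambda>w. w - ?u (w \<bullet> ?e))) borel ((+) (- (z $ t0 *\<^sub>R ?e)))"
    by (subst distr_distr) auto
  also have "\<dots> = lborel" unfolding 1 by (rule lborel_distr_plus)
  finally show ?thesis .
qed

lemma nn_integral_dil:
  assumes r: "r > 0" and [measurable]: "h \<in> borel_measurable borel"
  shows "(\<integral>\<^sup>+w. h (dil r w) \<partial>lborel) = ennreal (r ^ Q) * (\<integral>\<^sup>+w. h w \<partial>lborel)"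
proof -
  define c :: "real^'n \<Rightarrow> real" where "c b = (\<Sum>i\<in>UNIV. b $ i / r ^ om i)" for b
  have c: "c (axis i 1) = 1 / r ^ om i" for i
    by (simp add: c_def axis_def if_distrib[where f="\<lambda>u. u / _"] cong: if_cong)
  have Basis: "(Basis :: (real^'n) set) = (\<lambda>i. axis i 1) ` UNIV" by (auto simp: Basis_vec_def)
  have inj: "inj (\<lambda>i. axis i (1::real) :: real^'n)" by (auto simp: inj_on_def axis_eq_axis)
  have T: "(0 + (\<Sum>j\<in>Basis. (c j * (x \<bullet> j)) *\<^sub>R j)) = dil r x" for x :: "real^'n"
    unfolding Basis sum.reindex[OF inj] o_def c inner_axis
    by (simp add: vec_eq_iff dil_nth axis_def if_distrib cong: if_cong)
  have P: "(\<Prod>j\<in>Basis. \<bar>c j\<bar>) = 1 / r ^ Q"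
    unfolding Basis prod.reindex[OF inj] using r by (simp add: c prod_dividef Q_def power_sum)
  have "lborel = density (distr lborel borel (\<lambda>x::real^'n. 0 + (\<Sum>j\<in>Basis. (c j * (x \<bullet> j)) *\<^sub>R j))) (\<lambda>_. ennreal (\<Prod>j\<in>Basis. \<bar>c j\<bar>))"
    using r by (intro lborel_affine_euclidean) (auto simp: Basis c)
  then have eq: "lborel = density (distr lborel borel (dil r)) (\<lambda>_. ennreal (1 / r ^ Q))"
    unfolding T P .
  have "(\<integral>\<^sup>+w. h w \<partial>lborel) = ennreal (1 / r ^ Q) * (\<integral>\<^sup>+w. h (dil r w) \<partial>lborel)"
    by (subst eq) (simp add: nn_integral_density nn_integral_distr nn_integral_cmult)
  moreover have "ennreal (r ^ Q) * ennreal (1 / r ^ Q) = 1"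
    using r by (simp add: ennreal_mult[symmetric])
  ultimately show ?thesis by (simp add: mult.assoc[symmetric])
qed

lemma nn_integral_lam:
  assumes "r > 0" and [measurable]: "h \<in> borel_measurable borel"
  shows "(\<integral>\<^sup>+w. h (lam r z w) \<partial>lborel) = ennreal (r ^ Q) * (\<integral>\<^sup>+w. h w \<partial>lborel)"
proof -
  have "(\<integral>\<^sup>+w. h (lam r z w) \<partial>lborel) = (\<integral>\<^sup>+y. h (dil r y) \<partial>(distr lborel borel (Lam z)))"
    unfolding lam_def by (subst nn_integral_distr) auto
  then show ?thesis by (simp add: distr_Lam nn_integral_dil assms)
qed

definition kmass :: "real \<Rightarrow> real" where "kmass c = (2 * c) ^ CARD('n)"

lemma kball_measurable [measurable]: "kball c r z \<in> sets borel"
proof -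
  have "kball c r z = {w \<in> space borel. \<forall>i. \<bar>lam r z w $ i\<bar> \<le> c}" by (auto simp: kball_def)
  also have "\<dots> \<in> sets borel" by measurable
  finally show ?thesis .
qed

lemma emeasure_kball:
  assumes "r > 0" "c > 0"
  shows "emeasure lborel (kball c r z) = ennreal (kmass c * r ^ Q)"
proof -
  let ?S = "cbox (\<chi> i. - c) (\<chi> i. c) :: (real^'n) set"
  have "emeasure lborel (kball c r z) = (\<integral>\<^sup>+w. indicator ?S (lam r z w) \<partial>lborel)"
    by (subst nn_integral_indicator[symmetric], measurable, intro nn_integral_cong)
       (auto simp: kball_def indicator_def mem_box_cart abs_le_iff minus_le_iff)
  also have "\<dots> = ennreal (r ^ Q) * emeasure lborel ?S"
    by (subst nn_integral_lam) (auto simp: assms)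
  also have "emeasure lborel ?S = ennreal (kmass c)"
  proof (subst emeasure_lborel_cbox)
    have Basis: "(Basis :: (real^'n) set) = (\<lambda>i. axis i 1) ` UNIV" by (auto simp: Basis_vec_def)
    have inj: "inj (\<lambda>i. axis i (1::real) :: real^'n)" by (auto simp: inj_on_def axis_eq_axis)
    show "ennreal (\<Prod>b\<in>Basis. ((\<chi> i. c) - (\<chi> i. - c)) \<bullet> (b::real^'n)) = ennreal (kmass c)"
      unfolding Basis prod.reindex[OF inj] by (simp add: inner_axis kmass_def)
  qed (use assms in \<open>auto simp: Basis_vec_def inner_axis\<close>)
  finally show ?thesis using assms by (simp add: ennreal_mult[symmetric] kmass_def mult.commute)
qed

lemma nn_integral_psi: "(\<integral>\<^sup>+x. ennreal (\<psi> x) \<partial>lborel) = 1"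
proof -
  have Basis: "(Basis :: (real^'n) set) = (\<lambda>i. axis i 1) ` UNIV" by (auto simp: Basis_vec_def)
  have inj: "inj (\<lambda>i. axis i (1::real) :: real^'n)" by (auto simp: inj_on_def axis_eq_axis)
  have "(\<integral>\<^sup>+x. ennreal (\<psi> x) \<partial>lborel) = (\<integral>\<^sup>+x. (\<Prod>b\<in>Basis. ennreal (bump (x \<bullet> b))) \<partial>(lborel :: (real^'n) measure))"
    unfolding Basis prod.reindex[OF inj]
    by (simp add: \<psi>_def prod_ennreal bump_nonneg inner_axis)
  also have "\<dots> = 1"
    by (subst nn_integral_lborel_prod) (auto simp: nn_integral_bump)
  finally show ?thesis .
qed

end

subsection \<open>Averages over kinetic balls\<close>

lemma ennreal_tendsto_0I:
  fixes X :: "nat \<Rightarrow> ennreal"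
  assumes "\<And>e::real. e > 0 \<Longrightarrow> eventually (\<lambda>n. X n \<le> ennreal e) sequentially"
  shows "X \<longlonglongrightarrow> 0"
proof (rule order_tendstoI)
  fix a :: ennreal assume "0 < a"
  then obtain e where e: "0 < e" "e < a" using dense by blast
  obtain r where r: "e = ennreal r" "r > 0"
    using e by (cases e) (auto simp: ennreal_zero_less_top top_unique not_less[symmetric] intro: ennreal_less_zero_iff)
  show "eventually (\<lambda>n. X n < a) sequentially"
    using assms[OF r(2)] by eventually_elim (use e r in auto)
qed simp

context kolmogorov
begin

definition kker :: "real \<Rightarrow> int \<Rightarrow> real^'n \<Rightarrow> real^'n \<Rightarrow> ennreal" where
  "kker c m z w = ennreal (1 / (dyadic m) ^ Q) * indicator (kball c (dyadic m) z) w"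

lemma lam_pair_measurable:
  "(\<lambda>x. lam r (fst x) (snd x)) \<in> borel_measurable (lborel \<Otimes>\<^sub>M lborel)"
proof -
  have "(\<lambda>x. lam r (fst x) (snd x)) \<in> borel_measurable borel"
    by (intro borel_measurable_continuous_onI continuous_intros)
  then show ?thesis by (simp add: lborel_prod)
qed

lemma kker_measurable: "(\<lambda>(z, w). kker c m z w) \<in> borel_measurable (lborel \<Otimes>\<^sub>M lborel)"
proof -
  note [measurable] = lam_pair_measurable
  have "{x \<in> space (lborel \<Otimes>\<^sub>M lborel). \<forall>i. \<bar>lam (dyadic m) (fst x) (snd x) $ i\<bar> \<le> c} \<in> sets (lborel \<Otimes>\<^sub>M lborel)"
    (is "?A \<in> _") by measurable
  then have "(\<lambda>x. ennreal (1 / (dyadic m) ^ Q) * indicator ?A x) \<in> borel_measurable (lborel \<Otimes>\<^sub>M lborel)"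
    by measurable
  also have "(\<lambda>x. ennreal (1 / (dyadic m) ^ Q) * indicator ?A x) = (\<lambda>(z, w). kker c m z w)"
    by (auto simp: kker_def kball_def indicator_def space_pair_measure)
  finally show ?thesis .
qed

lemma powr_Q: "(dyadic m) ^ Q = 2 powr (real Q * real_of_int m)"
  by (simp add: powr_realpow[symmetric] powr_powr mult.commute)

lemma dyadic_kernel_kker:
  assumes c: "c > 0"
  obtains C where "dyadic_kernel lborel (kker c) (real Q) C"
proof -
  obtain c' where c': "c' > 0" "\<And>r z w. r > 0 \<Longrightarrow> w \<in> kball c r z \<Longrightarrow> z \<in> kball c' r w"
    using kball_swap by metis
  have mass: "ennreal (1 / r ^ Q) * emeasure lborel (kball a r z) = ennreal (kmass a)"
    if "r > 0" "a > 0" for a r z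
    using that by (simp add: emeasure_kball ennreal_mult[symmetric] kmass_def)
  \<comment> \<open>The first summand serves the rows and the second the columns, where
    \<open>kball_swap\<close> replaces the set of centres by a ball with constant \<open>c'\<close>;
    the 1 serves the supremum bound.\<close>
  define C where "C = kmass c + kmass c' + 1"
  have km: "kmass c > 0" "kmass c' > 0" using c c' by (auto simp: kmass_def)
  interpret sigma_finite_measure "lborel :: (real^'n) measure" by (rule sigma_finite_lborel)
  have "dyadic_kernel lborel (kker c) (real Q) C"
  proof
    show "(\<lambda>(z, w). kker c m z w) \<in> borel_measurable (lborel \<Otimes>\<^sub>M lborel)" for m by (rule kker_measurable)
    show "2 < real Q" using Q_ge_3 by simp
    show "0 < C" using km by (simp add: C_def)
  next
    fix m z
    have "(\<integral>\<^sup>+w. kker c m z w \<partial>lborel) = ennreal (kmass c)"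
      unfolding kker_def using c by (simp add: nn_integral_cmult mass)
    also have "\<dots> \<le> ennreal C" using km by (intro ennreal_leI) (simp add: C_def)
    finally show "(\<integral>\<^sup>+w. kker c m z w \<partial>lborel) \<le> ennreal C" .
  next
    fix m w
    have "(\<integral>\<^sup>+z. kker c m z w \<partial>lborel)
        \<le> (\<integral>\<^sup>+z. ennreal (1 / (dyadic m) ^ Q) * indicator (kball c' (dyadic m) w) z \<partial>lborel)"
      unfolding kker_def using c'(2)[of "dyadic m" w]
      by (intro nn_integral_mono mult_left_mono) (auto simp: indicator_def)
    also have "\<dots> = ennreal (kmass c')"
      using c' by (simp add: nn_integral_cmult mass)
    also have "\<dots> \<le> ennreal C" using km by (intro ennreal_leI) (simp add: C_def)
    finally show "(\<integral>\<^sup>+z. kker c m z w \<partial>lborel) \<le> ennreal C" .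
  next
    fix m z w
    have "kker c m z w \<le> ennreal (1 / (dyadic m) ^ Q)"
      by (auto simp: kker_def indicator_def)
    also have "1 / (dyadic m) ^ Q = 2 powr (- real Q * real_of_int m)"
      by (simp add: powr_Q powr_minus field_simps)
    also have "ennreal \<dots> \<le> ennreal (C * 2 powr (- real Q * real_of_int m))"
      using km by (intro ennreal_leI) (simp add: C_def)
    finally show "kker c m z w \<le> ennreal (C * 2 powr (- real Q * real_of_int m))" .
  qed
  then show thesis by (rule that)
qed

section \<open>L1 continuity along shrinking kinetic balls\<close>

definition oscil :: "real \<Rightarrow> nat \<Rightarrow> (real^'n \<Rightarrow> real) \<Rightarrow> ennreal" where
  "oscil c n h = (\<integral>\<^sup>+z. \<integral>\<^sup>+w. kker c (- int n) z w * ennreal \<bar>h w - h z\<bar> \<partial>lborel \<partial>lborel)"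

text \<open>The triangle inequality through \<open>h2 w\<close> and \<open>h2 z\<close> leaves the
  deviation at \<open>w\<close> and at \<open>z\<close>; the column bound controls one and the row
  bound the other. The constant does not depend on \<open>n\<close>, which makes vanishing
  oscillation stable under L1 limits.\<close>

lemma oscil_perturb:
  assumes dk: "dyadic_kernel lborel (kker c) (real Q) C"
    and [measurable]: "h1 \<in> borel_measurable borel" "h2 \<in> borel_measurable borel"
  shows "oscil c n h1 \<le> oscil c n h2 + ennreal (2 * C) * (\<integral>\<^sup>+w. ennreal \<bar>h1 w - h2 w\<bar> \<partial>lborel)"
proof -
  interpret dk: dyadic_kernel lborel "kker c" "real Q" C by (rule dk)
  note [measurable] = dk.k_measurable
  define k where "k = kker c (- int n)"
  have [measurable]: "(\<lambda>(z, w). k z w) \<in> borel_measurable (lborel \<Otimes>\<^sub>M lborel)"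
    "k z \<in> borel_measurable lborel" for z
    using dk.k_measurable2(2)[of z "- int n"] by (auto simp: k_def kker_measurable)
  define D where "D w = ennreal \<bar>h1 w - h2 w\<bar>" for w
  have [measurable]: "D \<in> borel_measurable borel" unfolding D_def[abs_def] by measurable
  have "oscil c n h1 \<le> (\<integral>\<^sup>+z. \<integral>\<^sup>+w. k z w * ennreal \<bar>h2 w - h2 z\<bar> + k z w * D w + k z w * D z \<partial>lborel \<partial>lborel)"
    unfolding oscil_def k_def[symmetric]
  proof (intro nn_integral_mono)
    fix z w
    have "ennreal \<bar>h1 w - h1 z\<bar> \<le> ennreal (\<bar>h2 w - h2 z\<bar> + \<bar>h1 w - h2 w\<bar> + \<bar>h1 z - h2 z\<bar>)"
      by (intro ennreal_leI) linarith
    then have "k z w * ennreal \<bar>h1 w - h1 z\<bar> \<le> k z w * (ennreal \<bar>h2 w - h2 z\<bar> + D w + D z)"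
      by (intro mult_left_mono) (auto simp: D_def)
    then show "k z w * ennreal \<bar>h1 w - h1 z\<bar> \<le> k z w * ennreal \<bar>h2 w - h2 z\<bar> + k z w * D w + k z w * D z"
      by (simp add: distrib_left)
  qed
  also have "\<dots> = (\<integral>\<^sup>+z. (\<integral>\<^sup>+w. k z w * ennreal \<bar>h2 w - h2 z\<bar> \<partial>lborel) + (\<integral>\<^sup>+w. k z w * D w \<partial>lborel)
      + (\<integral>\<^sup>+w. k z w \<partial>lborel) * D z \<partial>lborel)"
    by (intro nn_integral_cong) (simp add: nn_integral_add nn_integral_multc)
  also have "\<dots> = (\<integral>\<^sup>+z. (\<integral>\<^sup>+w. k z w * ennreal \<bar>h2 w - h2 z\<bar> \<partial>lborel) + (\<integral>\<^sup>+w. k z w * D w \<partial>lborel) \<partial>lborel)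
      + (\<integral>\<^sup>+z. (\<integral>\<^sup>+w. k z w \<partial>lborel) * D z \<partial>lborel)"
    by (rule nn_integral_add) measurable
  also have "(\<integral>\<^sup>+z. (\<integral>\<^sup>+w. k z w * ennreal \<bar>h2 w - h2 z\<bar> \<partial>lborel) + (\<integral>\<^sup>+w. k z w * D w \<partial>lborel) \<partial>lborel)
      = (\<integral>\<^sup>+z. \<integral>\<^sup>+w. k z w * ennreal \<bar>h2 w - h2 z\<bar> \<partial>lborel \<partial>lborel) + (\<integral>\<^sup>+z. \<integral>\<^sup>+w. k z w * D w \<partial>lborel \<partial>lborel)"
    by (rule nn_integral_add) measurable
  also have "(\<integral>\<^sup>+z. \<integral>\<^sup>+w. k z w * ennreal \<bar>h2 w - h2 z\<bar> \<partial>lborel \<partial>lborel) = oscil c n h2"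
    by (simp add: oscil_def k_def)
  also have "(\<integral>\<^sup>+z. \<integral>\<^sup>+w. k z w * D w \<partial>lborel \<partial>lborel) = (\<integral>\<^sup>+z. dk.avg (- int n) D z \<partial>lborel)"
    by (simp add: dk.avg_def k_def)
  also have "oscil c n h2 + (\<integral>\<^sup>+z. dk.avg (- int n) D z \<partial>lborel) + (\<integral>\<^sup>+z. (\<integral>\<^sup>+w. k z w \<partial>lborel) * D z \<partial>lborel)
      \<le> oscil c n h2 + ennreal C * (\<integral>\<^sup>+w. D w \<partial>lborel) + (\<integral>\<^sup>+z. ennreal C * D z \<partial>lborel)"
    unfolding k_def by (intro add_mono order_refl dk.nn_integral_avg_le nn_integral_mono mult_right_mono dk.k_row) auto
  also have "\<dots> = oscil c n h2 + ennreal (2 * C) * (\<integral>\<^sup>+w. D w \<partial>lborel)"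
  proof -
    have "ennreal (2 * C) = ennreal C + ennreal C"
      using ennreal_plus[of C C] dk.C_pos by simp
    then show ?thesis by (simp add: nn_integral_cmult distrib_right add.assoc)
  qed
  finally show ?thesis unfolding D_def .
qed

lemma kball_eventually_subset:
  assumes "open U" "z \<in> U" "c \<ge> 0"
  shows "eventually (\<lambda>n. kball c (dyadic (- int n)) z \<subseteq> U) sequentially"
proof -
  obtain e where e: "e > 0" "ball z e \<subseteq> U" using assms open_contains_ball by blast
  obtain d where d: "d > 0" "\<And>r w. 0 < r \<Longrightarrow> r < d \<Longrightarrow> w \<in> kball c r z \<Longrightarrow> dist w z < e"
    using kball_shrinks[OF assms(3) e(1), of z] by blast
  have "(\<lambda>n. (1 / 2) ^ n :: real) \<longlonglongrightarrow> 0" by (rule LIMSEQ_power_zero) auto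
  then have "eventually (\<lambda>n. (1 / 2) ^ n < d) sequentially"
    using d(1) by (rule order_tendstoD)
  then show ?thesis
  proof eventually_elim
    case (elim n)
    have "dyadic (- int n) = (1 / 2) ^ n"
      by (simp add: powr_minus powr_realpow power_one_over inverse_eq_divide)
    then show ?case using d(2)[of "dyadic (- int n)"] elim e(2) by (auto simp: dist_commute)
  qed
qed

text \<open>The integrand is nonzero only if exactly one of \<open>z\<close>, \<open>w\<close> lies
  in \<open>U\<close>. Fubini lets the integral be based at that point, around which small balls are
  eventually inside \<open>U\<close>: \<open>I1\<close> treats \<open>z\<close>, and
  \<open>I2\<close> treats \<open>w\<close> with the ball from \<open>kball_swap\<close>. Both are
  dominated by a multiple of the indicator of \<open>U\<close>.\<close>

lemma oscil_indicator_open: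
  assumes c: "c > 0" and U: "open U" "emeasure lborel U < \<infinity>"
  shows "(\<lambda>n. oscil c n (indicator U)) \<longlonglongrightarrow> 0"
proof -
  obtain C where dk: "dyadic_kernel lborel (kker c) (real Q) C" using dyadic_kernel_kker[OF c] .
  interpret dk: dyadic_kernel lborel "kker c" "real Q" C by (rule dk)
  have [measurable]: "U \<in> sets borel" using U by simp
  have [measurable]: "kker c m z \<in> borel_measurable lborel" "(\<lambda>z. kker c m z w) \<in> borel_measurable lborel" for m z w
    using dk.k_measurable2(2)[of z m] dk.k_measurable2(1)[of w m] by auto
  have [measurable]: "(\<lambda>(z, w). kker c m z w) \<in> borel_measurable (lborel \<Otimes>\<^sub>M lborel)" for m
    by (rule kker_measurable)
  have [measurable]: "(\<lambda>(w, z). kker c m z w) \<in> borel_measurable (lborel \<Otimes>\<^sub>M lborel)" for m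
    using measurable_compose[OF measurable_pair_swap' kker_measurable[of c m]] by (simp add: split_beta')
  obtain c' where c': "c' > 0" "\<And>r z w. r > 0 \<Longrightarrow> w \<in> kball c r z \<Longrightarrow> z \<in> kball c' r w"
    using kball_swap by metis
  define I1 where "I1 n z = (\<integral>\<^sup>+w. kker c (- int n) z w * indicator (- U) w \<partial>lborel) * indicator U z" for n z
  define I2 where "I2 n w = (\<integral>\<^sup>+z. kker c (- int n) z w * indicator (- U) z \<partial>lborel) * indicator U w" for n w
  have [measurable]: "I1 n \<in> borel_measurable lborel" "I2 n \<in> borel_measurable lborel" for n
    unfolding I1_def[abs_def] I2_def[abs_def] by measurable
  have fin: "(\<integral>\<^sup>+z. ennreal C * indicator U z \<partial>lborel) < \<infinity>"
    using U by (simp add: nn_integral_cmult ennreal_mult_less_top)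
  have le1: "(\<integral>\<^sup>+w. kker c m z w * indicator A w \<partial>lborel) \<le> ennreal C" for m z and A :: "(real^'n) set"
    by (rule order_trans[OF nn_integral_mono dk.k_row]) (auto simp: indicator_def)
  have le2: "(\<integral>\<^sup>+z. kker c m z w * indicator A z \<partial>lborel) \<le> ennreal C" for m w and A :: "(real^'n) set"
    by (rule order_trans[OF nn_integral_mono dk.k_col]) (auto simp: indicator_def)
  have "(\<lambda>n. \<integral>\<^sup>+z. I1 n z \<partial>lborel) \<longlonglongrightarrow> (\<integral>\<^sup>+z. 0 \<partial>(lborel :: (real^'n) measure))"
  proof (rule nn_integral_dominated_convergence[where w="\<lambda>z. ennreal C * indicator U z"])
    show "AE z in lborel. I1 n z \<le> ennreal C * indicator U z" for n
      unfolding I1_def by (intro AE_I2 mult_right_mono le1) auto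
    show "AE z in lborel. (\<lambda>n. I1 n z) \<longlonglongrightarrow> 0"
    proof (rule AE_I2)
      fix z
      show "(\<lambda>n. I1 n z) \<longlonglongrightarrow> 0"
      proof (cases "z \<in> U")
        case True
        have "eventually (\<lambda>n. I1 n z = 0) sequentially"
        proof (rule eventually_mono[OF kball_eventually_subset[OF U(1) True less_imp_le[OF c]]])
          fix n assume "kball c (dyadic (- int n)) z \<subseteq> U"
          then have "kker c (- int n) z w * indicator (- U) w = 0" for w
            by (auto simp: kker_def indicator_def)
          then show "I1 n z = 0" by (simp only: I1_def) simp
        qed
        then show ?thesis by (rule tendsto_eventually)
      qed (simp add: I1_def)
    qed
  qed (use fin in auto)
  moreover have "(\<lambda>n. \<integral>\<^sup>+z. I2 n z \<partial>lborel) \<longlonglongrightarrow> (\<integral>\<^sup>+z. 0 \<partial>(lborel :: (real^'n) measure))"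
  proof (rule nn_integral_dominated_convergence[where w="\<lambda>z. ennreal C * indicator U z"])
    show "AE w in lborel. I2 n w \<le> ennreal C * indicator U w" for n
      unfolding I2_def by (intro AE_I2 mult_right_mono le2) auto
    show "AE w in lborel. (\<lambda>n. I2 n w) \<longlonglongrightarrow> 0"
    proof (rule AE_I2)
      fix w
      show "(\<lambda>n. I2 n w) \<longlonglongrightarrow> 0"
      proof (cases "w \<in> U")
        case True
        have "eventually (\<lambda>n. I2 n w = 0) sequentially"
        proof (rule eventually_mono[OF kball_eventually_subset[OF U(1) True less_imp_le[OF c'(1)]]])
          fix n assume sub: "kball c' (dyadic (- int n)) w \<subseteq> U"
          have "kker c (- int n) z w * indicator (- U) z = 0" for z
            using c'(2)[of "dyadic (- int n)" w z] sub by (auto simp: kker_def indicator_def)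
          then show "I2 n w = 0" by (simp only: I2_def) simp
        qed
        then show ?thesis by (rule tendsto_eventually)
      qed (simp add: I2_def)
    qed
  qed (use fin in auto)
  ultimately have lim: "(\<lambda>n. (\<integral>\<^sup>+z. I1 n z \<partial>lborel) + (\<integral>\<^sup>+z. I2 n z \<partial>lborel)) \<longlonglongrightarrow> 0"
    using tendsto_add by fastforce
  have eq: "oscil c n (indicator U) = (\<integral>\<^sup>+z. I1 n z \<partial>lborel) + (\<integral>\<^sup>+z. I2 n z \<partial>lborel)" for n
  proof -
    have "oscil c n (indicator U) = (\<integral>\<^sup>+z. I1 n z + (\<integral>\<^sup>+w. kker c (- int n) z w * indicator (- U) z * indicator U w \<partial>lborel) \<partial>lborel)"
      unfolding oscil_def
    proof (rule nn_integral_cong)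
      fix z
      have "(\<integral>\<^sup>+w. kker c (- int n) z w * ennreal \<bar>indicator U w - indicator U z\<bar> \<partial>lborel)
        = (\<integral>\<^sup>+w. kker c (- int n) z w * indicator (- U) w * indicator U z + kker c (- int n) z w * indicator (- U) z * indicator U w \<partial>lborel)"
        by (intro nn_integral_cong) (auto simp: indicator_def)
      also have "\<dots> = I1 n z + (\<integral>\<^sup>+w. kker c (- int n) z w * indicator (- U) z * indicator U w \<partial>lborel)"
        by (subst nn_integral_add) (auto simp: I1_def nn_integral_multc)
      finally show "(\<integral>\<^sup>+w. kker c (- int n) z w * ennreal \<bar>indicator U w - indicator U z\<bar> \<partial>lborel)
        = I1 n z + (\<integral>\<^sup>+w. kker c (- int n) z w * indicator (- U) z * indicator U w \<partial>lborel)" .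
    qed
    also have "\<dots> = (\<integral>\<^sup>+z. I1 n z \<partial>lborel) + (\<integral>\<^sup>+z. (\<integral>\<^sup>+w. kker c (- int n) z w * indicator (- U) z * indicator U w \<partial>lborel) \<partial>lborel)"
      by (rule nn_integral_add) measurable
    also have "(\<integral>\<^sup>+z. (\<integral>\<^sup>+w. kker c (- int n) z w * indicator (- U) z * indicator U w \<partial>lborel) \<partial>lborel)
       = (\<integral>\<^sup>+w. (\<integral>\<^sup>+z. kker c (- int n) z w * indicator (- U) z * indicator U w \<partial>lborel) \<partial>lborel)"
      by (rule lborel_pair.Fubini'[symmetric]) measurable
    also have "\<dots> = (\<integral>\<^sup>+w. I2 n w \<partial>lborel)"
      by (intro nn_integral_cong) (auto simp: I2_def nn_integral_multc)
    finally show ?thesis .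
  qed
  show ?thesis using lim by (simp add: eq)
qed

lemma oscil_tendsto_approx:
  assumes c: "c > 0" and h [measurable]: "h \<in> borel_measurable borel"
    and approx: "\<And>e::real. e > 0 \<Longrightarrow> \<exists>h'. h' \<in> borel_measurable borel \<and> (\<lambda>n. oscil c n h') \<longlonglongrightarrow> 0 \<and>
       (\<integral>\<^sup>+w. ennreal \<bar>h w - h' w\<bar> \<partial>lborel) \<le> ennreal e"
  shows "(\<lambda>n. oscil c n h) \<longlonglongrightarrow> 0"
proof (rule ennreal_tendsto_0I)
  fix e :: real assume e: "e > 0"
  obtain C where dk: "dyadic_kernel lborel (kker c) (real Q) C" using dyadic_kernel_kker[OF c] .
  then have C: "C > 0" by (rule dyadic_kernel.C_pos)
  obtain h' where [measurable]: "h' \<in> borel_measurable borel" and lim: "(\<lambda>n. oscil c n h') \<longlonglongrightarrow> 0"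
    and le: "(\<integral>\<^sup>+w. ennreal \<bar>h w - h' w\<bar> \<partial>lborel) \<le> ennreal (e / (4 * C))"
    using approx[of "e / (4 * C)"] e C by auto
  have "eventually (\<lambda>n. oscil c n h' < ennreal (e / 2)) sequentially"
    using lim e by (intro order_tendstoD) auto
  then show "eventually (\<lambda>n. oscil c n h \<le> ennreal e) sequentially"
  proof eventually_elim
    case (elim n)
    have "oscil c n h \<le> oscil c n h' + ennreal (2 * C) * (\<integral>\<^sup>+w. ennreal \<bar>h w - h' w\<bar> \<partial>lborel)"
      by (rule oscil_perturb[OF dk]) measurable
    also have "\<dots> \<le> ennreal (e / 2) + ennreal (2 * C) * ennreal (e / (4 * C))"
      using elim le by (intro add_mono mult_left_mono) auto
    also have "\<dots> = ennreal e"
      using C e by (simp add: ennreal_mult[symmetric] ennreal_plus[symmetric] del: ennreal_plus)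
    finally show ?case .
  qed
qed

lemma oscil_add_le:
  assumes c: "c > 0" and [measurable]: "h1 \<in> borel_measurable borel" "h2 \<in> borel_measurable borel"
  shows "oscil c n (\<lambda>x. h1 x + h2 x) \<le> oscil c n h1 + oscil c n h2"
proof -
  have [measurable]: "(\<lambda>(z, w). kker c m z w) \<in> borel_measurable (lborel \<Otimes>\<^sub>M lborel)" for m
    by (rule kker_measurable)
  have [measurable]: "kker c m z \<in> borel_measurable lborel" for m z
    using measurable_Pair2[OF kker_measurable[of c m], of z] by simp
  have "oscil c n (\<lambda>x. h1 x + h2 x) \<le> (\<integral>\<^sup>+z. \<integral>\<^sup>+w. kker c (- int n) z w * ennreal \<bar>h1 w - h1 z\<bar> +
      kker c (- int n) z w * ennreal \<bar>h2 w - h2 z\<bar> \<partial>lborel \<partial>lborel)"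
    unfolding oscil_def distrib_left[symmetric]
    by (intro nn_integral_mono mult_left_mono) (auto simp: ennreal_plus[symmetric] simp del: ennreal_plus intro!: ennreal_leI)
  also have "\<dots> = oscil c n h1 + oscil c n h2"
    unfolding oscil_def by (subst nn_integral_add[symmetric]) (auto intro!: nn_integral_cong nn_integral_add)
  finally show ?thesis .
qed

lemma oscil_cmult: "oscil c n (\<lambda>x. a * h x) = ennreal \<bar>a\<bar> * oscil c n h"
  if [measurable]: "h \<in> borel_measurable borel"
proof -
  have [measurable]: "(\<lambda>(z, w). kker c m z w) \<in> borel_measurable (lborel \<Otimes>\<^sub>M lborel)" for m
    by (rule kker_measurable)
  have [measurable]: "kker c m z \<in> borel_measurable lborel" for m z
    using measurable_Pair2[OF kker_measurable[of c m], of z] by simp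
  have "ennreal \<bar>a * h w - a * h z\<bar> = ennreal \<bar>a\<bar> * ennreal \<bar>h w - h z\<bar>" for w z
    by (simp add: ennreal_mult[symmetric] abs_mult[symmetric] right_diff_distrib)
  then show ?thesis
    unfolding oscil_def by (simp add: nn_integral_cmult mult.left_commute)
qed

text \<open>Open sets of finite measure are the base; outer regularity passes to measurable sets,
  subadditivity to simple functions, and dominated convergence with
  \<open>oscil_tendsto_approx\<close> to all integrable functions.\<close>

lemma oscil_tendsto_0:
  assumes c: "c > 0" and h: "integrable lborel h"
  shows "(\<lambda>n. oscil c n h) \<longlonglongrightarrow> 0"
  using h
proof (induction rule: integrable_induct)
  case (base A a)
  have A [measurable]: "A \<in> sets borel" using base by simp
  have "(\<lambda>n. oscil c n (indicator A)) \<longlonglongrightarrow> 0"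
  proof (rule oscil_tendsto_approx[OF c])
    fix e :: real assume e: "e > 0"
    obtain U where U: "open U" "A \<subseteq> U" "emeasure lborel (U - A) < ennreal e"
      using outer_regular_lborel[OF A e] by blast
    have "emeasure lborel U \<le> emeasure lborel A + emeasure lborel (U - A)"
      using U by (subst plus_emeasure) (auto intro!: emeasure_mono)
    also have "\<dots> < \<infinity>" using base U(3) by (auto simp: ennreal_add_less_top intro: less_trans)
    finally have fin: "emeasure lborel U < \<infinity>" .
    have [measurable]: "U \<in> sets borel" using U by simp
    have "(\<integral>\<^sup>+w. ennreal \<bar>indicator A w - indicator U w\<bar> \<partial>lborel) = (\<integral>\<^sup>+w. indicator (U - A) w \<partial>lborel)"
      using U by (intro nn_integral_cong) (auto simp: indicator_def)
    also have "\<dots> \<le> ennreal e" using U by simp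
    finally show "\<exists>h'. h' \<in> borel_measurable borel \<and> (\<lambda>n. oscil c n h') \<longlonglongrightarrow> 0 \<and>
       (\<integral>\<^sup>+w. ennreal \<bar>indicator A w - h' w\<bar> \<partial>lborel) \<le> ennreal e"
      using oscil_indicator_open[OF c U(1) fin] by (intro exI[of _ "indicator U"]) auto
  qed measurable
  then have "(\<lambda>n. ennreal \<bar>a\<bar> * oscil c n (indicator A)) \<longlonglongrightarrow> ennreal \<bar>a\<bar> * 0"
    by (intro ennreal_tendsto_cmult) auto
  then show ?case
    by (simp add: oscil_cmult[symmetric] mult.commute)
next
  case (add f g)
  have [measurable]: "f \<in> borel_measurable borel" "g \<in> borel_measurable borel"
    using add(1,2) by auto
  show ?case
  proof (rule tendsto_sandwich[OF _ _ tendsto_const])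
    show "(\<lambda>n. oscil c n f + oscil c n g) \<longlonglongrightarrow> 0"
      using tendsto_add[OF add(3,4)] by simp
    show "\<forall>\<^sub>F n in sequentially. 0 \<le> oscil c n (\<lambda>x. f x + g x)" by simp
    show "\<forall>\<^sub>F n in sequentially. oscil c n (\<lambda>x. f x + g x) \<le> oscil c n f + oscil c n g"
      by (intro always_eventually allI oscil_add_le c) measurable
  qed
next
  case (lim f s)
  have [measurable]: "f \<in> borel_measurable borel" "\<And>i. s i \<in> borel_measurable borel"
    using lim by (auto dest: borel_measurable_integrable)
  show ?case
  proof (rule oscil_tendsto_approx[OF c])
    fix e :: real assume e: "e > 0"
    have "(\<lambda>i. \<integral>\<^sup>+w. ennreal (norm (s i w - f w)) \<partial>lborel) \<longlonglongrightarrow> 0"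
    proof -
      have "(\<lambda>i. \<integral>\<^sup>+w. ennreal (norm (s i w - f w)) \<partial>lborel) \<longlonglongrightarrow> (\<integral>\<^sup>+w. 0 \<partial>(lborel :: (real^'n) measure))"
      \<comment> \<open>The approximating functions satisfy
        \<open>norm (s i w) \<le> 2 * norm (f w)\<close>; subtracting \<open>f w\<close> adds one
        more.\<close>
      proof (rule nn_integral_dominated_convergence[where w="\<lambda>w. ennreal (3 * norm (f w))"])
        show "AE w in lborel. ennreal (norm (s i w - f w)) \<le> ennreal (3 * norm (f w))" for i
        proof (intro AE_I2 ennreal_leI)
          fix w
          show "norm (s i w - f w) \<le> 3 * norm (f w)"
            using lim(3)[of w i] norm_triangle_ineq4[of "s i w" "f w"] by simp
        qed
        show "AE w in lborel. (\<lambda>i. ennreal (norm (s i w - f w))) \<longlonglongrightarrow> 0"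
        proof (rule AE_I2)
          fix w
          have "(\<lambda>i. norm (s i w - f w)) \<longlonglongrightarrow> norm (f w - f w)"
            by (intro tendsto_norm tendsto_diff tendsto_const lim(2)) simp
          then show "(\<lambda>i. ennreal (norm (s i w - f w))) \<longlonglongrightarrow> 0"
            using tendsto_ennrealI by fastforce
        qed
        show "(\<integral>\<^sup>+w. ennreal (3 * norm (f w)) \<partial>lborel) < \<infinity>"
          using lim(4) by (auto simp: integrable_iff_bounded ennreal_mult nn_integral_cmult ennreal_mult_less_top)
      qed auto
      then show ?thesis by simp
    qed
    then have "eventually (\<lambda>i. (\<integral>\<^sup>+w. ennreal (norm (s i w - f w)) \<partial>lborel) < ennreal e) sequentially"
      by (rule order_tendstoD(2)) (use e in simp)
    then obtain i where i: "(\<integral>\<^sup>+w. ennreal (norm (s i w - f w)) \<partial>lborel) < ennreal e"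
      using eventually_happens'[OF sequentially_bot] by blast
    have "(\<integral>\<^sup>+w. ennreal \<bar>f w - s i w\<bar> \<partial>lborel) \<le> ennreal e"
      using i by (simp add: abs_minus_commute)
    then show "\<exists>h'. h' \<in> borel_measurable borel \<and> (\<lambda>n. oscil c n h') \<longlonglongrightarrow> 0 \<and>
       (\<integral>\<^sup>+w. ennreal \<bar>f w - h' w\<bar> \<partial>lborel) \<le> ennreal e"
      using lim(5)[of i] by (intro exI[of _ "s i"] conjI) simp_all
  qed measurable
qed

end

subsection \<open>Mollification of weak solutions\<close>

lemma cpt_smth_bound:
  assumes "cpt_smth \<phi>"
  obtains c K where "c > 0" "K > 0" "\<And>x. \<bar>\<phi> x\<bar> \<le> K * indicator (cube c) x"
proof -
  obtain c where c: "c > 0" "\<And>x i. \<phi> x \<noteq> 0 \<Longrightarrow> \<bar>x $ i\<bar> \<le> c" using assms by (rule cpt_smthE) blast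
  have "compact (\<phi> ` cbox (\<chi> i. - c) (\<chi> i. c))"
    by (intro compact_continuous_image smth_continuous cpt_smth_smth assms compact_cbox)
  then obtain K where K: "K > 0" "\<forall>y\<in>\<phi> ` cbox (\<chi> i. - c) (\<chi> i. c). norm y \<le> K"
    using compact_imp_bounded bounded_pos by metis
  have "\<bar>\<phi> x\<bar> \<le> K * indicator (cube c) x" for x
  proof (cases "\<phi> x = 0")
    case False
    then have *: "\<forall>i. \<bar>x $ i\<bar> \<le> c" using c(2) by blast
    then have "x \<in> cbox (\<chi> i. - c) (\<chi> i. c)" by (auto simp: mem_box_cart abs_le_iff minus_le_iff)
    then show ?thesis using K(2) * by auto
  qed (use K(1) in simp)
  then show thesis using that c(1) K(1) by blast
qed

lemma cpt_smth_bound_family: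
  fixes h :: "'j \<Rightarrow> real^'n::finite \<Rightarrow> real"
  assumes "finite J" "\<And>j. j \<in> J \<Longrightarrow> cpt_smth (h j)"
  obtains c K where "c > 0" "K > 0"
    "\<And>j x. j \<in> J \<Longrightarrow> \<bar>h j x\<bar> \<le> K * indicator (cube c) x"
proof -
  have "\<exists>c K. c > 0 \<and> K > 0 \<and> (\<forall>j\<in>J. \<forall>x. \<bar>h j x\<bar> \<le> K * indicator (cube c) x)"
    using assms
  proof (induction J rule: finite_induct)
    case empty
    show ?case by (intro exI[of _ 1]) simp
  next
    case (insert j J)
    obtain c K where 1: "c > 0" "K > 0" "\<forall>j\<in>J. \<forall>x. \<bar>h j x\<bar> \<le> K * indicator (cube c) x"
      using insert by blast
    obtain c' K' where 2: "c' > 0" "K' > 0" "\<And>x. \<bar>h j x\<bar> \<le> K' * indicator (cube c') x"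
      using insert.prems cpt_smth_bound[of "h j"] by blast
    have mono: "a * indicator (cube b) x \<le> max K K' * indicator (cube (max c c')) x"
      if "a \<le> max K K'" "b \<le> max c c'" for a b and x :: "real^'n"
    proof (cases "\<forall>i. \<bar>x $ i\<bar> \<le> b")
      case True
      then have "\<forall>i. \<bar>x $ i\<bar> \<le> max c c'" using that(2) order_trans by blast
      then show ?thesis using True that(1) by simp
    next
      case False
      then have "indicator (cube b) x = (0::real)" by (simp only: indicator_simps mem_Collect_eq not_False_eq_True)
      then show ?thesis using 1(2) by (simp only: mult_zero_right) (intro mult_nonneg_nonneg, auto)
    qed
    have "\<bar>h i x\<bar> \<le> max K K' * indicator (cube (max c c')) x" if "i \<in> insert j J" for i x
    proof (cases "i = j")
      case True
      have "K' * indicator (cube c') x \<le> max K K' * indicator (cube (max c c')) x"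
        by (rule mono) simp_all
      then show ?thesis using 2(3)[of x] True by (meson order_trans)
    next
      case False
      have "K * indicator (cube c) x \<le> max K K' * indicator (cube (max c c')) x"
        by (rule mono) simp_all
      moreover have "\<bar>h i x\<bar> \<le> K * indicator (cube c) x" using 1(3) that False by blast
      ultimately show ?thesis by (meson order_trans)
    qed
    moreover have "max c c' > 0" "max K K' > 0" using 1 2 by simp_all
    ultimately show ?case by blast
  qed
  then show thesis using that by blast
qed

lemma L2_mult_integrable:
  assumes u: "L2 u" and [measurable]: "v \<in> borel_measurable borel" "A \<in> sets borel"
    and v: "\<And>x. \<bar>v x\<bar> \<le> K * indicator A x" and A: "emeasure lborel A < \<infinity>"
  shows "integrable lborel (\<lambda>x. u x * v x)"
proof (rule Bochner_Integration.integrable_bound)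
  have [measurable]: "u \<in> borel_measurable borel" using u by (simp add: L2_def)
  show "integrable lborel (\<lambda>x. (u x)\<^sup>2 + K\<^sup>2 * indicator A x)"
    using u A by (intro Bochner_Integration.integrable_add integrable_mult_right integrable_real_indicator)
      (auto simp: L2_def)
  show "(\<lambda>x. u x * v x) \<in> borel_measurable lborel" by measurable
  show "AE x in lborel. norm (u x * v x) \<le> norm ((u x)\<^sup>2 + K\<^sup>2 * indicator A x)"
  proof (rule AE_I2)
    fix x
    have "\<bar>u x * v x\<bar> \<le> (u x)\<^sup>2 + (v x)\<^sup>2"
    proof -
      have "2 * (\<bar>u x\<bar> * \<bar>v x\<bar>) \<le> (u x)\<^sup>2 + (v x)\<^sup>2"
        using sum_squares_bound[of "\<bar>u x\<bar>" "\<bar>v x\<bar>"] by (simp add: mult.assoc)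
      moreover have "0 \<le> \<bar>u x\<bar> * \<bar>v x\<bar>" by simp
      ultimately show ?thesis unfolding abs_mult by linarith
    qed
    also have "(v x)\<^sup>2 \<le> (K * indicator A x)\<^sup>2"
      using power_mono[OF v[of x], of 2] by simp
    also have "\<dots> = K\<^sup>2 * indicator A x" by (simp add: indicator_def)
    finally show "norm (u x * v x) \<le> norm ((u x)\<^sup>2 + K\<^sup>2 * indicator A x)" by simp
  qed
qed

context kolmogorov
begin

text \<open>Since the drift is divergence free, moving \<open>Y\<close> onto \<open>\<phi>\<close>
  and moving the divergence off \<open>S\<close> both produce a minus sign; the two cancel in the
  equation, while the sign remains in the definition of the weak gradient \<open>g\<close>.\<close>

definition weak_sol :: "(real^'n \<Rightarrow> real) \<Rightarrow> ('n \<Rightarrow> real^'n \<Rightarrow> real) \<Rightarrow> ('n \<Rightarrow> real^'n \<Rightarrow> real) \<Rightarrow> bool" where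
  "weak_sol f g S \<longleftrightarrow> L2 f \<and> (\<forall>i\<in>V. L2 (g i)) \<and> (\<forall>i\<in>V. L2 (S i)) \<and>
     (\<forall>i\<in>V. \<forall>\<phi>. test_fun \<phi> \<longrightarrow> (\<integral>x. f x * partial i \<phi> x \<partial>lborel) = - (\<integral>x. g i x * \<phi> x \<partial>lborel)) \<and>
     (\<forall>\<phi>. test_fun \<phi> \<longrightarrow> (\<integral>x. f x * Y \<phi> x \<partial>lborel) = (\<integral>x. (\<Sum>i\<in>V. S i x * partial i \<phi> x) \<partial>lborel))"

definition data :: "('n \<Rightarrow> real^'n \<Rightarrow> real) \<Rightarrow> ('n \<Rightarrow> real^'n \<Rightarrow> real) \<Rightarrow> real^'n \<Rightarrow> real" where
  "data g S w = (\<Sum>i\<in>V. \<bar>g i w\<bar> + \<bar>S i w\<bar>)"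

text \<open>An average with the profile transported by the group law; dividing by
  \<open>r ^ Q\<close>, the Jacobian of the dilation, makes the total weight 1.\<close>

definition mol :: "(real^'n \<Rightarrow> real) \<Rightarrow> real \<Rightarrow> real^'n \<Rightarrow> real" where
  "mol f r z = (\<integral>w. f w * (\<psi> (lam r z w) / r ^ Q) \<partial>lborel)"

lemma data_measurable:
  assumes "weak_sol f g S" shows "data g S \<in> borel_measurable borel"
proof -
  have [measurable]: "g i \<in> borel_measurable borel" "S i \<in> borel_measurable borel" if "i \<in> V" for i
    using assms that by (auto simp: weak_sol_def L2_def)
  show ?thesis unfolding data_def[abs_def] by measurable
qed

lemma compose_lam_bound:
  assumes "\<And>x. \<bar>h x\<bar> \<le> K * indicator (cube c) x"
  shows "\<bar>h (lam r z w)\<bar> \<le> K * indicator (kball c r z) w"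
  using assms[of "lam r z w"] by (auto simp: kball_def indicator_def split: if_splits)

lemma integrable_compose_lam:
  assumes "L2 u" "cpt_smth h" "r > 0"
  shows "integrable lborel (\<lambda>w. u w * h (lam r z w))"
proof -
  obtain c K where "c > 0" "K > 0" "\<And>x. \<bar>h x\<bar> \<le> K * indicator (cube c) x"
    using cpt_smth_bound[OF assms(2)] by blast
  then show ?thesis
    using assms by (intro L2_mult_integrable[where A="kball c r z" and K=K] compose_lam_bound smth_measurable
        smth_compose_lam cpt_smth_smth) (auto simp: emeasure_kball)
qed

lemma integral_compose_lam_bound:
  assumes u: "L2 u" and h: "cpt_smth h" "\<And>x. \<bar>h x\<bar> \<le> K * indicator (cube c) x"
    and r: "r > 0" and K: "K \<ge> 0"
  shows "ennreal \<bar>\<integral>w. u w * h (lam r z w) \<partial>lborel\<bar>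
    \<le> ennreal K * (\<integral>\<^sup>+w. indicator (kball c r z) w * ennreal \<bar>u w\<bar> \<partial>lborel)"
proof -
  have [measurable]: "u \<in> borel_measurable borel" using u by (simp add: L2_def)
  have "ennreal (norm (\<integral>w. u w * h (lam r z w) \<partial>lborel)) \<le> (\<integral>\<^sup>+w. ennreal (norm (u w * h (lam r z w))) \<partial>lborel)"
    by (rule integral_norm_bound_ennreal[OF integrable_compose_lam[OF u h(1) r]])
  also have "\<dots> \<le> (\<integral>\<^sup>+w. ennreal K * (indicator (kball c r z) w * ennreal \<bar>u w\<bar>) \<partial>lborel)"
  proof (rule nn_integral_mono)
    fix w
    have "norm (u w * h (lam r z w)) \<le> \<bar>u w\<bar> * (K * indicator (kball c r z) w)"
      using compose_lam_bound[OF h(2)] by (simp add: abs_mult mult_left_mono)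
    then have "ennreal (norm (u w * h (lam r z w))) \<le> ennreal (\<bar>u w\<bar> * (K * indicator (kball c r z) w))"
      by (rule ennreal_leI)
    also have "\<dots> = ennreal K * (indicator (kball c r z) w * ennreal \<bar>u w\<bar>)"
      using K by (auto simp: indicator_def ennreal_mult mult.commute)
    finally show "ennreal (norm (u w * h (lam r z w))) \<le> ennreal K * (indicator (kball c r z) w * ennreal \<bar>u w\<bar>)" .
  qed
  also have "\<dots> = ennreal K * (\<integral>\<^sup>+w. indicator (kball c r z) w * ennreal \<bar>u w\<bar> \<partial>lborel)"
    by (rule nn_integral_cmult) measurable
  finally show ?thesis by simp
qed

lemma cpt_smth_psi: "cpt_smth \<psi>"
  using smth_psi psi_support by (rule cpt_smthI)

text \<open>The representation of the two-scale difference from \<open>accessible_psi_diff\<close>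
  is fixed once for the unit scale and carried to \<open>(z, r)\<close> by left invariance, so
  \<open>c\<close> and \<open>K\<close> depend neither on the solution nor on \<open>z\<close> and
  \<open>r\<close>.\<close>

lemma mol_diff_bound:
  obtains c K where "c > 0" "K > 0"
    "\<And>f g S r z. weak_sol f g S \<Longrightarrow> r > 0 \<Longrightarrow>
       ennreal \<bar>mol f r z - mol f (2 * r) z\<bar>
         \<le> ennreal (K * r / r ^ Q) * (\<integral>\<^sup>+w. indicator (kball c r z) w * ennreal (data g S w) \<partial>lborel)"
proof -
  obtain \<phi> F where \<phi>: "cpt_smth \<phi>" and F: "\<And>i. cpt_smth (F i)"
    and eq': "(\<lambda>x. \<psi> x - \<psi> (dil 2 x) / 2 ^ Q) = (\<lambda>x. Y \<phi> x + (\<Sum>i\<in>V. partial i (F i) x))"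
    using accessible_psi_diff unfolding accessible_def by blast
  have eq: "\<psi> x - \<psi> (dil 2 x) / 2 ^ Q = Y \<phi> x + (\<Sum>i\<in>V. partial i (F i) x)" for x
    using eq' by (rule fun_cong)
  define J where "J = (UNIV :: ('n \<times> bool) set)"
  \<comment> \<open>Collects every function that will be paired with \<open>S\<close> or
    \<open>g\<close>, so that a single ball and a single height bound them all.\<close>
  define hh where "hh j = (if snd j then partial (fst j) \<phi> else F (fst j))" for j
  have "finite J" by (simp add: J_def)
  moreover have "cpt_smth (hh j)" for j using \<phi> F by (simp add: hh_def cpt_smth_partial)
  ultimately obtain c K where cK: "c > 0" "K > 0"
    and bd: "\<And>j x. j \<in> J \<Longrightarrow> \<bar>hh j x\<bar> \<le> K * indicator (cube c) x"
    using cpt_smth_bound_family[of J hh] by metis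
  have bd1: "\<bar>partial i \<phi> x\<bar> \<le> K * indicator (cube c) x" for i x
    using bd[of "(i, True)" x] by (simp add: hh_def J_def)
  have bd2: "\<bar>F i x\<bar> \<le> K * indicator (cube c) x" for i x
    using bd[of "(i, False)" x] by (simp add: hh_def J_def)
  show thesis
  proof (rule that[OF cK])
    fix f g S r z
    assume sol: "weak_sol f g S" and r: "(r::real) > 0"
    have f: "L2 f" and gS: "\<And>i. i \<in> V \<Longrightarrow> L2 (g i)" "\<And>i. i \<in> V \<Longrightarrow> L2 (S i)"
      and grad: "\<And>i \<phi>. i \<in> V \<Longrightarrow> test_fun \<phi> \<Longrightarrow> (\<integral>x. f x * partial i \<phi> x \<partial>lborel) = - (\<integral>x. g i x * \<phi> x \<partial>lborel)"
      and eqn: "\<And>\<phi>. test_fun \<phi> \<Longrightarrow> (\<integral>x. f x * Y \<phi> x \<partial>lborel) = (\<integral>x. (\<Sum>i\<in>V. S i x * partial i \<phi> x) \<partial>lborel)"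
      using sol by (auto simp: weak_sol_def)
    have [measurable]: "g i \<in> borel_measurable borel" "S i \<in> borel_measurable borel" if "i \<in> V" for i
      using gS[OF that] by (auto simp: L2_def)
    let ?\<Phi> = "\<lambda>w. \<phi> (lam r z w)" and ?F = "\<lambda>i w. F i (lam r z w)"
    have int: "integrable lborel (\<lambda>w. u w * h (lam r z w))" if "L2 u" "cpt_smth h" for u h
      using integrable_compose_lam that r by blast
    have Y\<Phi>: "Y ?\<Phi> w = Y \<phi> (lam r z w) / r\<^sup>2" for w
      by (rule Y_lam) (use \<phi> r in \<open>auto simp: cpt_smth_smth\<close>)
    have d\<Phi>: "partial i ?\<Phi> w = partial i \<phi> (lam r z w) / r" if "i \<in> V" for i w
      by (rule partial_lam) (use \<phi> that in \<open>auto simp: cpt_smth_smth\<close>)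
    have dF: "partial i (?F i) w = partial i (F i) (lam r z w) / r" if "i \<in> V" for i w
      by (rule partial_lam) (use F that in \<open>auto simp: cpt_smth_smth\<close>)
    \<comment> \<open>Power counting: undoing the dilation costs \<open>r\<^sup>2\<close> for
      \<open>Y\<close> and \<open>r\<close> for a derivative in \<open>V\<close>. The equation
      afterwards trades \<open>Y\<close> for one derivative in \<open>V\<close>, which returns a
      factor \<open>1 / r\<close>, so both terms have the net gain \<open>r\<close>.\<close>
    have split: "\<psi> (lam r z w) / r ^ Q - \<psi> (lam (2 * r) z w) / (2 * r) ^ Q
        = r\<^sup>2 / r ^ Q * Y ?\<Phi> w + (\<Sum>i\<in>V. r / r ^ Q * partial i (?F i) w)" for w
    proof -
      have "\<psi> (lam r z w) / r ^ Q - \<psi> (lam (2 * r) z w) / (2 * r) ^ Q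
          = (\<psi> (lam r z w) - \<psi> (dil 2 (lam r z w)) / 2 ^ Q) / r ^ Q"
        by (simp add: lam_double power_mult_distrib diff_divide_distrib)
      also have "\<dots> = Y \<phi> (lam r z w) / r ^ Q + (\<Sum>i\<in>V. partial i (F i) (lam r z w) / r ^ Q)"
        by (simp add: eq add_divide_distrib sum_divide_distrib)
      also have "\<dots> = r\<^sup>2 / r ^ Q * Y ?\<Phi> w + (\<Sum>i\<in>V. r / r ^ Q * partial i (?F i) w)"
        using r by (simp add: Y\<Phi> dF)
      finally show ?thesis .
    qed
    have iY: "integrable lborel (\<lambda>w. f w * Y ?\<Phi> w)"
      using int[OF f cpt_smth_Y[OF \<phi>]] by (simp add: Y\<Phi>)
    have iF: "integrable lborel (\<lambda>w. f w * partial i (?F i) w)" if "i \<in> V" for i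
      using int[OF f cpt_smth_partial[OF F]] that by (simp add: dF)
    let ?s = "\<lambda>i. \<integral>w. S i w * partial i \<phi> (lam r z w) \<partial>lborel"
    let ?g = "\<lambda>i. \<integral>w. g i w * F i (lam r z w) \<partial>lborel"
    have "mol f r z - mol f (2 * r) z
        = (\<integral>w. f w * (\<psi> (lam r z w) / r ^ Q) - f w * (\<psi> (lam (2 * r) z w) / (2 * r) ^ Q) \<partial>lborel)"
      unfolding mol_def
      using integrable_compose_lam[OF f cpt_smth_psi, of r z] integrable_compose_lam[OF f cpt_smth_psi, of "2 * r" z] r
      by (intro Bochner_Integration.integral_diff[symmetric]) simp_all
    also have "\<dots> = (\<integral>w. r\<^sup>2 / r ^ Q * (f w * Y ?\<Phi> w) + (\<Sum>i\<in>V. r / r ^ Q * (f w * partial i (?F i) w)) \<partial>lborel)"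
      by (intro Bochner_Integration.integral_cong refl)
         (simp only: right_diff_distrib[symmetric] split distrib_left sum_distrib_left mult.left_commute)
    also have "\<dots> = r\<^sup>2 / r ^ Q * (\<integral>w. f w * Y ?\<Phi> w \<partial>lborel) + (\<Sum>i\<in>V. r / r ^ Q * (\<integral>w. f w * partial i (?F i) w \<partial>lborel))"
      using iY iF by (simp add: Bochner_Integration.integral_sum)
    also have "(\<integral>w. f w * Y ?\<Phi> w \<partial>lborel) = (\<integral>w. (\<Sum>i\<in>V. S i w * partial i ?\<Phi> w) \<partial>lborel)"
      by (intro eqn test_fun_compose_lam \<phi> r)
    also have "\<dots> = (\<Sum>i\<in>V. ?s i / r)"
    proof -
      have "(\<integral>w. (\<Sum>i\<in>V. S i w * partial i ?\<Phi> w) \<partial>lborel) = (\<integral>w. (\<Sum>i\<in>V. S i w * partial i \<phi> (lam r z w) / r) \<partial>lborel)"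
        by (intro Bochner_Integration.integral_cong sum.cong refl) (simp add: d\<Phi>)
      also have "\<dots> = (\<Sum>i\<in>V. \<integral>w. S i w * partial i \<phi> (lam r z w) / r \<partial>lborel)"
        using int gS(2) \<phi> by (intro Bochner_Integration.integral_sum) (simp add: cpt_smth_partial)
      finally show ?thesis by simp
    qed
    also have "(\<Sum>i\<in>V. r / r ^ Q * (\<integral>w. f w * partial i (?F i) w \<partial>lborel)) = (\<Sum>i\<in>V. - (r / r ^ Q * ?g i))"
      using F r by (intro sum.cong refl) (simp add: grad test_fun_compose_lam)
    also have "r\<^sup>2 / r ^ Q * (\<Sum>i\<in>V. ?s i / r)
       = (\<Sum>i\<in>V. r / r ^ Q * ?s i)"
      using r by (simp add: sum_distrib_left power2_eq_square)
    finally have main: "mol f r z - mol f (2 * r) z =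
       r / r ^ Q * (\<Sum>i\<in>V. ?s i - ?g i)"
      by (simp add: sum.distrib[symmetric] sum_distrib_left right_diff_distrib)
    define I where "I u = (\<integral>\<^sup>+w. indicator (kball c r z) w * ennreal \<bar>u w\<bar> \<partial>lborel)" for u :: "real^'n \<Rightarrow> real"
    have "ennreal \<bar>mol f r z - mol f (2 * r) z\<bar>
       \<le> ennreal (r / r ^ Q) * (\<Sum>i\<in>V. ennreal \<bar>?s i\<bar> + ennreal \<bar>?g i\<bar>)"
    proof -
      have "\<bar>mol f r z - mol f (2 * r) z\<bar> \<le> r / r ^ Q * (\<Sum>i\<in>V. \<bar>?s i\<bar> + \<bar>?g i\<bar>)"
        unfolding main abs_mult using r
        by (intro mult_mono order_trans[OF sum_abs] sum_mono) auto
      then have "ennreal \<bar>mol f r z - mol f (2 * r) z\<bar> \<le> ennreal (r / r ^ Q * (\<Sum>i\<in>V. \<bar>?s i\<bar> + \<bar>?g i\<bar>))"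
        by (rule ennreal_leI)
      also have "\<dots> = ennreal (r / r ^ Q) * ennreal (\<Sum>i\<in>V. \<bar>?s i\<bar> + \<bar>?g i\<bar>)"
        using r by (intro ennreal_mult sum_nonneg) auto
      also have "ennreal (\<Sum>i\<in>V. \<bar>?s i\<bar> + \<bar>?g i\<bar>)
         = (\<Sum>i\<in>V. ennreal (\<bar>?s i\<bar> + \<bar>?g i\<bar>))"
        by (rule sum_ennreal[symmetric]) simp
      finally show ?thesis by simp
    qed
    also have "\<dots> \<le> ennreal (r / r ^ Q) * (\<Sum>i\<in>V. ennreal K * I (S i) + ennreal K * I (g i))"
      unfolding I_def using gS \<phi> F cK r
      by (intro mult_left_mono sum_mono add_mono integral_compose_lam_bound bd1 bd2 cpt_smth_partial) auto
    also have "\<dots> = ennreal (r / r ^ Q) * (ennreal K * (\<Sum>i\<in>V. I (S i) + I (g i)))"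
      by (simp add: distrib_left[symmetric] sum_distrib_left[symmetric])
    also have "(\<Sum>i\<in>V. I (S i) + I (g i)) = (\<Sum>i\<in>V. \<integral>\<^sup>+w. indicator (kball c r z) w * ennreal \<bar>S i w\<bar> + indicator (kball c r z) w * ennreal \<bar>g i w\<bar> \<partial>lborel)"
      unfolding I_def by (intro sum.cong refl nn_integral_add[symmetric]) auto
    also have "\<dots> = (\<integral>\<^sup>+w. (\<Sum>i\<in>V. indicator (kball c r z) w * ennreal \<bar>S i w\<bar> + indicator (kball c r z) w * ennreal \<bar>g i w\<bar>) \<partial>lborel)"
      by (rule nn_integral_sum[symmetric]) auto
    also have "\<dots> = (\<integral>\<^sup>+w. indicator (kball c r z) w * ennreal (data g S w) \<partial>lborel)"
      by (intro nn_integral_cong)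
         (simp add: data_def sum_ennreal[symmetric] ennreal_plus distrib_left[symmetric] sum_distrib_left[symmetric] add.commute)
    also have "ennreal (r / r ^ Q) * (ennreal K * (\<integral>\<^sup>+w. indicator (kball c r z) w * ennreal (data g S w) \<partial>lborel))
       = ennreal (K * r / r ^ Q) * (\<integral>\<^sup>+w. indicator (kball c r z) w * ennreal (data g S w) \<partial>lborel)"
      using r cK by (simp add: mult.assoc[symmetric] ennreal_mult[symmetric] mult.commute)
    finally show "ennreal \<bar>mol f r z - mol f (2 * r) z\<bar>
         \<le> ennreal (K * r / r ^ Q) * (\<integral>\<^sup>+w. indicator (kball c r z) w * ennreal (data g S w) \<partial>lborel)" .
  qed
qed

text \<open>Compactness gives the height with some unspecified cube; \<open>psi_support\<close>
  replaces that cube by the unit one, to match the kernel \<open>kker 1\<close>.\<close>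

lemma psi_bound:
  obtains K where "K > 0" "\<And>x. \<psi> x \<le> K * indicator (cube 1) x"
proof -
  obtain c K where K: "K > 0" "\<And>x. \<bar>\<psi> x\<bar> \<le> K * indicator (cube c) x"
    using cpt_smth_bound[OF cpt_smth_psi] by blast
  have "\<psi> x \<le> K * indicator (cube 1) x" for x
  proof (cases "\<psi> x = 0")
    case False
    then have "x \<in> (cube 1)" using psi_support by blast
    moreover have "K * indicator (cube c) x \<le> K" using K(1) by (simp add: indicator_def)
    ultimately show ?thesis using K(2)[of x] by (simp add: indicator_def)
  qed (use K(1) in simp)
  then show thesis using that K(1) by blast
qed

lemma mol_kernel_bound:
  assumes K: "K > 0" "\<And>x. \<psi> x \<le> K * indicator (cube 1) x"
  shows "ennreal (\<psi> (lam (dyadic m) z w) / (dyadic m) ^ Q) \<le> ennreal K * kker 1 m z w"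
proof -
  let ?r = "dyadic m"
  have "\<psi> (lam ?r z w) / ?r ^ Q \<le> K * indicator (kball 1 ?r z) w / ?r ^ Q"
    using K(2)[of "lam ?r z w"] by (intro divide_right_mono) (auto simp: kball_def indicator_def)
  then have "ennreal (\<psi> (lam ?r z w) / ?r ^ Q) \<le> ennreal (K * indicator (kball 1 ?r z) w / ?r ^ Q)"
    by (rule ennreal_leI)
  also have "\<dots> = ennreal K * kker 1 m z w"
    using K(1) by (auto simp: kker_def indicator_def ennreal_mult[symmetric])
  finally show ?thesis .
qed

lemma mol_bound_avg:
  assumes f: "L2 f" and K: "K > 0" "\<And>x. \<psi> x \<le> K * indicator (cube 1) x"
  shows "ennreal \<bar>mol f (dyadic m) z\<bar> \<le> ennreal K * (\<integral>\<^sup>+w. kker 1 m z w * ennreal \<bar>f w\<bar> \<partial>lborel)"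
proof -
  let ?r = "dyadic m"
  have [measurable]: "f \<in> borel_measurable borel" using f by (simp add: L2_def)
  have [measurable]: "kker c m z \<in> borel_measurable lborel" for c m z
    using measurable_Pair2[OF kker_measurable[of c m], of z] by simp
  have int: "integrable lborel (\<lambda>w. f w * (\<psi> (lam ?r z w) / ?r ^ Q))"
    using integrable_compose_lam[OF f cpt_smth_psi, of ?r z] by simp
  have "ennreal \<bar>mol f ?r z\<bar> \<le> (\<integral>\<^sup>+w. ennreal (norm (f w * (\<psi> (lam ?r z w) / ?r ^ Q))) \<partial>lborel)"
    unfolding mol_def real_norm_def[symmetric] by (rule integral_norm_bound_ennreal[OF int])
  also have "\<dots> \<le> (\<integral>\<^sup>+w. ennreal K * (kker 1 m z w * ennreal \<bar>f w\<bar>) \<partial>lborel)"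
  proof (rule nn_integral_mono)
    fix w
    have "ennreal (norm (f w * (\<psi> (lam ?r z w) / ?r ^ Q))) = ennreal (\<psi> (lam ?r z w) / ?r ^ Q) * ennreal \<bar>f w\<bar>"
      using psi_nonneg by (simp add: abs_mult ennreal_mult[symmetric] mult.commute)
    also have "\<dots> \<le> (ennreal K * kker 1 m z w) * ennreal \<bar>f w\<bar>"
      by (intro mult_right_mono mol_kernel_bound K) auto
    finally show "ennreal (norm (f w * (\<psi> (lam ?r z w) / ?r ^ Q))) \<le> ennreal K * (kker 1 m z w * ennreal \<bar>f w\<bar>)"
      by (simp add: mult.assoc)
  qed
  also have "\<dots> = ennreal K * (\<integral>\<^sup>+w. kker 1 m z w * ennreal \<bar>f w\<bar> \<partial>lborel)"
    by (rule nn_integral_cmult) measurable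
  finally show ?thesis .
qed

text \<open>By \<open>avg_le_L2\<close> the average at scale \<open>dyadic m\<close> is at most a
  constant times \<open>2 powr (- (Q/2) * m)\<close>, a geometric sequence in \<open>n\<close> when
  \<open>m = int n\<close>.\<close>

lemma mol_tendsto_0:
  assumes f: "L2 f"
  shows "(\<lambda>n. mol f (dyadic (int n)) z) \<longlonglongrightarrow> 0"
proof -
  obtain K where K: "K > 0" "\<And>x. \<psi> x \<le> K * indicator (cube 1) x"
    by (rule psi_bound, rule that)
  obtain C where dk: "dyadic_kernel lborel (kker 1) (real Q) C" by (rule dyadic_kernel_kker[of 1]) simp
  interpret dk: dyadic_kernel lborel "kker 1" "real Q" C by (rule dk)
  have [measurable]: "f \<in> borel_measurable borel" using f by (simp add: L2_def)
  define N where "N = sqrt (\<integral>w. (f w)\<^sup>2 \<partial>lborel)"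
  have N: "N \<ge> 0" "(\<integral>\<^sup>+w. (ennreal \<bar>f w\<bar>)\<^sup>2 \<partial>lborel) \<le> ennreal (N\<^sup>2)"
    using f by (auto simp: N_def L2_def ennreal_power nn_integral_eq_integral)
  define q where "q = 2 powr - (real Q / 2)"
  have "q > 0" by (simp add: q_def)
  have "q < 1"
    unfolding q_def using Q_ge_3 by (intro powr_less_one) simp_all
  have bound: "\<bar>mol f (dyadic (int n)) z\<bar> \<le> K * (C * N) * q ^ n" for n
  proof -
    have "q ^ n = q powr real n"
      using \<open>q > 0\<close> by (rule powr_realpow[symmetric])
    also have "\<dots> = 2 powr (- (real Q / 2) * real_of_int (int n))"
      unfolding q_def powr_powr by simp
    finally have q: "2 powr (- (real Q / 2) * real_of_int (int n)) = q ^ n" ..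
    have "ennreal \<bar>mol f (dyadic (int n)) z\<bar> \<le> ennreal K * dk.avg (int n) (\<lambda>w. ennreal \<bar>f w\<bar>) z"
      unfolding dk.avg_def by (rule mol_bound_avg[OF f K])
    also have "\<dots> \<le> ennreal K * ennreal (C * N * 2 powr (- (real Q / 2) * real_of_int (int n)))"
      using N by (intro mult_left_mono dk.avg_le_L2) auto
    also have "\<dots> = ennreal (K * (C * N) * q ^ n)"
      unfolding q using K(1) dk.C_pos N(1) \<open>q > 0\<close> by (simp add: ennreal_mult[symmetric] mult.assoc)
    finally show ?thesis
      using K(1) dk.C_pos N(1) \<open>q > 0\<close> by (subst (asm) ennreal_le_iff) simp_all
  qed
  have lim: "(\<lambda>n. K * (C * N) * q ^ n) \<longlonglongrightarrow> K * (C * N) * 0"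
    using \<open>q > 0\<close> \<open>q < 1\<close> by (intro tendsto_mult tendsto_const LIMSEQ_power_zero) simp
  show ?thesis
  proof (rule Lim_null_comparison)
    show "\<forall>\<^sub>F n in sequentially. norm (mol f (dyadic (int n)) z) \<le> K * (C * N) * q ^ n"
      unfolding real_norm_def using bound by (intro always_eventually allI)
    show "(\<lambda>n. K * (C * N) * q ^ n) \<longlonglongrightarrow> 0" using lim by simp
  qed
qed

lemma sum_le_nn_integral_int:
  fixes X :: "int \<Rightarrow> ennreal"
  shows "(\<Sum>j<J. X (m0 + int j)) \<le> (\<integral>\<^sup>+m. X m \<partial>count_space UNIV)"
proof -
  let ?S = "(\<lambda>j. m0 + int j) ` {..<J}"
  have "(\<Sum>j<J. X (m0 + int j)) = (\<Sum>m\<in>?S. X m)"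
    by (subst sum.reindex) (auto simp: inj_on_def)
  also have "\<dots> = (\<integral>\<^sup>+m. X m \<partial>count_space ?S)"
    by (rule nn_integral_count_space_finite[symmetric]) simp
  also have "\<dots> = (\<integral>\<^sup>+m. X m * indicator ?S m \<partial>count_space UNIV)"
    by (rule nn_integral_count_space_indicator) simp
  also have "\<dots> \<le> (\<integral>\<^sup>+m. X m \<partial>count_space UNIV)"
    by (intro nn_integral_mono) (auto simp: indicator_def)
  finally show ?thesis .
qed

text \<open>Telescoping from the scale \<open>- int n\<close> up to \<open>int N\<close> bounds the
  difference by part of the sum defining the potential, and the term at \<open>int N\<close>
  disappears as \<open>N\<close> grows. The bound is uniform in \<open>n\<close>, so it survives the
  passage to small scales.\<close>

lemma mol_bound_pot:
  obtains c K where "c > 0" "K > 0"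
    "\<And>f g S n z. weak_sol f g S \<Longrightarrow>
       ennreal \<bar>mol f (dyadic (- int n)) z\<bar>
         \<le> ennreal K * dyadic_kernel.pot lborel (kker c) UNIV (\<lambda>w. ennreal (data g S w)) z"
proof -
  obtain c K where cK: "c > 0" "K > 0" and diff: "\<And>f g S r z. weak_sol f g S \<Longrightarrow> r > 0 \<Longrightarrow>
       ennreal \<bar>mol f r z - mol f (2 * r) z\<bar>
         \<le> ennreal (K * r / r ^ Q) * (\<integral>\<^sup>+w. indicator (kball c r z) w * ennreal (data g S w) \<partial>lborel)"
    by (rule mol_diff_bound, rule that)
  obtain C where dk: "dyadic_kernel lborel (kker c) (real Q) C" using dyadic_kernel_kker[OF cK(1)] .
  interpret dk: dyadic_kernel lborel "kker c" "real Q" C by (rule dk)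
  show thesis
  proof (rule that[OF cK])
    fix f g S n z assume sol: "weak_sol f g S"
    define G where "G w = ennreal (data g S w)" for w
    have [measurable]: "G \<in> borel_measurable borel"
      using data_measurable[OF sol] unfolding G_def[abs_def] by measurable
    define X where "X m = ennreal (dyadic m) * dk.avg m G z" for m
    define a where "a m = mol f (dyadic m) z" for m
    have step: "ennreal \<bar>a m - a (m + 1)\<bar> \<le> ennreal K * X m" for m
    proof -
      let ?r = "dyadic m"
      have "ennreal \<bar>a m - a (m + 1)\<bar> \<le> ennreal (K * ?r / ?r ^ Q) * (\<integral>\<^sup>+w. indicator (kball c ?r z) w * G w \<partial>lborel)"
        using diff[OF sol, of ?r z] by (simp add: a_def G_def powr_add mult.commute)
      also have "\<dots> = ennreal (K * ?r) * (ennreal (1 / ?r ^ Q) * (\<integral>\<^sup>+w. indicator (kball c ?r z) w * G w \<partial>lborel))"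
        using cK by (simp add: mult.assoc[symmetric] ennreal_mult[symmetric])
      also have "ennreal (1 / ?r ^ Q) * (\<integral>\<^sup>+w. indicator (kball c ?r z) w * G w \<partial>lborel) = dk.avg m G z"
        unfolding dk.avg_def kker_def mult.assoc by (rule nn_integral_cmult[symmetric]) measurable
      finally show ?thesis using cK by (simp add: X_def ennreal_mult mult.assoc)
    qed
    have pot: "dk.pot UNIV G z = (\<integral>\<^sup>+m. X m \<partial>count_space UNIV)"
      by (simp add: dk.pot_def X_def)
    have bound: "ennreal \<bar>a (- int n)\<bar> \<le> ennreal K * dk.pot UNIV G z + ennreal \<bar>a (int N)\<bar>" for N
    proof -
      have "a (- int n) - a (int N) = (\<Sum>j<n + N. a (- int n + int j) - a (- int n + int (Suc j)))"
        using sum_lessThan_telescope'[of "\<lambda>j. a (- int n + int j)" "n + N"] by simp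
      then have "\<bar>a (- int n) - a (int N)\<bar> \<le> (\<Sum>j<n + N. \<bar>a (- int n + int j) - a (- int n + int (Suc j))\<bar>)"
        by (simp only: sum_abs)
      also have "\<dots> = (\<Sum>j<n + N. \<bar>a (- int n + int j) - a ((- int n + int j) + 1)\<bar>)"
        by (intro sum.cong refl) (simp add: add_ac)
      finally have "\<bar>a (- int n)\<bar> \<le> (\<Sum>j<n + N. \<bar>a (- int n + int j) - a ((- int n + int j) + 1)\<bar>) + \<bar>a (int N)\<bar>"
        by linarith
      then have "ennreal \<bar>a (- int n)\<bar> \<le> ennreal ((\<Sum>j<n + N. \<bar>a (- int n + int j) - a ((- int n + int j) + 1)\<bar>) + \<bar>a (int N)\<bar>)"
        by (rule ennreal_leI)
      also have "\<dots> = (\<Sum>j<n + N. ennreal \<bar>a (- int n + int j) - a ((- int n + int j) + 1)\<bar>) + ennreal \<bar>a (int N)\<bar>"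
        by (simp add: sum_nonneg)
      also have "\<dots> \<le> (\<Sum>j<n + N. ennreal K * X (- int n + int j)) + ennreal \<bar>a (int N)\<bar>"
        by (intro add_right_mono sum_mono step)
      also have "\<dots> \<le> ennreal K * dk.pot UNIV G z + ennreal \<bar>a (int N)\<bar>"
        unfolding pot sum_distrib_left[symmetric] by (intro add_right_mono mult_left_mono sum_le_nn_integral_int) auto
      finally show ?thesis .
    qed
    have "(\<lambda>N. ennreal K * dk.pot UNIV G z + ennreal \<bar>a (int N)\<bar>) \<longlonglongrightarrow> ennreal K * dk.pot UNIV G z + ennreal \<bar>0\<bar>"
      using mol_tendsto_0[of f z] sol unfolding a_def weak_sol_def
      by (intro tendsto_add tendsto_const tendsto_ennrealI tendsto_rabs) auto
    then have "ennreal \<bar>a (- int n)\<bar> \<le> ennreal K * dk.pot UNIV G z + ennreal \<bar>0\<bar>"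
      by (rule LIMSEQ_le_const) (use bound in blast)
    then show "ennreal \<bar>mol f (dyadic (- int n)) z\<bar>
         \<le> ennreal K * dk.pot UNIV (\<lambda>w. ennreal (data g S w)) z"
      by (simp add: a_def G_def[abs_def])
  qed
qed

end

subsection \<open>The Sobolev inequality for graded Kolmogorov operators\<close>

context kolmogorov
begin

lemma mol_kernel_mass:
  assumes "r > 0"
  shows "integrable lborel (\<lambda>w. \<psi> (lam r z w) / r ^ Q)" "(\<integral>w. \<psi> (lam r z w) / r ^ Q \<partial>lborel) = 1"
proof -
  have [measurable]: "\<psi> \<in> borel_measurable borel" by (rule smth_measurable[OF smth_psi])
  have "(\<integral>\<^sup>+w. ennreal (\<psi> (lam r z w) / r ^ Q) \<partial>lborel) = (\<integral>\<^sup>+w. ennreal (\<psi> (lam r z w)) * ennreal (1 / r ^ Q) \<partial>lborel)"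
    using assms psi_nonneg by (intro nn_integral_cong) (simp add: ennreal_mult[symmetric])
  also have "\<dots> = ennreal (r ^ Q) * ennreal (1 / r ^ Q)"
    using assms by (simp add: nn_integral_multc nn_integral_lam[where h="\<lambda>x. ennreal (\<psi> x)"] nn_integral_psi)
  also have "\<dots> = 1" using assms by (simp add: ennreal_mult[symmetric])
  finally have 1: "(\<integral>\<^sup>+w. ennreal (\<psi> (lam r z w) / r ^ Q) \<partial>lborel) = 1" .
  show int: "integrable lborel (\<lambda>w. \<psi> (lam r z w) / r ^ Q)"
    using assms psi_nonneg by (intro integrableI_nonneg) (auto simp: 1)
  show "(\<integral>w. \<psi> (lam r z w) / r ^ Q \<partial>lborel) = 1"
    using assms psi_nonneg 1 by (subst integral_eq_nn_integral) auto
qed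

lemma mol_diff_oscil:
  assumes f: "L2 f" and K: "K > 0" "\<And>x. \<psi> x \<le> K * indicator (cube 1) x"
  shows "ennreal \<bar>f z - mol f (dyadic m) z\<bar> \<le> ennreal K * (\<integral>\<^sup>+w. kker 1 m z w * ennreal \<bar>f w - f z\<bar> \<partial>lborel)"
proof -
  let ?r = "dyadic m"
  let ?k = "\<lambda>w. \<psi> (lam ?r z w) / ?r ^ Q"
  have [measurable]: "f \<in> borel_measurable borel" using f by (simp add: L2_def)
  have [measurable]: "kker c m z \<in> borel_measurable lborel" for c m z
    using measurable_Pair2[OF kker_measurable[of c m], of z] by simp
  have k: "integrable lborel ?k" "(\<integral>w. ?k w \<partial>lborel) = 1"
    by (rule mol_kernel_mass, simp)+
  have int: "integrable lborel (\<lambda>w. f w * ?k w)"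
    using integrable_compose_lam[OF f cpt_smth_psi, of ?r z] by simp
  have int2: "integrable lborel (\<lambda>w. (f w - f z) * ?k w)"
    unfolding left_diff_distrib by (rule Bochner_Integration.integrable_diff[OF int integrable_mult_right[OF k(1)]])
  have "mol f ?r z - f z = (\<integral>w. f w * ?k w \<partial>lborel) - (\<integral>w. f z * ?k w \<partial>lborel)"
    unfolding mol_def integral_mult_right_zero k(2) by simp
  also have "\<dots> = (\<integral>w. (f w - f z) * ?k w \<partial>lborel)"
    unfolding left_diff_distrib
    by (rule Bochner_Integration.integral_diff[symmetric, OF int integrable_mult_right[OF k(1)]])
  finally have eq: "mol f ?r z - f z = (\<integral>w. (f w - f z) * ?k w \<partial>lborel)" .
  have "ennreal \<bar>f z - mol f ?r z\<bar> = ennreal (norm (\<integral>w. (f w - f z) * ?k w \<partial>lborel))"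
    unfolding eq[symmetric] real_norm_def by (subst abs_minus_commute) (rule refl)
  also have "\<dots> \<le> (\<integral>\<^sup>+w. ennreal (norm ((f w - f z) * ?k w)) \<partial>lborel)"
    by (rule integral_norm_bound_ennreal[OF int2])
  also have "\<dots> \<le> (\<integral>\<^sup>+w. ennreal K * (kker 1 m z w * ennreal \<bar>f w - f z\<bar>) \<partial>lborel)"
  proof (rule nn_integral_mono)
    fix w
    have "ennreal (norm ((f w - f z) * ?k w)) = ennreal (?k w) * ennreal \<bar>f w - f z\<bar>"
      using psi_nonneg by (simp add: abs_mult ennreal_mult[symmetric] mult.commute)
    also have "\<dots> \<le> (ennreal K * kker 1 m z w) * ennreal \<bar>f w - f z\<bar>"
      by (intro mult_right_mono mol_kernel_bound K) auto
    finally show "ennreal (norm ((f w - f z) * ?k w)) \<le> ennreal K * (kker 1 m z w * ennreal \<bar>f w - f z\<bar>)"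
      by (simp add: mult.assoc)
  qed
  also have "\<dots> = ennreal K * (\<integral>\<^sup>+w. kker 1 m z w * ennreal \<bar>f w - f z\<bar> \<partial>lborel)"
    by (rule nn_integral_cmult) measurable
  finally show ?thesis .
qed

text \<open>The excess of \<open>\<bar>f z\<bar>\<close> over \<open>T z\<close> is at most the
  distance from \<open>f z\<close> to its average, for every scale. Its integral over a bounded set
  is therefore below a multiple of an oscillation that tends to 0.\<close>

lemma AE_le_of_mol_bound:
  assumes f: "L2 f" and T [measurable]: "T \<in> borel_measurable borel"
    and bound: "\<And>n z. ennreal \<bar>mol f (dyadic (- int n)) z\<bar> \<le> T z"
  shows "AE z in lborel. ennreal \<bar>f z\<bar> \<le> T z"
proof -
  have [measurable]: "f \<in> borel_measurable borel" using f by (simp add: L2_def)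
  have kk [measurable]: "(\<lambda>(z, w). kker 1 m z w) \<in> borel_measurable (lborel \<Otimes>\<^sub>M lborel)" for m
    by (rule kker_measurable)
  obtain K where K: "K > 0" "\<And>x. \<psi> x \<le> K * indicator (cube 1) x"
    by (rule psi_bound, rule that)
  have "AE z in lborel. z \<in> cball 0 (real R) \<longrightarrow> ennreal \<bar>f z\<bar> \<le> T z" for R :: nat
  proof -
    obtain R' where R': "R' > 0" "\<And>r z w. 0 < r \<Longrightarrow> r \<le> 1 \<Longrightarrow> norm z \<le> real R \<Longrightarrow> w \<in> kball 1 r z \<Longrightarrow> norm w \<le> R'"
      by (rule kball_bounded[of 1 "real R"]) auto
    \<comment> \<open>\<open>oscil_tendsto_0\<close> asks for an integrable function, while
      \<open>f\<close> is only square integrable. \<open>W\<close> contains the centres under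
      consideration and all their kinetic balls of radius at most 1, so cutting \<open>f\<close> off
      outside \<open>W\<close> does not change these averages.\<close>
    define W where "W = (cball 0 (max (real R) R') :: (real^'n) set)"
    define h where "h w = f w * indicator W w" for w
    have [measurable]: "W \<in> sets borel" by (simp add: W_def)
    have h: "integrable lborel h"
      unfolding h_def[abs_def] using emeasure_lborel_cball_finite[of 0 "max (real R) R'"]
      by (intro L2_mult_integrable[OF f, where A=W and K=1] borel_measurable_indicator) (auto simp: W_def)
    have [measurable]: "h \<in> borel_measurable borel" using h by auto
    define I where "I n z = (\<integral>\<^sup>+w. kker 1 (- int n) z w * ennreal \<bar>h w - h z\<bar> \<partial>lborel)" for n z
    have [measurable]: "I n \<in> borel_measurable lborel" for n
      unfolding I_def[abs_def] by measurable
    \<comment> \<open>Subtraction in \<open>ennreal\<close> is truncated at 0, so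
      \<open>D z = 0\<close> on the ball means exactly the desired inequality there.\<close>
    define D where "D z = (ennreal \<bar>f z\<bar> - T z) * indicator (cball 0 (real R)) z" for z
    have [measurable]: "cball (0 :: real^'n) (real R) \<in> sets borel" by simp
    have [measurable]: "D \<in> borel_measurable borel" unfolding D_def[abs_def] by measurable
    have D_le: "D z \<le> ennreal K * I n z" for n z
    proof (cases "z \<in> cball 0 (real R)")
      case True
      have "kker 1 (- int n) z w * ennreal \<bar>f w - f z\<bar> = kker 1 (- int n) z w * ennreal \<bar>h w - h z\<bar>" for w
      proof (cases "w \<in> kball 1 (dyadic (- int n)) z")
        case wk: True
        have "dyadic (- int n) \<le> 1"
          by (simp add: powr_minus powr_realpow inverse_le_1_iff)
        then have "norm w \<le> R'" using True wk by (intro R'(2)[of "dyadic (- int n)" z]) auto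
        then have "h w = f w" "h z = f z" using True by (auto simp: h_def W_def)
        then show ?thesis by simp
      qed (simp add: kker_def)
      then have eq: "(\<integral>\<^sup>+w. kker 1 (- int n) z w * ennreal \<bar>f w - f z\<bar> \<partial>lborel) = I n z"
        by (simp only: I_def)
      have "ennreal \<bar>f z\<bar> \<le> ennreal (\<bar>mol f (dyadic (- int n)) z\<bar> + \<bar>f z - mol f (dyadic (- int n)) z\<bar>)"
        by (intro ennreal_leI) linarith
      also have "\<dots> = ennreal \<bar>mol f (dyadic (- int n)) z\<bar> + ennreal \<bar>f z - mol f (dyadic (- int n)) z\<bar>"
        by (rule ennreal_plus) auto
      also have "\<dots> \<le> T z + ennreal K * I n z"
        unfolding eq[symmetric] by (intro add_mono bound mol_diff_oscil f K)
      finally have "ennreal \<bar>f z\<bar> - T z \<le> ennreal K * I n z"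
        by (simp add: ennreal_minus_le_iff)
      then show ?thesis using True by (simp add: D_def)
    qed (simp add: D_def)
    have le: "(\<integral>\<^sup>+z. D z \<partial>lborel) \<le> ennreal K * oscil 1 n h" for n
    proof -
      have "(\<integral>\<^sup>+z. D z \<partial>lborel) \<le> (\<integral>\<^sup>+z. ennreal K * I n z \<partial>lborel)"
        by (intro nn_integral_mono D_le)
      also have "\<dots> = ennreal K * (\<integral>\<^sup>+z. I n z \<partial>lborel)"
        by (rule nn_integral_cmult) measurable
      finally show ?thesis by (simp add: oscil_def I_def[abs_def])
    qed
    have "(\<lambda>n. ennreal K * oscil 1 n h) \<longlonglongrightarrow> ennreal K * 0"
      using oscil_tendsto_0[OF _ h, of 1] by (intro ennreal_tendsto_cmult) auto
    then have "(\<integral>\<^sup>+z. D z \<partial>lborel) \<le> ennreal K * 0"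
      by (rule LIMSEQ_le_const) (use le in blast)
    then have "(\<integral>\<^sup>+z. D z \<partial>lborel) = 0" by simp
    then have "AE z in lborel. D z = 0"
      by (subst (asm) nn_integral_0_iff_AE) auto
    then show ?thesis
    proof eventually_elim
      case (elim z)
      then show ?case by (auto simp: D_def intro: ennreal_minus_eq_0)
    qed
  qed
  then have "AE z in lborel. \<forall>R::nat. z \<in> cball 0 (real R) \<longrightarrow> ennreal \<bar>f z\<bar> \<le> T z"
    unfolding AE_all_countable by blast
  then show ?thesis
  proof eventually_elim
    case (elim z)
    have "z \<in> cball 0 (real (nat \<lceil>norm z\<rceil>))" by simp
    then show ?case using elim by blast
  qed
qed

lemma data_power2_le:
  "(data g S w)\<^sup>2 \<le> 2 * real CARD('n) * ((\<Sum>i\<in>V. (g i w)\<^sup>2) + (\<Sum>i\<in>V. (S i w)\<^sup>2))"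
proof -
  have "(data g S w)\<^sup>2 \<le> (\<Sum>i\<in>V. (\<bar>g i w\<bar> + \<bar>S i w\<bar>)\<^sup>2) * real (card V)"
    unfolding data_def by (rule sum_squared_le_sum_of_squares)
  also have "\<dots> \<le> (\<Sum>i\<in>V. 2 * ((g i w)\<^sup>2 + (S i w)\<^sup>2)) * real CARD('n)"
  proof (intro mult_mono sum_mono)
    fix i
    show "(\<bar>g i w\<bar> + \<bar>S i w\<bar>)\<^sup>2 \<le> 2 * ((g i w)\<^sup>2 + (S i w)\<^sup>2)"
      using sum_squares_bound[of "\<bar>g i w\<bar>" "\<bar>S i w\<bar>"] by (simp add: power2_sum)
  qed (auto intro!: sum_nonneg card_mono)
  also have "\<dots> = 2 * real CARD('n) * ((\<Sum>i\<in>V. (g i w)\<^sup>2) + (\<Sum>i\<in>V. (S i w)\<^sup>2))"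
    by (simp add: sum_distrib_left[symmetric] sum.distrib)
  finally show ?thesis .
qed

theorem sobolev:
  defines "p \<equiv> 2 * real Q / (real Q - 2)"
  shows "\<exists>C>0. \<forall>f g S. weak_sol f g S \<longrightarrow>
    integrable lborel (\<lambda>x. \<bar>f x\<bar> powr p) \<and>
    (\<integral>x. \<bar>f x\<bar> powr p \<partial>lborel) powr (1 / p)
      \<le> C * (sqrt (\<integral>x. (\<Sum>i\<in>V. (g i x)\<^sup>2) \<partial>lborel) + sqrt (\<integral>x. (\<Sum>i\<in>V. (S i x)\<^sup>2) \<partial>lborel))"
proof -
  have p: "p > 2" using Q_ge_3 by (simp add: p_def field_simps)
  obtain c K where cK: "c > 0" "K > 0" and mb: "\<And>f g S n z. weak_sol f g S \<Longrightarrow>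
       ennreal \<bar>mol f (dyadic (- int n)) z\<bar>
         \<le> ennreal K * dyadic_kernel.pot lborel (kker c) UNIV (\<lambda>w. ennreal (data g S w)) z"
    by (rule mol_bound_pot, rule that)
  obtain C0 where dk: "dyadic_kernel lborel (kker c) (real Q) C0" using dyadic_kernel_kker[OF cK(1)] .
  interpret dk: dyadic_kernel lborel "kker c" "real Q" C0 by (rule dk)
  obtain C' where C': "C' > 0"
    and strong: "\<And>G N. G \<in> borel_measurable lborel \<Longrightarrow> (\<And>w. G w \<ge> (0::real)) \<Longrightarrow> N > 0 \<Longrightarrow>
        (\<integral>\<^sup>+w. (ennreal (G w))\<^sup>2 \<partial>lborel) \<le> ennreal (N\<^sup>2) \<Longrightarrow>
        \<exists>H \<in> borel_measurable lborel.
          (\<forall>z\<in>space lborel. \<forall>y\<ge>0. ennreal y \<le> dk.pot UNIV (\<lambda>w. ennreal (G w)) z \<longrightarrow> ennreal (y powr p) \<le> H z) \<and>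
          (\<integral>\<^sup>+z. H z \<partial>lborel) \<le> ennreal (C' * N powr (p - 2)) * (\<integral>\<^sup>+w. (ennreal (G w))\<^sup>2 \<partial>lborel)"
  proof (rule dk.pot_strong_type[folded p_def], goal_cases)
    case (1 C')
    show thesis by (rule that[OF 1(2)]) (rule 1(3), auto)
  qed
  define D where "D = 2 * real CARD('n)"
  have D: "D > 0" by (simp add: D_def)
  define C where "C = C' powr (1 / p) * (K * sqrt D)"
  have "C > 0" using C' cK D by (simp add: C_def)
  moreover have "integrable lborel (\<lambda>x. \<bar>f x\<bar> powr p) \<and>
    (\<integral>x. \<bar>f x\<bar> powr p \<partial>lborel) powr (1 / p)
      \<le> C * (sqrt (\<integral>x. (\<Sum>i\<in>V. (g i x)\<^sup>2) \<partial>lborel) + sqrt (\<integral>x. (\<Sum>i\<in>V. (S i x)\<^sup>2) \<partial>lborel))"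
    if sol: "weak_sol f g S" for f g S
  proof -
    have f: "L2 f" and gS: "\<And>i. i \<in> V \<Longrightarrow> L2 (g i)" "\<And>i. i \<in> V \<Longrightarrow> L2 (S i)"
      using sol by (auto simp: weak_sol_def)
    have [measurable]: "f \<in> borel_measurable borel" using f by (simp add: L2_def)
    have G [measurable]: "data g S \<in> borel_measurable borel" using sol by (rule data_measurable)
    have G0: "data g S w \<ge> 0" for w by (auto simp: data_def intro!: sum_nonneg)
    define a where "a = (\<integral>x. (\<Sum>i\<in>V. (g i x)\<^sup>2) \<partial>lborel)"
    define b where "b = (\<integral>x. (\<Sum>i\<in>V. (S i x)\<^sup>2) \<partial>lborel)"
    have a: "a \<ge> 0" and b: "b \<ge> 0" by (auto simp: a_def b_def intro!: integral_nonneg_AE sum_nonneg)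
    define M where "M = sqrt a + sqrt b"
    have M: "M \<ge> 0" using a b by (simp add: M_def)
    have ab: "a + b \<le> M\<^sup>2" using a b by (simp add: M_def power2_sum)
    have intg: "integrable lborel (\<lambda>x. \<Sum>i\<in>V. (g i x)\<^sup>2)" "integrable lborel (\<lambda>x. \<Sum>i\<in>V. (S i x)\<^sup>2)"
      using gS by (auto simp: L2_def)
    have data2: "(\<integral>\<^sup>+w. (ennreal (data g S w))\<^sup>2 \<partial>lborel) \<le> ennreal (D * M\<^sup>2)"
    proof -
      have "(\<integral>\<^sup>+w. (ennreal (data g S w))\<^sup>2 \<partial>lborel) \<le> (\<integral>\<^sup>+w. ennreal (D * ((\<Sum>i\<in>V. (g i w)\<^sup>2) + (\<Sum>i\<in>V. (S i w)\<^sup>2))) \<partial>lborel)"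
        using G0 data_power2_le by (intro nn_integral_mono) (simp add: ennreal_power D_def ennreal_leI)
      also have "\<dots> = ennreal (\<integral>w. D * ((\<Sum>i\<in>V. (g i w)\<^sup>2) + (\<Sum>i\<in>V. (S i w)\<^sup>2)) \<partial>lborel)"
        using intg D by (intro nn_integral_eq_integral) (auto intro!: AE_I2 mult_nonneg_nonneg add_nonneg_nonneg sum_nonneg)
      also have "(\<integral>w. D * ((\<Sum>i\<in>V. (g i w)\<^sup>2) + (\<Sum>i\<in>V. (S i w)\<^sup>2)) \<partial>lborel) = D * (a + b)"
        using Bochner_Integration.integral_add[OF intg] by (simp add: a_def b_def)
      also have "ennreal \<dots> \<le> ennreal (D * M\<^sup>2)"
        using ab D by (intro ennreal_leI mult_left_mono) auto
      finally show ?thesis .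
    qed
    \<comment> \<open>The potential estimate requires a positive \<open>N\<close>. If
      \<open>M = 0\<close> the square integral of the data is 0, and the arbitrary value 1 still
      gives the bound 0.\<close>
    define N where "N = (if M > 0 then sqrt D * M else 1)"
    have N: "N > 0" using D by (simp add: N_def)
    have "D * M\<^sup>2 \<le> N\<^sup>2" using M D by (auto simp: N_def power_mult_distrib)
    then have "(\<integral>\<^sup>+w. (ennreal (data g S w))\<^sup>2 \<partial>lborel) \<le> ennreal (N\<^sup>2)"
      using data2 by (meson ennreal_leI order_trans)
    then obtain H where [measurable]: "H \<in> borel_measurable lborel"
      and H: "\<And>z y. y \<ge> 0 \<Longrightarrow> ennreal y \<le> dk.pot UNIV (\<lambda>w. ennreal (data g S w)) z \<Longrightarrow> ennreal (y powr p) \<le> H z"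
      and intH: "(\<integral>\<^sup>+z. H z \<partial>lborel) \<le> ennreal (C' * N powr (p - 2)) * (\<integral>\<^sup>+w. (ennreal (data g S w))\<^sup>2 \<partial>lborel)"
      using strong[of "data g S" N] G G0 N by auto
    have H_bound: "(\<integral>\<^sup>+z. H z \<partial>lborel) \<le> ennreal (C' * (sqrt D * M) powr p)"
    proof -
      have "(\<integral>\<^sup>+z. H z \<partial>lborel) \<le> ennreal (C' * N powr (p - 2)) * ennreal (D * M\<^sup>2)"
        using intH data2 by (meson mult_left_mono order_trans zero_le)
      also have "\<dots> = ennreal (C' * N powr (p - 2) * (D * M\<^sup>2))"
        using C' D by (simp add: ennreal_mult[symmetric])
      also have "C' * N powr (p - 2) * (D * M\<^sup>2) = C' * (sqrt D * M) powr p"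
      proof (cases "M > 0")
        case True
        then have x: "sqrt D * M > 0" using D by simp
        have "(sqrt D * M) powr p = (sqrt D * M) powr (p - 2) * (sqrt D * M) powr 2"
          by (simp add: powr_add[symmetric])
        also have "(sqrt D * M) powr 2 = D * M\<^sup>2"
          using x D by (simp add: powr_numeral power_mult_distrib)
        finally show ?thesis using True by (simp add: N_def)
      qed (use M in simp)
      finally show ?thesis .
    qed
    have "AE z in lborel. ennreal \<bar>f z\<bar> \<le> ennreal K * dk.pot UNIV (\<lambda>w. ennreal (data g S w)) z"
    proof (rule AE_le_of_mol_bound[OF f _ mb[OF sol]])
      have "dk.pot UNIV (\<lambda>w. ennreal (data g S w)) \<in> borel_measurable lborel"
        by (rule dk.pot_measurable) measurable
      then show "(\<lambda>z. ennreal K * dk.pot UNIV (\<lambda>w. ennreal (data g S w)) z) \<in> borel_measurable borel"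
        by simp
    qed
    then have AE_H: "AE z in lborel. ennreal (\<bar>f z\<bar> powr p) \<le> ennreal (K powr p) * H z"
    proof eventually_elim
      case (elim z)
      \<comment> \<open>The majorant \<open>H\<close> is applied at the height
        \<open>\<bar>f z\<bar> / K\<close>, which lies below the potential itself; the lost
        \<open>K\<close> returns as \<open>K powr p\<close>.\<close>
      have "ennreal (\<bar>f z\<bar> / K) = ennreal (1 / K) * ennreal \<bar>f z\<bar>"
        using cK by (simp add: ennreal_mult[symmetric])
      also have "\<dots> \<le> ennreal (1 / K) * (ennreal K * dk.pot UNIV (\<lambda>w. ennreal (data g S w)) z)"
        by (rule mult_left_mono[OF elim]) simp
      also have "\<dots> = dk.pot UNIV (\<lambda>w. ennreal (data g S w)) z"
        using cK by (simp add: mult.assoc[symmetric] ennreal_mult[symmetric])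
      finally have "ennreal ((\<bar>f z\<bar> / K) powr p) \<le> H z"
        using cK by (intro H) auto
      then have "ennreal (K powr p) * ennreal ((\<bar>f z\<bar> / K) powr p) \<le> ennreal (K powr p) * H z"
        by (rule mult_left_mono) simp
      then show ?case
        using cK by (simp add: ennreal_mult[symmetric] powr_divide)
    qed
    have "(\<integral>\<^sup>+z. ennreal (\<bar>f z\<bar> powr p) \<partial>lborel) \<le> (\<integral>\<^sup>+z. ennreal (K powr p) * H z \<partial>lborel)"
      by (rule nn_integral_mono_AE[OF AE_H])
    also have "\<dots> = ennreal (K powr p) * (\<integral>\<^sup>+z. H z \<partial>lborel)"
      by (rule nn_integral_cmult) measurable
    also have "\<dots> \<le> ennreal (K powr p) * ennreal (C' * (sqrt D * M) powr p)"
      by (rule mult_left_mono[OF H_bound]) simp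
    also have "\<dots> = ennreal (C' * (K * sqrt D * M) powr p)"
      using C' cK D M by (simp add: ennreal_mult[symmetric] powr_mult mult_ac)
    finally have nn: "(\<integral>\<^sup>+z. ennreal (\<bar>f z\<bar> powr p) \<partial>lborel) \<le> ennreal (C' * (K * sqrt D * M) powr p)" .
    have int: "integrable lborel (\<lambda>x. \<bar>f x\<bar> powr p)"
      using nn by (intro integrableI_nonneg) (auto intro: le_less_trans)
    have "ennreal (\<integral>x. \<bar>f x\<bar> powr p \<partial>lborel) \<le> ennreal (C' * (K * sqrt D * M) powr p)"
      using nn nn_integral_eq_integral[OF int] by simp
    then have le: "(\<integral>x. \<bar>f x\<bar> powr p \<partial>lborel) \<le> C' * (K * sqrt D * M) powr p"
      using C' by (subst (asm) ennreal_le_iff) auto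
    have "(\<integral>x. \<bar>f x\<bar> powr p \<partial>lborel) powr (1 / p) \<le> (C' * (K * sqrt D * M) powr p) powr (1 / p)"
      using le p by (intro powr_mono2) auto
    also have "\<dots> = C * M"
      using C' cK D M p by (simp add: powr_mult powr_powr C_def)
    finally show ?thesis using int by (simp add: M_def a_def b_def)
  qed
  ultimately show ?thesis by blast
qed

end

subsection \<open>Block coordinates\<close>

definition blocks :: "nat \<Rightarrow> (nat \<Rightarrow> nat) \<Rightarrow> (nat \<times> nat) set" where
  "blocks k d = (SIGMA j:{1..k}. {..<d j})"

lemma gidx_less: "j \<in> {1..k} \<Longrightarrow> r < d j \<Longrightarrow> gidx d j r < 1 + (\<Sum>i\<in>{1..k}. d i)"
proof -
  assume j: "j \<in> {1..k}" and r: "r < d j"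
  have "(\<Sum>i\<in>{1..<j}. d i) + d j = (\<Sum>i\<in>insert j {1..<j}. d i)" by simp
  also have "\<dots> \<le> (\<Sum>i\<in>{1..k}. d i)" using j by (intro sum_mono2) auto
  finally show ?thesis using r by (simp add: gidx_def)
qed

lemma gidx_less_block:
  assumes "1 \<le> j" "j < j'" "r < d j" shows "gidx d j r < gidx d j' r'"
proof -
  have "(\<Sum>i\<in>{1..<j}. d i) + d j = (\<Sum>i\<in>insert j {1..<j}. d i)" by simp
  also have "\<dots> \<le> (\<Sum>i\<in>{1..<j'}. d i)" using assms by (intro sum_mono2) auto
  finally show ?thesis using assms(3) by (simp add: gidx_def)
qed

text \<open>Blocks occupy consecutive intervals, which gives injectivity and the range; surjectivity
  follows by counting.\<close>

lemma bij_betw_gidx: "bij_betw (\<lambda>(j, r). gidx d j r) (blocks k d) {1..<1 + (\<Sum>i\<in>{1..k}. d i)}"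
proof -
  have inj: "inj_on (\<lambda>(j, r). gidx d j r) (blocks k d)"
  proof (rule inj_onI, clarify)
    fix j r j' r'
    assume *: "(j, r) \<in> blocks k d" "(j', r') \<in> blocks k d" and eq: "gidx d j r = gidx d j' r'"
    have "j = j'"
      using gidx_less_block[of j j' r d r'] gidx_less_block[of j' j r' d r] * eq
      by (cases j j' rule: linorder_cases) (auto simp: blocks_def)
    then show "j = j' \<and> r = r'" using eq by (simp add: gidx_def)
  qed
  have sub: "(\<lambda>(j, r). gidx d j r) ` blocks k d \<subseteq> {1..<1 + (\<Sum>i\<in>{1..k}. d i)}"
  proof (clarify)
    fix j r assume "(j, r) \<in> blocks k d"
    then show "gidx d j r \<in> {1..<1 + (\<Sum>i\<in>{1..k}. d i)}"
      using gidx_less[of j k r d] by (auto simp: blocks_def gidx_def)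
  qed
  have "card ((\<lambda>(j, r). gidx d j r) ` blocks k d) = card {1..<1 + (\<Sum>i\<in>{1..k}. d i)}"
    using inj by (simp add: card_image blocks_def)
  then have "(\<lambda>(j, r). gidx d j r) ` blocks k d = {1..<1 + (\<Sum>i\<in>{1..k}. d i)}"
    using sub by (intro card_subset_eq) auto
  then show ?thesis using inj by (simp add: bij_betw_def)
qed

locale block_coordinates =
  fixes k :: nat and d :: "nat \<Rightarrow> nat" and b :: "nat \<Rightarrow> nat \<Rightarrow> nat \<Rightarrow> real" and idx :: "nat \<Rightarrow> 'n::finite"
  assumes k: "k \<ge> 1" and d1: "d 1 \<ge> 1"
    and rank: "\<And>j. j \<in> {1..<k} \<Longrightarrow> full_row_rank (d j) (d (Suc j)) (b j)"
    and bij: "bij_betw idx {..<1 + (\<Sum>j\<in>{1..k}. d j)} UNIV"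
begin

definition crd :: "nat \<Rightarrow> nat \<Rightarrow> 'n" where "crd j r = idx (gidx d j r)"

text \<open>The inverse labelling is unspecified at the time index \<open>idx 0\<close>, which lies
  in no block; hence the explicit tests for \<open>idx 0\<close> in the weight and in the
  matrix.\<close>

definition pos :: "'n \<Rightarrow> nat \<times> nat" where "pos = the_inv_into (blocks k d) (\<lambda>(j, r). crd j r)"

definition wt :: "'n \<Rightarrow> nat" where
  "wt i = (if i = idx 0 then 2 else 1 + 2 * (k - fst (pos i)))"

definition BB :: "'n \<Rightarrow> 'n \<Rightarrow> real" where
  "BB i i' = (if i \<noteq> idx 0 \<and> i' \<noteq> idx 0 \<and> fst (pos i') = Suc (fst (pos i))
     then b (fst (pos i)) (snd (pos i)) (snd (pos i')) else 0)"

lemma bij_crd: "bij_betw (\<lambda>(j, r). crd j r) (blocks k d) (UNIV - {idx 0})"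
proof -
  let ?N = "1 + (\<Sum>i\<in>{1..k}. d i)"
  have "{1..<?N} = {..<?N} - {0}" by auto
  moreover have "bij_betw idx ({..<?N} - {0}) (UNIV - {idx 0})"
    using bij by (rule bij_betw_DiffI) (auto simp: bij_betw_def)
  ultimately have "bij_betw (idx \<circ> (\<lambda>(j, r). gidx d j r)) (blocks k d) (UNIV - {idx 0})"
    using bij_betw_trans[OF bij_betw_gidx[of d k]] by simp
  moreover have "idx \<circ> (\<lambda>(j, r). gidx d j r) = (\<lambda>(j, r). crd j r)"
    by (auto simp: crd_def)
  ultimately show ?thesis by simp
qed

lemma pos_crd: "j \<in> {1..k} \<Longrightarrow> r < d j \<Longrightarrow> pos (crd j r) = (j, r)"
  unfolding pos_def using the_inv_into_f_f[OF bij_betw_imp_inj_on[OF bij_crd], of "(j, r)"]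
  by (simp add: blocks_def)

lemma crd_ne_0: "j \<in> {1..k} \<Longrightarrow> r < d j \<Longrightarrow> crd j r \<noteq> idx 0"
  using bij_betw_imp_surj_on[OF bij_crd] by (force simp: blocks_def)

lemma crd_cases:
  obtains "i = idx 0" | j r where "j \<in> {1..k}" "r < d j" "i = crd j r"
proof (cases "i = idx 0")
  case False
  then have "i \<in> (\<lambda>(j, r). crd j r) ` blocks k d"
    using bij_betw_imp_surj_on[OF bij_crd] by blast
  then obtain j r where "(j, r) \<in> blocks k d" "i = crd j r" by auto
  then show thesis using that(2) by (auto simp: blocks_def)
qed (rule that(1))

lemma wt_crd: "j \<in> {1..k} \<Longrightarrow> r < d j \<Longrightarrow> wt (crd j r) = 1 + 2 * (k - j)"
  by (simp add: wt_def crd_ne_0 pos_crd)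

lemma BB_crd:
  assumes "j \<in> {1..k}" "r < d j" "j' \<in> {1..k}" "r' < d j'"
  shows "BB (crd j r) (crd j' r') = (if j' = Suc j then b j r r' else 0)"
  using assms by (auto simp: BB_def crd_ne_0 pos_crd)

lemma sum_UNIV:
  fixes F :: "'n \<Rightarrow> 'c::comm_monoid_add"
  shows "(\<Sum>i\<in>UNIV. F i) = F (idx 0) + (\<Sum>j\<in>{1..k}. \<Sum>r<d j. F (crd j r))"
proof -
  have "(\<Sum>i\<in>UNIV - {idx 0}. F i) = (\<Sum>x\<in>blocks k d. F (case x of (j, r) \<Rightarrow> crd j r))"
    by (rule sum.reindex_bij_betw[OF bij_crd, symmetric])
  also have "\<dots> = (\<Sum>j\<in>{1..k}. \<Sum>r<d j. F (crd j r))"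
    unfolding blocks_def by (subst sum.Sigma) (auto simp: split_beta)
  finally show ?thesis
    using sum.remove[of UNIV "idx 0" F] by simp
qed

text \<open>For the row condition, testing a vanishing combination against a column in block
  \<open>Suc j\<close> leaves only the rows of block \<open>j\<close>, so it becomes a vanishing
  combination of the rows of \<open>b j\<close>, and the rank hypothesis applies. Weight different
  from 1 means \<open>j < k\<close>, so that such a block exists.\<close>

lemma kolmogorov: "kolmogorov (idx 0) wt BB"
proof
  show "wt (idx 0) = 2" by (simp add: wt_def)
  show "odd (wt i)" if "i \<noteq> idx 0" for i using that by (simp add: wt_def)
  show "i \<noteq> idx 0 \<and> j \<noteq> idx 0 \<and> wt i = wt j + 2" if "BB i j \<noteq> 0" for i j
  proof -
    have ij: "i \<noteq> idx 0" "j \<noteq> idx 0" using that by (auto simp: BB_def split: if_splits)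
    obtain a r where 1: "a \<in> {1..k}" "r < d a" "i = crd a r" using crd_cases[of i] ij by blast
    obtain a' r' where 2: "a' \<in> {1..k}" "r' < d a'" "j = crd a' r'" using crd_cases[of j] ij by blast
    have "a' = Suc a" using that 1 2 by (auto simp: BB_crd split: if_splits)
    then show ?thesis using ij 1 2 by (auto simp: wt_crd)
  qed
  show "\<exists>i. i \<noteq> idx 0"
    using crd_ne_0[of 1 0] k d1 by auto
  fix z :: "'n \<Rightarrow> real" and i
  assume z: "\<And>c. (\<Sum>i\<in>UNIV. z i * BB i c) = 0" and i: "i \<noteq> idx 0" "wt i \<noteq> 1"
  obtain j r where j: "j \<in> {1..k}" "r < d j" "i = crd j r" using crd_cases[of i] i by blast
  have jk: "j \<in> {1..<k}" using i(2) j by (auto simp: wt_crd)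
  have "(\<Sum>r<d j. z (crd j r) * b j r c) = 0" if c: "c < d (Suc j)" for c
  proof -
    have "0 = (\<Sum>i\<in>UNIV. z i * BB i (crd (Suc j) c))" using z by simp
    also have "\<dots> = (\<Sum>j'\<in>{1..k}. \<Sum>r<d j'. z (crd j' r) * BB (crd j' r) (crd (Suc j) c))"
      by (simp add: sum_UNIV BB_def[of "idx 0"])
    also have "\<dots> = (\<Sum>j'\<in>{1..k}. \<Sum>r<d j'. z (crd j' r) * (if j' = j then b j r c else 0))"
      using jk c by (intro sum.cong refl) (auto simp: BB_crd)
    also have "\<dots> = (\<Sum>j'\<in>{1..k}. if j' = j then (\<Sum>r<d j. z (crd j r) * b j r c) else 0)"
      by (intro sum.cong refl) simp
    also have "\<dots> = (\<Sum>r<d j. z (crd j r) * b j r c)" using j(1) by simp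
    finally show ?thesis by simp
  qed
  then have "\<forall>c<d (Suc j). (\<Sum>r<d j. z (crd j r) * b j r c) = 0" by blast
  then have "\<forall>r<d j. z (crd j r) = 0"
    by (rule rank[OF jk, unfolded full_row_rank_def, THEN spec, THEN mp])
  then show "z i = 0" using j by blast
qed

sublocale kolmogorov "idx 0" wt BB by (rule kolmogorov)

lemma Q_eq_homdim: "Q = homdim k d"
proof -
  have "Q = 2 + (\<Sum>j\<in>{1..k}. \<Sum>r<d j. wt (crd j r))"
    by (simp add: Q_def sum_UNIV om_t0)
  also have "(\<Sum>j\<in>{1..k}. \<Sum>r<d j. wt (crd j r)) = (\<Sum>j\<in>{1..k}. d j * (1 + 2 * (k - j)))"
    by (intro sum.cong refl) (simp add: wt_crd)
  finally show ?thesis by (simp add: homdim_def)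
qed

lemma V_eq: "V = crd k ` {..<d k}"
proof
  show "V \<subseteq> crd k ` {..<d k}"
  proof
    fix i assume "i \<in> V"
    then have "wt i = 1" by (simp add: V_def)
    moreover from this have "i \<noteq> idx 0" using om_t0 by auto
    ultimately obtain j r where "j \<in> {1..k}" "r < d j" "i = crd j r" using crd_cases[of i] by blast
    then show "i \<in> crd k ` {..<d k}" using \<open>wt i = 1\<close> by (auto simp: wt_crd)
  qed
  show "crd k ` {..<d k} \<subseteq> V" using k by (auto simp: V_def wt_crd)
qed

lemma inj_on_crd: "inj_on (crd k) {..<d k}"
proof (rule inj_onI)
  fix r r' assume r: "r \<in> {..<d k}" "r' \<in> {..<d k}" and eq: "crd k r = crd k r'"
  have "pos (crd k r) = (k, r)" by (rule pos_crd) (use r k in simp_all)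
  moreover have "pos (crd k r') = (k, r')" by (rule pos_crd) (use r k in simp_all)
  ultimately show "r = r'" using eq by (metis prod.inject)
qed

lemma sum_V: "(\<Sum>i\<in>V. F i (snd (pos i))) = (\<Sum>r<d k. F (crd k r) r)"
  unfolding V_eq sum.reindex[OF inj_on_crd] o_def
proof (rule sum.cong[OF refl])
  fix r assume "r \<in> {..<d k}"
  then have "pos (crd k r) = (k, r)" using k by (intro pos_crd) auto
  then show "F (crd k r) (snd (pos (crd k r))) = F (crd k r) r" by simp
qed

lemma Y_eq: "Y \<phi> x = partial (idx 0) \<phi> x +
   (\<Sum>j\<in>{1..<k}. \<Sum>r<d j. (\<Sum>c<d (Suc j). b j r c * x $ crd (Suc j) c) * partial (crd j r) \<phi> x)"
proof -
  have Bv: "Bv x $ crd j r = (if j < k then \<Sum>c<d (Suc j). b j r c * x $ crd (Suc j) c else 0)"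
    if j: "j \<in> {1..k}" "r < d j" for j r
  proof -
    have "Bv x $ crd j r = (\<Sum>j'\<in>{1..k}. \<Sum>c<d j'. (if j' = Suc j then b j r c else 0) * x $ crd j' c)"
      using j by (simp add: Bv_nth sum_UNIV BB_crd) (simp add: BB_def)
    also have "\<dots> = (\<Sum>j'\<in>{1..k}. if j' = Suc j then (\<Sum>c<d (Suc j). b j r c * x $ crd (Suc j) c) else 0)"
      by (intro sum.cong refl) simp
    also have "\<dots> = (if j < k then \<Sum>c<d (Suc j). b j r c * x $ crd (Suc j) c else 0)"
      using j(1) by auto
    finally show ?thesis .
  qed
  have "(\<Sum>i\<in>UNIV. Bv x $ i * partial i \<phi> x) = (\<Sum>j\<in>{1..k}. \<Sum>r<d j. Bv x $ crd j r * partial (crd j r) \<phi> x)"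
    by (simp add: sum_UNIV Bv_t0)
  also have "\<dots> = (\<Sum>j\<in>{1..<k}. \<Sum>r<d j. Bv x $ crd j r * partial (crd j r) \<phi> x)"
  proof (rule sum.mono_neutral_right)
    show "\<forall>j\<in>{1..k} - {1..<k}. (\<Sum>r<d j. Bv x $ crd j r * partial (crd j r) \<phi> x) = 0"
      by (auto simp: Bv intro!: sum.neutral)
  qed auto
  also have "\<dots> = (\<Sum>j\<in>{1..<k}. \<Sum>r<d j. (\<Sum>c<d (Suc j). b j r c * x $ crd (Suc j) c) * partial (crd j r) \<phi> x)"
    by (intro sum.cong refl) (simp add: Bv)
  finally show ?thesis by (simp add: Y_def)
qed

lemma weak_solI:
  assumes "L2 f" "\<forall>r<d k. L2 (g r)"
    and "\<forall>r<d k. \<forall>\<phi>. test_fun \<phi> \<longrightarrow>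
        (\<integral>x. f x * partial (idx (gidx d k r)) \<phi> x \<partial>lborel) = - (\<integral>x. g r x * \<phi> x \<partial>lborel)"
    and "\<forall>r<d k. L2 (S r)"
    and "\<forall>\<phi>. test_fun \<phi> \<longrightarrow>
        (\<integral>x. f x * (partial (idx 0) \<phi> x +
            (\<Sum>j\<in>{1..<k}. \<Sum>r<d j.
               (\<Sum>c<d (Suc j). b j r c * x $ idx (gidx d (Suc j) c)) * partial (idx (gidx d j r)) \<phi> x))
          \<partial>lborel)
        = (\<integral>x. (\<Sum>r<d k. S r x * partial (idx (gidx d k r)) \<phi> x) \<partial>lborel)"
  shows "weak_sol f (\<lambda>i. g (snd (pos i))) (\<lambda>i. S (snd (pos i)))"
  unfolding weak_sol_def
proof (intro conjI allI ballI impI)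
  have pV: "snd (pos i) < d k \<and> crd k (snd (pos i)) = i" if "i \<in> V" for i
    using that k by (auto simp: V_eq pos_crd)
  show "L2 f" by (rule assms)
  fix i assume "i \<in> V"
  note i = pV[OF this]
  show "L2 (g (snd (pos i)))" "L2 (S (snd (pos i)))" using i assms by blast+
  fix \<phi> :: "real^'n \<Rightarrow> real" assume "test_fun \<phi>"
  then show "(\<integral>x. f x * partial i \<phi> x \<partial>lborel) = - (\<integral>x. g (snd (pos i)) x * \<phi> x \<partial>lborel)"
    using i assms(3) unfolding crd_def by metis
next
  fix \<phi> :: "real^'n \<Rightarrow> real" assume "test_fun \<phi>"
  then show "(\<integral>x. f x * Y \<phi> x \<partial>lborel) = (\<integral>x. (\<Sum>i\<in>V. S (snd (pos i)) x * partial i \<phi> x) \<partial>lborel)"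
    using assms(5) unfolding Y_eq sum_V[of "\<lambda>i r. S r _ * partial i \<phi> _"] crd_def by blast
qed

end

section \<open>One constant for all labellings\<close>

lemma uniform_constant:
  fixes R :: "'a \<Rightarrow> real \<Rightarrow> bool"
  assumes "finite A" "\<And>x. x \<in> A \<Longrightarrow> \<exists>C>0. R x C"
    and mono: "\<And>x C C'. R x C \<Longrightarrow> C \<le> C' \<Longrightarrow> R x C'"
  shows "\<exists>C>0. \<forall>x\<in>A. R x C"
  using assms(1,2)
proof (induction A rule: finite_induct)
  case empty
  show ?case by (intro exI[of _ 1]) simp
next
  case (insert y A)
  obtain C where C: "C > 0" "\<forall>x\<in>A. R x C" using insert by blast
  obtain C' where C': "C' > 0" "R y C'" using insert.prems[of y] by blast
  have "R x (max C C')" if "x \<in> insert y A" for x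
  proof (cases "x = y")
    case True
    then show ?thesis using mono[OF C'(2), of "max C C'"] by simp
  next
    case False
    then have "R x C" using C that by blast
    then show ?thesis using mono[of x C "max C C'"] by simp
  qed
  moreover have "max C C' > 0" using C by simp
  ultimately show ?case by blast
qed

text \<open>The index type is finite, the weights take values in \<open>W\<close> and the matrix
  entries in \<open>F\<close>, both independent of \<open>idx\<close>; so the triples lie in a
  product of finite function spaces, although there are infinitely many \<open>idx\<close>.\<close>

lemma finite_block_structures:
  "finite {(idx 0, block_coordinates.wt k d idx, block_coordinates.BB k d b idx) | idx :: nat \<Rightarrow> 'n::finite.
     block_coordinates k d b idx}" (is "finite ?A")
proof -
  define W where "W = {2} \<union> (\<lambda>j. 1 + 2 * (k - j)) ` {1..k}"
  define F where "F = {0} \<union> (\<lambda>(j, r, c). b j r c) ` (SIGMA j:{1..k}. {..<d j} \<times> {..<d (Suc j)})"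
  have fin: "finite W" "finite F" by (simp_all add: W_def F_def)
  have "?A \<subseteq> UNIV \<times> (Pi\<^sub>E UNIV (\<lambda>_. W)) \<times> (Pi\<^sub>E UNIV (\<lambda>_. Pi\<^sub>E UNIV (\<lambda>_. F)))"
  proof
    fix \<tau> assume "\<tau> \<in> ?A"
    then obtain idx :: "nat \<Rightarrow> 'n" where \<tau>: "\<tau> = (idx 0, block_coordinates.wt k d idx, block_coordinates.BB k d b idx)"
      and "block_coordinates k d b idx" by blast
    then interpret block_coordinates k d b idx by simp
    have "wt i \<in> W" for i
      by (rule crd_cases[of i]) (auto simp: W_def om_t0 wt_crd)
    then have 1: "wt \<in> Pi\<^sub>E UNIV (\<lambda>_. W)" by (intro PiE_I) auto
    have "BB i i' \<in> F" for i i'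
    proof (rule crd_cases[of i])
      fix j r assume 1: "j \<in> {1..k}" "r < d j" "i = crd j r"
      show ?thesis
      proof (rule crd_cases[of i'])
        fix j' r' assume 2: "j' \<in> {1..k}" "r' < d j'" "i' = crd j' r'"
        then show ?thesis using 1 by (force simp: F_def BB_crd)
      qed (simp add: F_def BB_def)
    qed (simp add: F_def BB_def)
    then have "BB \<in> Pi\<^sub>E UNIV (\<lambda>_. Pi\<^sub>E UNIV (\<lambda>_. F))" by (intro PiE_I) auto
    then show "\<tau> \<in> UNIV \<times> (Pi\<^sub>E UNIV (\<lambda>_. W)) \<times> (Pi\<^sub>E UNIV (\<lambda>_. Pi\<^sub>E UNIV (\<lambda>_. F)))"
      using 1 unfolding \<tau> by (intro SigmaI UNIV_I)
  qed
  moreover have "finite (UNIV \<times> (Pi\<^sub>E (UNIV :: 'n set) (\<lambda>_. W)) \<times> (Pi\<^sub>E (UNIV :: 'n set) (\<lambda>_. Pi\<^sub>E (UNIV :: 'n set) (\<lambda>_. F))) :: ('n \<times> _) set)"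
    using fin by (intro finite_cartesian_product finite_PiE) auto
  ultimately show ?thesis by (rule finite_subset)
qed

text \<open>Stated for a triple outside the locale, so that constants for different labellings can
  be compared; monotonicity in \<open>C\<close> then allows taking a maximum.\<close>

definition sobolev_bound :: "'n::finite \<times> ('n \<Rightarrow> nat) \<times> ('n \<Rightarrow> 'n \<Rightarrow> real) \<Rightarrow> real \<Rightarrow> bool" where
  "sobolev_bound \<tau> C \<longleftrightarrow> (case \<tau> of (t0, om, B) \<Rightarrow>
     let p = 2 * real (kolmogorov.Q om) / (real (kolmogorov.Q om) - 2) in
     \<forall>f g S. kolmogorov.weak_sol t0 om B f g S \<longrightarrow>
       integrable lborel (\<lambda>x. \<bar>f x\<bar> powr p) \<and>
       (\<integral>x. \<bar>f x\<bar> powr p \<partial>lborel) powr (1 / p)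
         \<le> C * (sqrt (\<integral>x. (\<Sum>i\<in>kolmogorov.V om. (g i x)\<^sup>2) \<partial>lborel)
              + sqrt (\<integral>x. (\<Sum>i\<in>kolmogorov.V om. (S i x)\<^sup>2) \<partial>lborel)))"

lemma sobolev_bound_mono:
  assumes "sobolev_bound \<tau> C" "C \<le> C'" shows "sobolev_bound \<tau> C'"
proof -
  obtain t0 om B where \<tau>: "\<tau> = (t0, om, B)" by (cases \<tau>)
  have "x \<le> C' * (sqrt (\<integral>x. (\<Sum>i\<in>kolmogorov.V om. (g i x)\<^sup>2) \<partial>lborel) + sqrt (\<integral>x. (\<Sum>i\<in>kolmogorov.V om. (S i x)\<^sup>2) \<partial>lborel))"
    if "x \<le> C * (sqrt (\<integral>x. (\<Sum>i\<in>kolmogorov.V om. (g i x)\<^sup>2) \<partial>lborel) + sqrt (\<integral>x. (\<Sum>i\<in>kolmogorov.V om. (S i x)\<^sup>2) \<partial>lborel))"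
    for x and g S :: "'a \<Rightarrow> real^'a \<Rightarrow> real"
  proof -
    have "0 \<le> (\<integral>x. (\<Sum>i\<in>kolmogorov.V om. (h i x)\<^sup>2) \<partial>lborel)" for h :: "'a \<Rightarrow> real^'a \<Rightarrow> real"
      by (intro integral_nonneg_AE AE_I2 sum_nonneg) simp
    then show ?thesis
      using that assms(2) by (meson add_nonneg_nonneg mult_right_mono order_trans real_sqrt_ge_zero)
  qed
  then show ?thesis using assms(1) unfolding sobolev_bound_def \<tau> Let_def by blast
qed

theorem mainTheorem11:
  fixes k :: nat and d :: "nat \<Rightarrow> nat" and b :: "nat \<Rightarrow> nat \<Rightarrow> nat \<Rightarrow> real"
  assumes "k \<ge> 1" and "d 1 \<ge> 1" and "\<forall>j\<in>{1..<k}. d j \<le> d (Suc j)"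
    and "\<forall>j\<in>{1..<k}. full_row_rank (d j) (d (Suc j)) (b j)"
    and "CARD('n::finite) = 1 + (\<Sum>j\<in>{1..k}. d j)"
  shows "\<exists>C>0. \<forall>(idx :: nat \<Rightarrow> 'n) (f :: real^'n \<Rightarrow> real) (g :: nat \<Rightarrow> real^'n \<Rightarrow> real)
              (S :: nat \<Rightarrow> real^'n \<Rightarrow> real).
     bij_betw idx {..<1 + (\<Sum>j\<in>{1..k}. d j)} UNIV \<longrightarrow>
     L2 f \<longrightarrow> (\<forall>r<d k. L2 (g r)) \<longrightarrow>
     (\<forall>r<d k. \<forall>\<phi>. test_fun \<phi> \<longrightarrow>
        (\<integral>x. f x * partial (idx (gidx d k r)) \<phi> x \<partial>lborel) = - (\<integral>x. g r x * \<phi> x \<partial>lborel)) \<longrightarrow>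
     (\<forall>r<d k. L2 (S r)) \<longrightarrow>
     (\<forall>\<phi>. test_fun \<phi> \<longrightarrow>
        (\<integral>x. f x * (partial (idx 0) \<phi> x +
            (\<Sum>j\<in>{1..<k}. \<Sum>r<d j.
               (\<Sum>c<d (Suc j). b j r c * x $ idx (gidx d (Suc j) c)) * partial (idx (gidx d j r)) \<phi> x))
          \<partial>lborel)
        = (\<integral>x. (\<Sum>r<d k. S r x * partial (idx (gidx d k r)) \<phi> x) \<partial>lborel)) \<longrightarrow>
     (let \<kappa> = real (homdim k d) / (real (homdim k d) - 2) in
       integrable lborel (\<lambda>x. \<bar>f x\<bar> powr (2 * \<kappa>)) \<and>
       (\<integral>x. \<bar>f x\<bar> powr (2 * \<kappa>) \<partial>lborel) powr (1 / (2 * \<kappa>))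
         \<le> C * (sqrt (\<integral>x. (\<Sum>r<d k. (g r x)\<^sup>2) \<partial>lborel) + sqrt (\<integral>x. (\<Sum>r<d k. (S r x)\<^sup>2) \<partial>lborel)))"
proof -
  let ?A = "{(idx 0, block_coordinates.wt k d idx, block_coordinates.BB k d b idx) | idx :: nat \<Rightarrow> 'n.
     block_coordinates k d b idx}"
  have "\<exists>C>0. \<forall>\<tau>\<in>?A. sobolev_bound \<tau> C"
  proof (rule uniform_constant[OF finite_block_structures])
    fix \<tau> assume "\<tau> \<in> ?A"
    then obtain idx :: "nat \<Rightarrow> 'n" where \<tau>: "\<tau> = (idx 0, block_coordinates.wt k d idx, block_coordinates.BB k d b idx)"
      and "block_coordinates k d b idx" by blast
    then interpret block_coordinates k d b idx by simp
    show "\<exists>C>0. sobolev_bound \<tau> C"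
      using sobolev unfolding sobolev_bound_def \<tau> by (simp add: Let_def)
  qed (rule sobolev_bound_mono)
  then obtain C where C: "C > 0" "\<And>\<tau>. \<tau> \<in> ?A \<Longrightarrow> sobolev_bound \<tau> C" by blast
  show ?thesis
  proof (intro exI[of _ C] conjI C(1) allI impI, goal_cases)
    case (1 idx f g S)
    interpret block_coordinates k d b idx
      by standard (use assms 1(1) in auto)
    have "sobolev_bound (idx 0, wt, BB) C"
      using block_coordinates_axioms by (intro C(2)) blast
    then have "integrable lborel (\<lambda>x. \<bar>f x\<bar> powr (2 * real Q / (real Q - 2))) \<and>
       (\<integral>x. \<bar>f x\<bar> powr (2 * real Q / (real Q - 2)) \<partial>lborel) powr (1 / (2 * real Q / (real Q - 2)))
         \<le> C * (sqrt (\<integral>x. (\<Sum>i\<in>V. (g (snd (pos i)) x)\<^sup>2) \<partial>lborel)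
              + sqrt (\<integral>x. (\<Sum>i\<in>V. (S (snd (pos i)) x)\<^sup>2) \<partial>lborel))"
      using weak_solI[OF 1(2-6)] unfolding sobolev_bound_def Let_def prod.case by blast
    \<comment> \<open>Here \<open>2 * \<kappa>\<close> is the exponent
      \<open>2 * Q / (Q - 2)\<close> by \<open>Q_eq_homdim\<close>, and the sums over
      \<open>V\<close> become sums over the components of the last block.\<close>
    then show ?case
      by (simp add: Let_def Q_eq_homdim sum_V[of "\<lambda>i r. (g r _)\<^sup>2"] sum_V[of "\<lambda>i r. (S r _)\<^sup>2"])
  qed
qed

end
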